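(* Let $n\ge 1$ be an odd integer. Among the $2^{n+3}$ assignments of over/under data to the crossings of the free $2\ 1\ n$ knot, exactly $2\binom{n}{\frac{n-1}{2}}$ produce the figure eight knot, and, for every odd $k$ with $1\le k\le n$, exactly $2\binom{n}{\frac{n-k}{2}}$ produce the $2\ 1\ k$ knot.
   Context: Knots are not distinguished from their mirror images. For odd $m\geq 1$, the free $2\ 1\ m$ knot is the following planar closed curve with $m+3$ double points (the free closure of Conway's $2\ 1\ m$ tangle). Take a horizontal row of $m$ crossings: two parallel horizontal strands crossing each other $m$ times in succession, with four ends (upper-left, lower-left, upper-right, lower-right). Above the row place three further crossings $L$ (left), $R$ (right, at the same height as $L$) and $B$ (centered, below $L$ and $R$), each drawn as an $\mathsf{X}$ with ends NW, NE, SW, SE. Join, without further crossings: NE of $L$ to NW of $R$ by an inner arc; NW of $L$ to NE of $R$ by an outer arc passing above the inner one; SE of $L$ to NW of $B$; SW of $R$ to NE of $B$; SW of $B$ to the upper-left end of the row; SE of $B$ to the upper-right end of the row; SW of $L$ to the lower-left end of the row (around the left side); SE of $R$ to the lower-right end of the row (around the right side). An assignment is a choice, at each crossing, of which of the two strands is the overstrand; it produces a knot diagram. The $2\ 1\ k$ knot is the knot obtained from the free $2\ 1\ k$ knot by an alternating assignment; equivalently, the closure of the rational tangle with continued fraction $k+\frac{1}{1+\frac12}=\frac{3k+2}{3}$. The $2\ 1\ 1$ knot is the figure eight knot. *)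

theory Defs
  imports "HOL-Library.Multiset" "HOL-Library.FuncSet"
begin

section \<open>Knot diagrams\<close>

text \<open>
  A diagram on the sphere is given by its planar diagram code.  Its edges are numbered, and
  \<^item> \<open>Xing a b c d\<close> is a crossing at which the edges \<open>a, b, c, d\<close> end in this counterclockwise
    order, the understrand joining \<open>a\<close> to \<open>c\<close> and the overstrand joining \<open>b\<close> to \<open>d\<close>;
  \<^item> \<open>Joint a b\<close> is a marked point of the curve, at which the edges \<open>a\<close> and \<open>b\<close> meet.
  Joints carry no topological information.  They permit the Reidemeister moves to be stated as
  replacements of small pieces of a diagram by pieces with the same ends, and they permit a
  crossingless circle, \<open>[Joint a a]\<close>.
\<close>

datatype 'a vertex = Xing 'a 'a 'a 'a | Joint 'a 'a

type_synonym diagram = "nat vertex list"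

fun ends :: "'a vertex \<Rightarrow> 'a list" where
  "ends (Xing a b c d) = [a, b, c, d]"
| "ends (Joint a b) = [a, b]"

fun strands :: "'a vertex \<Rightarrow> ('a \<times> 'a) set" where
  "strands (Xing a b c d) = {(a, c), (b, d)}"
| "strands (Joint a b) = {(a, b)}"

definition edges :: "diagram \<Rightarrow> nat set" where
  "edges D = (\<Union>v\<in>set D. set (ends v))"

definition well_formed :: "diagram \<Rightarrow> bool" where
  "well_formed D \<longleftrightarrow> (\<forall>e\<in>edges D. count_list (concat (map ends D)) e = 2)"

definition one_component :: "diagram \<Rightarrow> bool" where
  "one_component D \<longleftrightarrow> D \<noteq> [] \<and>
     (\<forall>e\<in>edges D. \<forall>e'\<in>edges D.
        (e, e') \<in> ((\<Union>v\<in>set D. strands v) \<union> (\<Union>v\<in>set D. strands v)\<inverse>)\<^sup>*)"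

text \<open>
  \<open>(i, j)\<close> stands for the corner at the \<open>i\<close>-th vertex between its \<open>j\<close>-th end and the
  counterclockwise next one.  \<open>face_step\<close> walks along the boundary of a face: it leaves a corner
  along its \<open>j\<close>-th end, follows that edge to its other end, and arrives in the corner of which
  that other end is the counterclockwise last side.  It is a permutation of the corners, and its
  orbits are the faces.
\<close>

definition corners :: "diagram \<Rightarrow> (nat \<times> nat) set" where
  "corners D = {(i, j). i < length D \<and> j < length (ends (D ! i))}"

definition face_step :: "diagram \<Rightarrow> ((nat \<times> nat) \<times> (nat \<times> nat)) set" where
  "face_step D = {((i, j), (i', j')). (i, j) \<in> corners D \<and> (i', j') \<in> corners D \<and>
     (let k = Suc j' mod length (ends (D ! i')) in
        (i, j) \<noteq> (i', k) \<and> ends (D ! i) ! j = ends (D ! i') ! k)}"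

definition faces :: "diagram \<Rightarrow> (nat \<times> nat) set set" where
  "faces D = corners D // (face_step D)\<^sup>*"

text \<open>
  A one-component code is connected, so it comes from a diagram on the sphere iff its Euler
  characteristic (vertices minus edges plus faces) is 2.
\<close>

definition knot_diagram :: "diagram \<Rightarrow> bool" where
  "knot_diagram D \<longleftrightarrow> well_formed D \<and> one_component D \<and>
     length D + card (faces D) = card (edges D) + 2"


section \<open>Knots\<close>

text \<open>
  A crossing drawn as an X: the strand from NW to SE is the overstrand iff \<open>nwse_over\<close>.
\<close>

definition crossing :: "bool \<Rightarrow> 'a \<Rightarrow> 'a \<Rightarrow> 'a \<Rightarrow> 'a \<Rightarrow> 'a vertex" where
  "crossing nwse_over nw ne sw se =
     (if nwse_over then Xing sw se ne nw else Xing nw sw se ne)"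

text \<open>
  The first five rules only change the description of a diagram and the joints on it; the others
  are the Reidemeister moves.  In \<open>R3\<close> three strands run upwards from \<open>p1, p2, p3\<close> to
  \<open>q3, q2, q1\<close>, as in the braid relation; with \<open>s = False\<close> the strand from \<open>p1\<close> is on top and the
  one from \<open>p3\<close> at the bottom, with \<open>s = True\<close> it is the other way round.
  That the edges in the interior of a replaced piece occur nowhere else in the diagram is
  ensured by the well-formedness required in \<open>knot_step\<close>.
\<close>

inductive move :: "diagram \<Rightarrow> diagram \<Rightarrow> bool" where
  reorder: "mset D = mset D' \<Longrightarrow> move D D'"
| relabel: "inj_on f (edges D) \<Longrightarrow> move D (map (map_vertex f) D)"
| rotate_Xing: "move (Xing a b c d # D) (Xing c d a b # D)"
| rotate_Joint: "move (Joint a b # D) (Joint b a # D)"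
| remove_Joint: "a \<noteq> b \<Longrightarrow> move (Joint a b # D) (map (map_vertex (id(b := a))) D)"
| R1: "move (Xing x x a b # D) (Joint a b # D)"
| R1': "move (Xing a x x b # D) (Joint a b # D)"
| R2: "move (Xing c x y a # Xing y x d b # D) (Joint a b # Joint c d # D)"
| R3: "move (crossing s v u p1 p2 # crossing s w q3 u p3 # crossing s q1 q2 v w # D)
            (crossing s w v p2 p3 # crossing s q1 u p1 w # crossing s q2 q3 u v # D)"

fun switch :: "'a vertex \<Rightarrow> 'a vertex" where
  "switch (Xing a b c d) = Xing b c d a"
| "switch (Joint a b) = Joint a b"

text \<open>
  All intermediate diagrams have to be planar; in particular, a move \<open>R2\<close> can create crossings
  only between strands on the boundary of a common face.  Mirror images are identified.
\<close>

definition knot_step :: "diagram \<Rightarrow> diagram \<Rightarrow> bool" where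
  "knot_step D D' \<longleftrightarrow> knot_diagram D \<and> knot_diagram D' \<and> (move D D' \<or> D' = map switch D)"

definition same_knot :: "diagram \<Rightarrow> diagram \<Rightarrow> bool" (infix "\<approx>" 50) where
  "D \<approx> D' \<longleftrightarrow> equivclp knot_step D D'"

text \<open>The standard planar diagram code of \<open>4\<^sub>1\<close>.\<close>

definition figure_eight :: diagram where
  "figure_eight = [Xing 4 2 5 1, Xing 8 6 1 5, Xing 6 3 7 4, Xing 2 7 3 8]"

fun under_ends :: "'a vertex \<Rightarrow> 'a set" where
  "under_ends (Xing a b c d) = {a, c}"
| "under_ends (Joint a b) = {}"

fun over_ends :: "'a vertex \<Rightarrow> 'a set" where
  "over_ends (Xing a b c d) = {b, d}"
| "over_ends (Joint a b) = {}"

text \<open>For diagrams without joints: every edge leads from an overpass to an underpass.\<close>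

definition alternating :: "diagram \<Rightarrow> bool" where
  "alternating D \<longleftrightarrow>
     (\<forall>e\<in>edges D. (\<exists>v\<in>set D. e \<in> under_ends v) \<and> (\<exists>v\<in>set D. e \<in> over_ends v))"


section \<open>The free 2 1 m knot\<close>

text \<open>
  \<open>Left\<close>, \<open>Right\<close>, \<open>Bottom\<close> are the crossings above the row, and \<open>Row i\<close> (\<open>i < m\<close>) are those of
  the row, from left to right.  The upper strand of the row passes through the edges
  \<open>upper 0, \<dots>, upper m\<close>, where \<open>upper 0\<close> and \<open>upper m\<close> leave the row at its upper-left and
  upper-right end; likewise for the lower positions.
\<close>

datatype site = Left | Right | Bottom | Row nat

definition sites :: "nat \<Rightarrow> site list" where
  "sites m = [Left, Right, Bottom] @ map Row [0..<m]"

definition inner_arc :: nat where "inner_arc = 0"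
definition outer_arc :: nat where "outer_arc = 1"
definition left_bottom :: nat where "left_bottom = 2"
definition right_bottom :: nat where "right_bottom = 3"
definition upper :: "nat \<Rightarrow> nat" where "upper j = 4 + 2 * j"
definition lower :: "nat \<Rightarrow> nat" where "lower j = 5 + 2 * j"

text \<open>The arguments of \<open>crossing s\<close> are the edges at NW, NE, SW and SE.\<close>

fun site_crossing :: "nat \<Rightarrow> bool \<Rightarrow> site \<Rightarrow> nat vertex" where
  "site_crossing m s Left = crossing s outer_arc inner_arc (lower 0) left_bottom"
| "site_crossing m s Right = crossing s inner_arc outer_arc right_bottom (lower m)"
| "site_crossing m s Bottom = crossing s left_bottom right_bottom (upper 0) (upper m)"
| "site_crossing m s (Row i) = crossing s (upper i) (upper (Suc i)) (lower i) (lower (Suc i))"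

definition assignments :: "nat \<Rightarrow> (site \<Rightarrow> bool) set" where
  "assignments m = set (sites m) \<rightarrow>\<^sub>E UNIV"

definition free21 :: "nat \<Rightarrow> (site \<Rightarrow> bool) \<Rightarrow> diagram" where
  "free21 m \<alpha> = map (\<lambda>s. site_crossing m (\<alpha> s) s) (sites m)"

text \<open>
  The diagram represents the 2 1 k knot.  There are two alternating assignments, and they give
  mirror images.
\<close>

definition is_21_knot :: "nat \<Rightarrow> diagram \<Rightarrow> bool" where
  "is_21_knot k D \<longleftrightarrow> (\<exists>\<alpha>\<in>assignments k. alternating (free21 k \<alpha>) \<and> D \<approx> free21 k \<alpha>)"

end

theory Submission
  imports Defs Complex_Main "HOL-Combinatorics.List_Permutation"
begin

text \<open>
  Adjacent opposite crossings of the row cancel by a second Reidemeister move, so an assignment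
  whose top part alternates (two choices) and whose row has \<open>k\<close> more crossings of the alternating type
  than of the other one gives the 2 1 k knot; there are \<open>n choose ((n - k) div 2)\<close> such rows.
  The 2 1 1 diagram is the standard diagram of the figure eight knot up to renumbering.

  That no other assignment gives a 2 1 k knot is shown by the Kauffman bracket at loop value 3, that
  is, for \<open>A\<^sup>2 + A\<^sup>-\<^sup>2 = -3\<close>.  For this value it is a state sum over the colourings of the edges by three
  colours.  A first Reidemeister move multiplies the bracket at \<open>A\<close> by \<open>-A\<^sup>3\<close> or its inverse, the bracket at
  \<open>A\<^sup>-\<^sup>1\<close> by the inverse factor, and mirror images exchange the two; hence their product is an
  invariant of unoriented knots up to mirror images.  With \<open>x = A\<^sup>4\<close> its values are combinations of
  the integers \<open>x\<^sup>n + x\<^sup>-\<^sup>n\<close>.  On the 2 1 k knots it is larger than 9 and strictly increasing in \<open>k\<close>; on all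
  other knots that occur it is at most 9.
\<close>

section \<open>Edges and their ends\<close>

text \<open>Colours replace the count of circles in a state, so every move becomes a local identity
  between sums of Kronecker deltas; this asks for a loop value that is a positive integer. The
  values 1 and 2 say nothing: they correspond to the Jones polynomial at a primitive cube root of
  unity and at 1, where it equals 1 on all knots. Three colours are the first to separate knots, and
  as A is then not a root of unity, the values grow with the number of crossings. The second
  obstacle is that \<open>knot_step\<close> demands planarity of every diagram it touches, for rows
  of arbitrary length. Faces are counted by hand for a single assignment on each free curve. A
  crossing change only rotates the ends of a vertex and so keeps the faces, and the codes with
  joints that arise while two crossings cancel inherit planarity from the shorter diagram at the
  end, by inserting joints into it.\<close>

lemma edges_simps [simp]:
  "edges [] = {}"
  "edges (v # D) = set (ends v) \<union> edges D"
  by (auto simp: edges_def)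

lemma finite_edges [simp]: "finite (edges D)"
  by (auto simp: edges_def)

lemma set_ends_map_vertex: "set (ends (map_vertex g v)) = g ` set (ends v)"
  by (cases v) auto

lemma edges_map_vertex: "edges (map (map_vertex g) D) = g ` edges D"
  by (induction D) (auto simp: set_ends_map_vertex)

lemma edges_map_switch [simp]: "edges (map switch D) = edges D"
proof (induction D)
  case (Cons v D)
  then show ?case by (cases v) auto
qed simp

lemma count_list_eq_0_edges: "count_list (concat (map ends D)) e = 0 \<longleftrightarrow> e \<notin> edges D"
  by (auto simp: edges_def count_list_0_iff)

lemma well_formed_count:
  "well_formed D \<longleftrightarrow> (\<forall>e. count_list (concat (map ends D)) e \<in> {0, 2})"
  using count_list_eq_0_edges[of D] by (auto simp: well_formed_def)

text \<open>An edge that a replaced piece already shows twice cannot occur outside it. This makes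
  the interior edges of \<open>R2\<close> and \<open>R3\<close> bound variables whose colours can be
  summed out.\<close>

lemma well_formed_twice:
  assumes "well_formed D" "mset (concat (map ends D)) = {#e, e#} + M"
  shows "e \<notin># M"
proof -
  have "count (mset (concat (map ends D))) e \<in> {0, 2}"
    using assms(1) by (simp only: well_formed_count count_mset)
  then show ?thesis unfolding assms(2) by (simp add: not_in_iff)
qed

section \<open>The bracket with three colours\<close>

abbreviation kron :: "nat \<Rightarrow> nat \<Rightarrow> 'r::comm_ring_1" where
  "kron i j \<equiv> of_bool (i = j)"

text \<open>The two summands are the smoothings of the crossing: edges joined by a smoothing must
  share their colour. Summing over the colours turns every closed circle into a factor 3.\<close>

fun weight :: "'r::comm_ring_1 \<Rightarrow> 'r \<Rightarrow> ('a \<Rightarrow> nat) \<Rightarrow> 'a vertex \<Rightarrow> 'r" where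
  "weight A B f (Xing a b c d) =
     A * (kron (f a) (f b) * kron (f c) (f d)) + B * (kron (f b) (f c) * kron (f d) (f a))"
| "weight A B f (Joint a b) = kron (f a) (f b)"

abbreviation weights :: "'r::comm_ring_1 \<Rightarrow> 'r \<Rightarrow> (nat \<Rightarrow> nat) \<Rightarrow> diagram \<Rightarrow> 'r" where
  "weights A B f D \<equiv> prod_list (map (weight A B f) D)"

definition labellings :: "nat set \<Rightarrow> (nat \<Rightarrow> nat) set" where
  "labellings E = E \<rightarrow>\<^sub>E {..<3}"

definition bracket :: "'r::comm_ring_1 \<Rightarrow> 'r \<Rightarrow> diagram \<Rightarrow> 'r" where
  "bracket A B D = (\<Sum>f\<in>labellings (edges D). weights A B f D)"

lemma weight_map_vertex: "weight A B f (map_vertex g v) = weight A B (f \<circ> g) v"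
  by (cases v) auto

lemma weights_map_vertex: "weights A B f (map (map_vertex g) D) = weights A B (f \<circ> g) D"
  by (simp add: weight_map_vertex comp_def)

lemma weight_cong: "(\<And>e. e \<in> set (ends v) \<Longrightarrow> f e = g e) \<Longrightarrow> weight A B f v = weight A B g v"
  by (cases v) auto

lemma weights_cong: "(\<And>e. e \<in> edges D \<Longrightarrow> f e = g e) \<Longrightarrow> weights A B f D = weights A B g D"
  by (induction D) (auto intro!: arg_cong2[where f="(*)"] weight_cong)

lemma weights_fun_upd: "x \<notin> edges D \<Longrightarrow> weights A B (f(x := c)) D = weights A B f D"
  by (rule weights_cong) auto

lemma sum_labellings_insert:
  assumes "x \<notin> E"
  shows "(\<Sum>f\<in>labellings (insert x E). g f) = (\<Sum>f\<in>labellings E. \<Sum>c<3. g (f(x := c)))"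
proof -
  have "(\<Sum>f\<in>labellings (insert x E). g f) =
      sum g ((\<lambda>(c, f). f(x := c)) ` ({..<3} \<times> (E \<rightarrow>\<^sub>E {..<3})))"
    unfolding labellings_def PiE_insert_eq ..
  also have "\<dots> = sum (g \<circ> (\<lambda>(c, f). f(x := c))) ({..<3} \<times> (E \<rightarrow>\<^sub>E {..<3}))"
    by (rule sum.reindex) (rule inj_combinator[OF assms])
  also have "\<dots> = (\<Sum>c<3. \<Sum>f\<in>E \<rightarrow>\<^sub>E {..<3}. g (f(x := c)))"
    by (simp add: sum.cartesian_product case_prod_unfold comp_def)
  also have "\<dots> = (\<Sum>f\<in>labellings E. \<Sum>c<3. g (f(x := c)))"
    unfolding labellings_def by (rule sum.swap)
  finally show ?thesis .
qed

lemma labellings_less: "f \<in> labellings E \<Longrightarrow> e \<in> E \<Longrightarrow> f e < 3"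
  by (auto simp: labellings_def PiE_def Pi_def)

lemma bracket_eqI:
  assumes "edges D = E" and "edges D' = E"
    and "\<And>f. f \<in> labellings E \<Longrightarrow> weights A B f D = weights A' B' f D'"
  shows "bracket A B D = bracket A' B' D'"
  using assms by (auto simp: bracket_def intro!: sum.cong)

section \<open>Changes of the description and of the joints\<close>

lemma bracket_reorder:
  assumes "mset D = mset D'" shows "bracket A B D = bracket A B D'"
proof (rule bracket_eqI[where E="edges D'"])
  show "edges D = edges D'" using mset_eq_setD[OF assms] by (simp add: edges_def)
  show "weights A B f D = weights A B f D'" for f
    using assms by (metis mset_map prod_mset_prod_list)
qed simp

lemma bracket_relabel:
  assumes "inj_on g (edges D)"
  shows "bracket A B (map (map_vertex g) D) = bracket A B D"
  unfolding bracket_def edges_map_vertex weights_map_vertex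
proof (rule sum.reindex_bij_witness[where
      i="\<lambda>f. \<lambda>e\<in>g ` edges D. f (inv_into (edges D) g e)" and j="\<lambda>f. \<lambda>e\<in>edges D. f (g e)"])
  fix f assume f: "f \<in> labellings (g ` edges D)"
  show "(\<lambda>e\<in>g ` edges D. (\<lambda>e\<in>edges D. f (g e)) (inv_into (edges D) g e)) = f"
  proof
    fix e show "(\<lambda>e\<in>g ` edges D. (\<lambda>e\<in>edges D. f (g e)) (inv_into (edges D) g e)) e = f e"
      using f assms by (cases "e \<in> g ` edges D")
        (auto simp: labellings_def PiE_def extensional_def)
  qed
  show "(\<lambda>e\<in>edges D. f (g e)) \<in> labellings (edges D)"
    using f by (auto simp: labellings_def PiE_def Pi_def)
  show "weights A B (\<lambda>e\<in>edges D. f (g e)) D = weights A B (f \<circ> g) D"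
    by (rule weights_cong) auto
next
  fix f assume f: "f \<in> labellings (edges D)"
  show "(\<lambda>e\<in>edges D. (\<lambda>e\<in>g ` edges D. f (inv_into (edges D) g e)) (g e)) = f"
  proof
    fix e show "(\<lambda>e\<in>edges D. (\<lambda>e\<in>g ` edges D. f (inv_into (edges D) g e)) (g e)) e = f e"
      using f assms by (cases "e \<in> edges D")
        (auto simp: labellings_def PiE_def extensional_def)
  qed
  show "(\<lambda>e\<in>g ` edges D. f (inv_into (edges D) g e)) \<in> labellings (g ` edges D)"
    using f assms by (auto simp: labellings_def PiE_def Pi_def)
qed

lemma bracket_switch: "bracket A B (map switch D) = bracket B A D"
proof (rule bracket_eqI)
  show "weights A B f (map switch D) = weights B A f D" for f
  proof (induction D)
    case (Cons v D)
    then show ?case by (cases v) (auto simp: algebra_simps)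
  qed simp
qed simp_all

text \<open>The delta of the joint forces the colour of \<open>b\<close> to be that of
  \<open>a\<close>, so summing out \<open>b\<close> is a substitution. Well-formedness supplies
  another occurrence of \<open>a\<close>, which keeps the colour of \<open>a\<close> among the
  summation variables.\<close>

lemma bracket_remove_Joint:
  assumes wf: "well_formed (Joint a b # D)" and ab: "a \<noteq> b"
  shows "bracket A B (Joint a b # D) = bracket A B (map (map_vertex (id(b := a))) D)"
proof -
  let ?g = "id(b := a)"
  let ?E = "?g ` edges D"
  have "count_list (concat (map ends (Joint a b # D))) a \<in> {0, 2}"
    using wf by (simp only: well_formed_count)
  then have "count_list (concat (map ends D)) a = 1" using ab by auto
  then have a: "a \<in> edges D" using count_list_eq_0_edges[of D a] by force
  then have aE: "a \<in> ?E" using ab by force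
  have E: "edges (Joint a b # D) = insert b ?E" using a by auto
  have b: "b \<notin> ?E" using ab by auto
  have "bracket A B (Joint a b # D) =
      (\<Sum>f\<in>labellings ?E. \<Sum>c<3. weights A B (f(b := c)) (Joint a b # D))"
    unfolding bracket_def E by (rule sum_labellings_insert[OF b])
  also have "\<dots> = (\<Sum>f\<in>labellings ?E. weights A B (f \<circ> ?g) D)"
  proof (rule sum.cong[OF refl])
    fix f assume f: "f \<in> labellings ?E"
    have "(\<Sum>c<3. weights A B (f(b := c)) (Joint a b # D)) =
        (\<Sum>c<3. if f a = c then weights A B (f(b := c)) D else 0)"
      using ab by (intro sum.cong) auto
    also have "\<dots> = weights A B (f(b := f a)) D"
      using labellings_less[OF f aE] by (simp add: sum.delta)
    also have "f(b := f a) = f \<circ> ?g" by auto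
    finally show "(\<Sum>c<3. weights A B (f(b := c)) (Joint a b # D)) = weights A B (f \<circ> ?g) D" .
  qed
  also have "\<dots> = bracket A B (map (map_vertex ?g) D)"
    by (simp only: bracket_def edges_map_vertex weights_map_vertex)
  finally show ?thesis .
qed

section \<open>The Reidemeister moves as identities between colour sums\<close>

lemma sum_kron:
  fixes g :: "nat \<Rightarrow> 'r::comm_ring_1"
  assumes "i < 3"
  shows "(\<Sum>u<3. kron i u * g u) = g i" "(\<Sum>u<3. kron u i * g u) = g i"
proof -
  have "(\<Sum>u<3. kron i u * g u) = (\<Sum>u<3. if i = u then g u else 0)"
    by (rule sum.cong) auto
  then show "(\<Sum>u<3. kron i u * g u) = g i" using assms by simp
  have "(\<Sum>u<3. kron u i * g u) = (\<Sum>u<3. if i = u then g u else 0)"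
    by (rule sum.cong) auto
  then show "(\<Sum>u<3. kron u i * g u) = g i" using assms by simp
qed

text \<open>Common form of both kinks: one smoothing leaves \<open>x\<close> as a separate circle,
  hence the factor 3, the other inserts it into the strand. If AB = 1 and A^2 + B^2 = -3, the
  resulting factors \<open>3 * A + B\<close> and \<open>3 * B + A\<close> are -A^3 and -B^3.\<close>

lemma bracket_loop:
  assumes v: "\<And>f. weight A B f v = P * kron (f a) (f b) + Q * (kron (f a) (f x) * kron (f b) (f x))"
    and ends: "set (ends v) = {x, a, b}" and x: "a \<noteq> x" "b \<noteq> x" "x \<notin> edges D"
  shows "bracket A B (v # D) = (3 * P + Q) * bracket A B (Joint a b # D)"
proof -
  let ?E = "edges (Joint a b # D)"
  have E: "edges (v # D) = insert x ?E" using ends by auto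
  have "bracket A B (v # D) =
      (\<Sum>f\<in>labellings ?E. \<Sum>c<3. weights A B (f(x := c)) (v # D))"
    unfolding bracket_def E by (rule sum_labellings_insert) (use x in auto)
  also have "\<dots> = (\<Sum>f\<in>labellings ?E. (3 * P + Q) * weights A B f (Joint a b # D))"
  proof (rule sum.cong[OF refl])
    fix f assume f: "f \<in> labellings ?E"
    have a: "f a < 3" using labellings_less[OF f] by auto
    have "(\<Sum>c<3. weights A B (f(x := c)) (v # D)) =
        (\<Sum>c<3. P * kron (f a) (f b) * weights A B f D +
           Q * (kron (f a) c * (kron (f b) c * weights A B f D)))"
      using x by (intro sum.cong) (auto simp: v weights_fun_upd algebra_simps)
    also have "\<dots> = 3 * P * kron (f a) (f b) * weights A B f D +
        Q * (kron (f b) (f a) * weights A B f D)"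
      by (simp only: sum.distrib sum_kron[OF a] flip: sum_distrib_left) (simp add: algebra_simps)
    finally show "(\<Sum>c<3. weights A B (f(x := c)) (v # D)) =
        (3 * P + Q) * weights A B f (Joint a b # D)"
      by (simp add: algebra_simps)
  qed
  also have "\<dots> = (3 * P + Q) * bracket A B (Joint a b # D)"
    by (simp only: bracket_def sum_distrib_left)
  finally show ?thesis .
qed

lemma bracket_R1:
  assumes wf: "well_formed (Xing x x a b # D)"
  shows "bracket A B (Xing x x a b # D) = (3 * A + B) * bracket A B (Joint a b # D)"
proof (rule bracket_loop[where x=x])
  have "count_list (concat (map ends (Xing x x a b # D))) x \<in> {0, 2}"
    using wf by (simp only: well_formed_count)
  then show "a \<noteq> x" "b \<noteq> x" "x \<notin> edges D"
    by (auto simp flip: count_list_eq_0_edges split: if_splits)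
qed (auto simp: algebra_simps)

lemma bracket_R1':
  assumes wf: "well_formed (Xing a x x b # D)"
  shows "bracket A B (Xing a x x b # D) = (3 * B + A) * bracket A B (Joint a b # D)"
proof (rule bracket_loop[where x=x])
  have "count_list (concat (map ends (Xing a x x b # D))) x \<in> {0, 2}"
    using wf by (simp only: well_formed_count)
  then show "a \<noteq> x" "b \<noteq> x" "x \<notin> edges D"
    by (auto simp flip: count_list_eq_0_edges split: if_splits)
qed (auto simp: algebra_simps)

text \<open>The weight of a crossing with the edges \<open>i, j, k, l\<close> at NW, NE, SW and SE, seen as a linear
  combination of two vertical strands and of a cup over a cap.\<close>

definition braid :: "'r::comm_ring_1 \<Rightarrow> 'r \<Rightarrow> nat \<Rightarrow> nat \<Rightarrow> nat \<Rightarrow> nat \<Rightarrow> 'r" where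
  "braid A B i j k l = A * (kron i k * kron j l) + B * (kron i j * kron k l)"

lemma weight_crossing:
  "weight A B f (crossing s i j k l) =
     (if s then braid B A (f i) (f j) (f k) (f l) else braid A B (f i) (f j) (f k) (f l))"
  by (auto simp: crossing_def braid_def algebra_simps)

lemma braid_flip:
  "braid A B i j k l = braid A B j i l k" "braid A B i j k l = braid A B k l i j"
  by (auto simp: braid_def algebra_simps)

lemma sum_braid:
  assumes "j < 3" "k < 3"
  shows "(\<Sum>i<3. braid A B i j k l * g i) = A * kron j l * g k + B * kron k l * g j"
proof -
  have "(\<Sum>i<3. braid A B i j k l * g i) =
      (\<Sum>i<3. A * kron j l * (kron i k * g i) + B * kron k l * (kron i j * g i))"
    by (intro sum.cong) (auto simp: braid_def algebra_simps)
  also have "\<dots> = A * kron j l * g k + B * kron k l * g j"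
    by (simp only: sum.distrib sum_kron assms flip: sum_distrib_left)
  finally show ?thesis .
qed

text \<open>Joining the two lower ends of a crossing makes a kink.\<close>

lemma sum_braid_diag:
  assumes "i < 3"
  shows "(\<Sum>u<3. braid A B i j u u) = (A + 3 * B) * kron i j"
proof -
  have "(\<Sum>u<3. braid A B i j u u) = (\<Sum>u<3. A * (kron i u * kron j u) + B * kron i j)"
    by (simp add: braid_def)
  also have "\<dots> = A * kron j i + 3 * B * kron i j"
    by (simp only: sum.distrib sum_kron assms flip: sum_distrib_left) (simp add: algebra_simps)
  finally show ?thesis by (auto simp: algebra_simps)
qed

text \<open>After the crossings are smoothed, both sides lie in the span of the five planar pairings
  of the six ends. They differ only in the two pairings where one strand runs straight up beside a
  cup and a cap, and the difference carries the factor B (A^2 + B^2 + 3 A B) = 0.\<close>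

lemma yang_baxter:
  fixes A B :: "'r::comm_ring_1"
  assumes AB: "A * B = 1" "A * A + B * B = -3"
    and p: "p1 < 3" "p2 < 3" "p3 < 3" and q: "q1 < 3" "q2 < 3" "q3 < 3"
  shows "(\<Sum>u<3. \<Sum>w<3. \<Sum>v<3. braid A B v u p1 p2 * (braid A B w q3 u p3 * braid A B q1 q2 v w)) =
    (\<Sum>w<3. \<Sum>u<3. \<Sum>v<3. braid A B w v p2 p3 * (braid A B q1 u p1 w * braid A B q2 q3 u v))"
    (is "?L = ?R")
proof -
  have "?L = (\<Sum>u<3. \<Sum>w<3. braid A B w q3 u p3 *
      (A * kron u p2 * braid A B q1 q2 p1 w + B * kron p1 p2 * braid A B q1 q2 u w))"
    by (intro sum.cong refl) (subst sum_braid, use p in \<open>auto simp: algebra_simps\<close>)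
  also have "\<dots> = (\<Sum>u<3. kron u p2 * (A * A * kron q3 p3 * braid A B q1 q2 p1 u)
      + A * B * kron p1 p2 * kron q3 p3 * braid A B q1 q2 u u
      + kron u p3 * (B * (A * kron u p2 * braid A B q1 q2 p1 q3 + B * kron p1 p2 * braid A B q1 q2 u q3)))"
    by (intro sum.cong refl) (subst sum_braid, use q in \<open>auto simp: algebra_simps\<close>)
  also have "\<dots> = A * A * kron q3 p3 * braid A B q1 q2 p1 p2
      + A * B * kron p1 p2 * kron q3 p3 * ((A + 3 * B) * kron q1 q2)
      + B * (A * kron p3 p2 * braid A B q1 q2 p1 q3 + B * kron p1 p2 * braid A B q1 q2 p3 q3)"
    by (simp only: sum.distrib sum_kron sum_braid_diag p q flip: sum_distrib_left)
  finally have L: "?L = \<dots>" .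
  have "?R = (\<Sum>w<3. \<Sum>u<3. braid A B q1 u p1 w *
      (A * kron w p2 * braid A B q2 q3 u p3 + B * kron p2 p3 * braid A B q2 q3 u w))"
    by (subst braid_flip(1), intro sum.cong refl)
      (subst sum_braid, use p in \<open>auto simp: algebra_simps\<close>)
  also have "\<dots> = (\<Sum>w<3. kron w p2 * (A * A * kron p1 q1 * braid A B q2 q3 w p3)
      + A * B * kron p2 p3 * kron p1 q1 * braid A B q2 q3 w w
      + kron w p1 * (B * (A * kron w p2 * braid A B q2 q3 q1 p3 + B * kron p2 p3 * braid A B q2 q3 q1 w)))"
    by (subst braid_flip(1), intro sum.cong refl)
      (subst sum_braid, use q in \<open>auto simp: algebra_simps\<close>)
  also have "\<dots> = A * A * kron p1 q1 * braid A B q2 q3 p2 p3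
      + A * B * kron p2 p3 * kron p1 q1 * ((A + 3 * B) * kron q2 q3)
      + B * (A * kron p1 p2 * braid A B q2 q3 q1 p3 + B * kron p2 p3 * braid A B q2 q3 q1 p1)"
    by (simp only: sum.distrib sum_kron sum_braid_diag p q flip: sum_distrib_left)
  finally have R: "?R = \<dots>" .
  have "B * (A * A + B * B + 3 * (A * B)) = 0" unfolding AB by simp
  then have z: "A * B * (A + 3 * B) + B * B * B = 0" by (simp add: algebra_simps)
  have kron_commute: "(kron i j :: 'r) = kron j i" for i j by (simp add: eq_commute)
  \<comment> \<open>The deltas are abstracted to ring variables, which leaves a polynomial identity
    modulo \<open>z\<close>.\<close>
  have *: "A * A * d33 * (A * (d11 * d22) + B * (q12 * p12)) + A * B * p12 * d33 * ((A + 3 * B) * q12)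
      + B * (A * p23 * (A * (d11 * q23) + B * (q12 * d13)) + B * p12 * (A * (d31 * q23) + B * (q12 * d33))) =
      A * A * d11 * (A * (d22 * d33) + B * (q23 * p23)) + A * B * p23 * d11 * ((A + 3 * B) * q23)
      + B * (A * p12 * (A * (q12 * d33) + B * (q23 * d31)) + B * p23 * (A * (q12 * d13) + B * (q23 * d11)))"
    (is "?l = ?r") for d11 d22 d33 p12 q12 p23 q23 d13 d31 :: 'r
  proof -
    have "?l = ?r + (A * B * (A + 3 * B) + B * B * B) * (q12 * p12 * d33 - q23 * p23 * d11)"
      by (simp add: algebra_simps)
    then show ?thesis unfolding z by simp
  qed
  show ?thesis unfolding L R unfolding braid_def
    using *[of "kron q3 p3" "kron q1 p1" "kron q2 p2" "kron q1 q2" "kron p1 p2" "kron p3 p2" "kron q2 q3"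
        "kron p1 q3" "kron q1 p3"]
    by (simp only: kron_commute[of p1 q1] kron_commute[of p2 p3] kron_commute[of q2 q1]
        kron_commute[of q3 p1] kron_commute[of p3 q3])
qed

text \<open>Of the four smoothings of two cancelling crossings, one gives the pairing of the
  right-hand side, with weight AB = 1. The other three give the other pairing, with weights A^2, B^2
  and 3 A B, where the 3 comes from a circle that splits off.\<close>

lemma cup_cap:
  fixes A B :: "'r::comm_ring_1"
  assumes AB: "A * B = 1" "A * A + B * B = -3" and "i < 3" "j < 3" "k < 3" "l < 3"
  shows "(\<Sum>x<3. \<Sum>y<3. (A * (kron k x * kron y i) + B * (kron x y * kron i k)) *
      (A * (kron y x * kron l j) + B * (kron x l * kron j y))) = kron i j * kron k l"
    (is "?L = _")
proof -
  have "?L = (\<Sum>x<3. \<Sum>y<3. kron i y * (A * A * kron l j * (kron x y * kron k x) +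
      A * B * (kron k x * kron x l * kron j y)) + kron x y * (A * B * kron i k * kron l j) +
      kron x y * (B * B * kron i k * (kron x l * kron j y)))"
    by (intro sum.cong refl) (auto simp: algebra_simps)
  also have "\<dots> = (\<Sum>x<3. A * A * kron l j * (kron x i * kron k x) +
      A * B * (kron k x * kron x l * kron j i) + A * B * kron i k * kron l j +
      B * B * kron i k * (kron x l * kron j x))"
    by (intro sum.cong refl) (simp only: sum.distrib sum_kron assms lessThan_iff)
  also have "\<dots> = (\<Sum>x<3. kron k x * (A * A * kron l j * kron x i + A * B * (kron x l * kron j i)) +
      A * B * kron i k * kron l j + kron l x * (B * B * kron i k * kron j x))"
    by (intro sum.cong refl) (auto simp: algebra_simps)
  also have "\<dots> = A * A * kron l j * kron k i + A * B * (kron k l * kron j i) +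
      3 * (A * B * kron i k * kron l j) + B * B * kron i k * kron j l"
    by (simp only: sum.distrib sum_kron assms) (simp add: algebra_simps)
  also have "\<dots> = (A * A + B * B + 3 * (A * B)) * (kron i k * kron j l) + A * B * (kron i j * kron k l)"
    by (auto simp: algebra_simps)
  finally show ?thesis unfolding AB by simp
qed

lemma bracket_R2:
  fixes A B :: "'r::comm_ring_1"
  assumes AB: "A * B = 1" "A * A + B * B = -3"
    and wf: "well_formed (Xing c x y a # Xing y x d b # D)"
  shows "bracket A B (Xing c x y a # Xing y x d b # D) = bracket A B (Joint a b # Joint c d # D)"
    (is "bracket A B ?D = bracket A B ?D'")
proof -
  let ?E = "edges ?D'"
  have "x \<notin># {#c, y, a, y, d, b#} + mset (concat (map ends D))"
    by (rule well_formed_twice[OF wf]) simp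
  moreover have "y \<notin># {#c, x, a, x, d, b#} + mset (concat (map ends D))"
    by (rule well_formed_twice[OF wf]) simp
  ultimately have x: "x \<noteq> a" "x \<noteq> b" "x \<noteq> c" "x \<noteq> d" "x \<notin> edges D" "x \<noteq> y"
    and y: "y \<noteq> a" "y \<noteq> b" "y \<noteq> c" "y \<noteq> d" "y \<notin> edges D"
    by (auto simp: edges_def)
  have E: "edges ?D = insert y (insert x ?E)" by auto
  have "bracket A B ?D = (\<Sum>f\<in>labellings (insert x ?E). \<Sum>j<3. weights A B (f(y := j)) ?D)"
    unfolding bracket_def E by (rule sum_labellings_insert) (use x y in auto)
  also have "\<dots> = (\<Sum>f\<in>labellings ?E. \<Sum>i<3. \<Sum>j<3. weights A B (f(x := i, y := j)) ?D)"
    by (rule sum_labellings_insert) (use x y in auto)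
  also have "\<dots> = (\<Sum>f\<in>labellings ?E. weights A B f ?D')"
  proof (rule sum.cong[OF refl])
    fix f assume f: "f \<in> labellings ?E"
    have "(\<Sum>i<3. \<Sum>j<3. weights A B (f(x := i, y := j)) ?D) =
      (\<Sum>i<3. \<Sum>j<3. (A * (kron (f c) i * kron j (f a)) + B * (kron i j * kron (f a) (f c))) *
        (A * (kron j i * kron (f d) (f b)) + B * (kron i (f d) * kron (f b) j))) * weights A B f D"
      using x y by (simp add: weights_fun_upd sum_distrib_right mult.assoc)
    also have "\<dots> = weights A B f ?D'"
      by (subst cup_cap[OF AB]) (auto intro: labellings_less[OF f] simp: mult.assoc)
    finally show "(\<Sum>i<3. \<Sum>j<3. weights A B (f(x := i, y := j)) ?D) = weights A B f ?D'" .
  qed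
  finally show ?thesis by (simp only: bracket_def)
qed

lemma bracket_R3:
  fixes A B :: "'r::comm_ring_1"
  assumes AB: "A * B = 1" "A * A + B * B = -3"
    and wf: "well_formed (crossing s v u p1 p2 # crossing s w q3 u p3 # crossing s q1 q2 v w # D)"
  shows "bracket A B (crossing s v u p1 p2 # crossing s w q3 u p3 # crossing s q1 q2 v w # D) =
    bracket A B (crossing s w v p2 p3 # crossing s q1 u p1 w # crossing s q2 q3 u v # D)"
    (is "bracket A B ?D = bracket A B ?D'")
proof -
  let ?P = "{p1, p2, p3, q1, q2, q3}"
  let ?E = "?P \<union> edges D"
  have set_ends_crossing: "set (ends (crossing s i j k l)) = {i, j, k, l}" for s i j k l
    by (auto simp: crossing_def)
  have mset_ends: "mset (ends (crossing s i j k l)) = {#i, j, k, l#}" for s i j k l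
    by (auto simp: crossing_def)
  let ?M = "mset (concat (map ends D))"
  have "u \<notin># {#v, p1, p2, w, q3, p3, q1, q2, v, w#} + ?M"
    by (rule well_formed_twice[OF wf]) (simp add: mset_ends)
  moreover have "v \<notin># {#u, p1, p2, w, q3, u, p3, q1, q2, w#} + ?M"
    by (rule well_formed_twice[OF wf]) (simp add: mset_ends)
  moreover have "w \<notin># {#v, u, p1, p2, q3, u, p3, q1, q2, v#} + ?M"
    by (rule well_formed_twice[OF wf]) (simp add: mset_ends)
  ultimately have u: "u \<notin> ?E" and v: "v \<notin> ?E" and w: "w \<notin> ?E" and "u \<noteq> v" "u \<noteq> w" "v \<noteq> w"
    by (auto simp: edges_def)
  have E: "edges ?D = insert v (insert w (insert u ?E))" "edges ?D' = insert v (insert w (insert u ?E))"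
    by (auto simp: set_ends_crossing)
  have uvw: "v \<notin> insert w (insert u ?E)" "w \<notin> insert u ?E" "u \<notin> ?E"
    using u v w \<open>u \<noteq> v\<close> \<open>u \<noteq> w\<close> \<open>v \<noteq> w\<close> by auto
  have sum: "bracket A B C = (\<Sum>f\<in>labellings ?E. \<Sum>i<3. \<Sum>k<3. \<Sum>j<3. weights A B (f(u := i, w := k, v := j)) C)"
    if "edges C = insert v (insert w (insert u ?E))" for C
    unfolding bracket_def that by (simp only: sum_labellings_insert[OF uvw(1)] sum_labellings_insert[OF uvw(2)]
        sum_labellings_insert[OF uvw(3)])
  show ?thesis unfolding sum[OF E(1)] sum[OF E(2)]
  proof (rule sum.cong[OF refl])
    fix f assume f: "f \<in> labellings ?E"
    have less: "f p1 < 3" "f p2 < 3" "f p3 < 3" "f q1 < 3" "f q2 < 3" "f q3 < 3"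
      by (auto intro: labellings_less[OF f])
    have D: "weights A B (f(u := i, w := k, v := j)) D = weights A B f D" for i j k
      by (rule weights_cong) (use u v w in auto)
    have ne: "e \<noteq> u" "e \<noteq> v" "e \<noteq> w" if "e \<in> ?P" for e using that u v w by auto
    have BA: "B * A = 1" "B * B + A * A = -3" using AB by (simp_all add: algebra_simps)
    note [simp] = \<open>u \<noteq> v\<close> \<open>u \<noteq> w\<close> \<open>v \<noteq> w\<close> not_sym[OF \<open>u \<noteq> v\<close>] not_sym[OF \<open>u \<noteq> w\<close>]
      not_sym[OF \<open>v \<noteq> w\<close>] ne
    \<comment> \<open>The parameter \<open>s\<close> only exchanges A and B, and the relations
      assumed for them are symmetric.\<close>
    let ?A = "if s then B else A" and ?B = "if s then A else B"
    have W: "weight A B g (crossing s i j k l) = braid ?A ?B (g i) (g j) (g k) (g l)" for g i j k l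
      by (simp add: weight_crossing)
    have "(\<Sum>i<3. \<Sum>k<3. \<Sum>j<3. weights A B (f(u := i, w := k, v := j)) ?D) =
      (\<Sum>i<3. \<Sum>k<3. \<Sum>j<3. braid ?A ?B j i (f p1) (f p2) *
        (braid ?A ?B k (f q3) i (f p3) * braid ?A ?B (f q1) (f q2) j k)) * weights A B f D"
      by (simp add: W D sum_distrib_right mult.assoc)
    also have "\<dots> = (\<Sum>k<3. \<Sum>i<3. \<Sum>j<3. braid ?A ?B k j (f p2) (f p3) *
        (braid ?A ?B (f q1) i (f p1) k * braid ?A ?B (f q2) (f q3) i j)) * weights A B f D"
      by (subst yang_baxter) (use AB BA less in auto)
    also have "\<dots> = (\<Sum>k<3. \<Sum>i<3. \<Sum>j<3. weights A B (f(u := i, w := k, v := j)) ?D')"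
      by (simp add: W D sum_distrib_right mult.assoc)
    also have "\<dots> = (\<Sum>i<3. \<Sum>k<3. \<Sum>j<3. weights A B (f(u := i, w := k, v := j)) ?D')"
      by (rule sum.swap)
    finally show "(\<Sum>i<3. \<Sum>k<3. \<Sum>j<3. weights A B (f(u := i, w := k, v := j)) ?D) =
      (\<Sum>i<3. \<Sum>k<3. \<Sum>j<3. weights A B (f(u := i, w := k, v := j)) ?D')" .
  qed
qed

section \<open>Invariance of the product of the two brackets\<close>

definition bracket_norm :: "'r::comm_ring_1 \<Rightarrow> 'r \<Rightarrow> diagram \<Rightarrow> 'r" where
  "bracket_norm A B D = bracket A B D * bracket B A D"

lemma bracket_norm_move:
  fixes A B :: "'r::comm_ring_1"
  assumes AB: "A * B = 1" "A * A + B * B = -3"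
    and "move D D'" and wf: "well_formed D"
  shows "bracket_norm A B D = bracket_norm A B D'"
proof -
  have BA: "B * A = 1" "B * B + A * A = -3" using AB by (simp_all add: algebra_simps)
  \<comment> \<open>A kink scales the brackets at (A, B) and at (B, A) by these two factors, which
    are inverse to each other.\<close>
  have "(3 * A + B) * (3 * B + A) = 10 * (A * B) + 3 * (A * A + B * B)"
    by (simp add: algebra_simps)
  then have 1: "(3 * A + B) * (3 * B + A) = 1" unfolding AB by simp
  have 2: "(3 * A + B) * x * ((3 * B + A) * y) = x * y" for x y
  proof -
    have "(3 * A + B) * x * ((3 * B + A) * y) = ((3 * A + B) * (3 * B + A)) * (x * y)"
      by (simp only: mult_ac)
    then show ?thesis unfolding 1 by simp
  qed
  from \<open>move D D'\<close> show ?thesis unfolding bracket_norm_def using wf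
  proof (induction rule: move.induct)
    case (reorder D D')
    then show ?case using bracket_reorder by metis
  next
    case (rotate_Xing a b c d D)
    have "bracket A B (Xing a b c d # D) = bracket A B (Xing c d a b # D)" for A B :: 'r
      by (rule bracket_eqI) (auto simp: algebra_simps)
    then show ?case by metis
  next
    case (rotate_Joint a b D)
    have "bracket A B (Joint a b # D) = bracket A B (Joint b a # D)" for A B :: 'r
      by (rule bracket_eqI) (auto simp: algebra_simps)
    then show ?case by metis
  next
    case (R1 x a b D)
    then show ?case by (simp only: bracket_R1 2)
  next
    case (R1' a x b D)
    then show ?case by (simp only: bracket_R1') (metis 2 mult.commute)
  next
    case (R2 c x y a d b D)
    then show ?case using bracket_R2[OF AB] bracket_R2[OF BA] by metis
  next
    case (R3 s v u p1 p2 w q3 p3 q1 q2 D)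
    then show ?case by (simp only: bracket_R3[OF AB R3] bracket_R3[OF BA R3])
  qed (simp_all add: bracket_relabel bracket_remove_Joint)
qed

lemma bracket_norm_same_knot:
  fixes A B :: "'r::comm_ring_1"
  assumes AB: "A * B = 1" "A * A + B * B = -3" and "D \<approx> D'"
  shows "bracket_norm A B D = bracket_norm A B D'"
proof -
  have step: "bracket_norm A B D = bracket_norm A B D'" if "knot_step D D'" for D D'
    using that bracket_norm_move[OF AB]
    by (auto simp: knot_step_def knot_diagram_def bracket_norm_def bracket_switch mult.commute)
  have "equivclp knot_step D D'" using \<open>D \<approx> D'\<close> by (simp add: same_knot_def)
  then show ?thesis
    by (induction rule: equivclp_induct) (auto dest: step)
qed

section \<open>Planarity\<close>

text \<open>Pairs \<open>(i, j)\<close> name corners and ends alike. In these terms a step from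
  \<open>c\<close> to \<open>c'\<close> says that \<open>turn D c'\<close> is the other end of the
  edge at \<open>c\<close>, so stepping is the exchange of the two ends of an edge followed by the
  inverse of \<open>turn\<close>.\<close>

definition end_at :: "diagram \<Rightarrow> nat \<times> nat \<Rightarrow> nat" where
  "end_at D c = ends (D ! fst c) ! snd c"

definition turn :: "diagram \<Rightarrow> nat \<times> nat \<Rightarrow> nat \<times> nat" where
  "turn D c = (fst c, Suc (snd c) mod length (ends (D ! fst c)))"

lemma ends_not_Nil [simp]: "ends v \<noteq> []"
  by (cases v) auto

lemma in_corners: "c \<in> corners D \<longleftrightarrow> fst c < length D \<and> snd c < length (ends (D ! fst c))"
  by (cases c) (auto simp: corners_def)

lemma face_step_iff:
  "(c, c') \<in> face_step D \<longleftrightarrow>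
     c \<in> corners D \<and> c' \<in> corners D \<and> c \<noteq> turn D c' \<and> end_at D c = end_at D (turn D c')"
  by (cases c; cases c') (auto simp: face_step_def turn_def end_at_def Let_def)

lemma finite_corners [simp]: "finite (corners D)"
proof -
  have "corners D = (SIGMA i:{..<length D}. {..<length (ends (D ! i))})"
    by (auto simp: corners_def)
  then show ?thesis by simp
qed

lemma turn_in_corners [simp]: "c \<in> corners D \<Longrightarrow> turn D c \<in> corners D"
  by (auto simp: in_corners turn_def)

lemma bij_betw_turn: "bij_betw (turn D) (corners D) (corners D)"
proof -
  have "inj_on (turn D) (corners D)"
    by (auto simp: inj_on_def in_corners turn_def mod_Suc split: if_splits)
  moreover have "turn D ` corners D \<subseteq> corners D" by auto
  ultimately show ?thesis
    by (simp add: bij_betw_def endo_inj_surj)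
qed

lemma corners_Cons: "corners (v # D) = Pair 0 ` {..<length (ends v)} \<union> apfst Suc ` corners D"
  (is "?L = ?R")
proof (rule set_eqI)
  fix c show "c \<in> ?L \<longleftrightarrow> c \<in> ?R"
    by (cases c; cases "fst c") (auto simp: corners_def image_iff apfst_def map_prod_def)
qed

lemma end_at_Cons [simp]:
  "end_at (v # D) (0, j) = ends v ! j" "end_at (v # D) (apfst Suc c) = end_at D c"
  by (simp_all add: end_at_def)

lemma turn_Cons [simp]:
  "turn (v # D) (0, j) = (0, Suc j mod length (ends v))"
  "turn (v # D) (apfst Suc c) = apfst Suc (turn D c)"
  by (simp_all add: turn_def)

lemma card_nth_eq: "card {j. j < length xs \<and> xs ! j = e} = count_list xs e"
  by (simp add: count_list_eq_length_filter length_filter_conv_card eq_commute)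

lemma card_slots: "card {c \<in> corners D. end_at D c = e} = count_list (concat (map ends D)) e"
proof (induction D)
  case Nil
  then show ?case by (simp add: corners_def)
next
  case (Cons v D)
  let ?A = "{j. j < length (ends v) \<and> ends v ! j = e}" and ?B = "{c \<in> corners D. end_at D c = e}"
  have "{c \<in> corners (v # D). end_at (v # D) c = e} = Pair 0 ` ?A \<union> apfst Suc ` ?B"
    by (auto simp: corners_Cons simp del: apfst_conv)
  moreover have "card (Pair (0::nat) ` ?A \<union> apfst Suc ` ?B) = card (Pair (0::nat) ` ?A) + card (apfst Suc ` ?B)"
    by (rule card_Un_disjoint) auto
  moreover have "card (Pair (0::nat) ` ?A) = card ?A" by (rule card_image) (auto simp: inj_on_def)
  moreover have "card (apfst Suc ` ?B) = card ?B" by (rule card_image) (auto simp: inj_on_def)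
  ultimately show ?case using Cons by (simp add: card_nth_eq)
qed

lemma end_at_image: "end_at D ` corners D = edges D"
proof (induction D)
  case (Cons v D)
  have "ends v ! j \<in> set (ends v)" if "j < length (ends v)" for j using that by simp
  moreover have "set (ends v) = (\<lambda>j. ends v ! j) ` {..<length (ends v)}"
    by (auto simp: in_set_conv_nth)
  ultimately show ?case
    by (simp add: corners_Cons image_Un image_image Cons del: apfst_conv)
qed (auto simp: corners_def)

lemma well_formed_slots:
  "well_formed D \<longleftrightarrow> (\<forall>e\<in>edges D. card {c \<in> corners D. end_at D c = e} = 2)"
  by (simp add: well_formed_def card_slots)

text \<open>In a well-formed code every edge has exactly two ends, so passing to the other end is an
  involution. Composed with the inverse of the bijection \<open>turn\<close> it is a permutation of
  the corners.\<close>

lemma face_step_functional: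
  assumes wf: "well_formed D" and c: "c \<in> corners D"
  shows "\<exists>!c'. (c, c') \<in> face_step D" "\<exists>!c'. (c', c) \<in> face_step D"
proof -
  have other: "\<exists>!s. s \<in> corners D \<and> s \<noteq> c \<and> end_at D s = end_at D c" if "c \<in> corners D" for c
  proof -
    have "card {s \<in> corners D. end_at D s = end_at D c} = 2"
      using wf that end_at_image by (auto simp: well_formed_slots)
    then obtain x y where xy: "{s \<in> corners D. end_at D s = end_at D c} = {x, y}" "x \<noteq> y"
      by (auto simp: card_2_iff)
    with that have "c = x \<or> c = y" by blast
    then show ?thesis
    proof
      assume "c = x" then show ?thesis using xy by (intro ex1I[of _ y]) blast+
    next
      assume "c = y" then show ?thesis using xy by (intro ex1I[of _ x]) blast+
    qed
  qed
  obtain s where s: "s \<in> corners D" "s \<noteq> c" "end_at D s = end_at D c"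
    and s_uniq: "\<And>t. t \<in> corners D \<Longrightarrow> t \<noteq> c \<Longrightarrow> end_at D t = end_at D c \<Longrightarrow> t = s"
    using other[OF c] by metis
  obtain c' where c': "c' \<in> corners D" "turn D c' = s"
    using s bij_betw_turn by (metis bij_betw_iff_bijections)
  show "\<exists>!c'. (c, c') \<in> face_step D"
  proof (rule ex1I)
    show "(c, c') \<in> face_step D" using c c' s by (auto simp: face_step_iff)
    fix d assume "(c, d) \<in> face_step D"
    then have d: "d \<in> corners D" "turn D d \<noteq> c" "end_at D (turn D d) = end_at D c"
      by (auto simp: face_step_iff)
    then have "turn D d = s" by (intro s_uniq) auto
    then show "d = c'" using c' d(1) bij_betw_turn[of D] by (auto simp: bij_betw_def inj_on_def)
  qed
  have tc: "turn D c \<in> corners D" using c by simp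
  show "\<exists>!c'. (c', c) \<in> face_step D"
    using other[OF tc] c by (auto simp: face_step_iff)
qed

text \<open>The set reachable from \<open>y\<close> is finite and mapped into itself by an injective
  successor function, hence onto itself; the preimage of \<open>y\<close> in it can only be
  \<open>x\<close>. Thus \<open>faces\<close> consists of the orbits of a permutation.\<close>

lemma face_step_rtrancl_sym:
  assumes wf: "well_formed D" and "(c, c') \<in> (face_step D)\<^sup>*"
  shows "(c', c) \<in> (face_step D)\<^sup>*"
  using assms(2)
proof (induction rule: rtrancl_induct)
  case (step x y)
  let ?R = "face_step D"
  let ?T = "?R\<^sup>* `` {y}"
  define p where "p = (\<lambda>c. THE c'. (c, c') \<in> ?R)"
  have p: "(c, c') \<in> ?R \<longleftrightarrow> p c = c'" if "c \<in> corners D" for c c'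
    using theI'[OF face_step_functional(1)[OF wf that]] face_step_functional(1)[OF wf that]
    unfolding p_def by blast
  have sub: "?R \<subseteq> corners D \<times> corners D" by (auto simp: face_step_iff)
  have x: "x \<in> corners D" and y: "y \<in> corners D" using step(2) sub by auto
  have T: "?T \<subseteq> corners D"
  proof
    fix z assume "z \<in> ?T"
    then have "(y, z) \<in> ?R\<^sup>*" by simp
    then show "z \<in> corners D" by (induction rule: rtrancl_induct) (use y sub in auto)
  qed
  have "p ` ?T \<subseteq> ?T"
  proof
    fix z assume "z \<in> p ` ?T"
    then obtain w where "(y, w) \<in> ?R\<^sup>*" "z = p w" by auto
    moreover have "w \<in> corners D" using T calculation by auto
    moreover have "(w, p w) \<in> ?R" using p calculation by blast
    ultimately show "z \<in> ?T" by (auto intro: rtrancl_into_rtrancl)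
  qed
  moreover have inj: "inj_on p (corners D)"
  proof (rule inj_onI)
    fix u v assume uv: "u \<in> corners D" "v \<in> corners D" "p u = p v"
    then have "(u, p u) \<in> ?R" "(v, p u) \<in> ?R" using p by auto
    moreover have "p u \<in> corners D" using sub calculation by auto
    ultimately show "u = v" using face_step_functional(2)[OF wf] by blast
  qed
  moreover have "finite ?T" by (rule finite_subset[OF T finite_corners])
  ultimately have "p ` ?T = ?T"
    by (intro endo_inj_surj) (auto intro: inj_on_subset[OF _ T])
  then obtain z where z: "z \<in> ?T" "p z = y" by (metis ImageI imageE rtrancl.rtrancl_refl singletonI)
  have "p x = y" using p step(2) x by simp
  with z inj x T have "z = x" by (auto simp: inj_on_def)
  with z have "(y, x) \<in> ?R\<^sup>*" by simp
  then show ?case using step.IH by simp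
qed simp

text \<open>Compares numbers of classes along a map that is onto up to equivalence. It serves for
  isomorphic codes, for the insertion of a joint, and for counting the faces of a concrete diagram
  against a set of numbers.\<close>

lemma card_quotient_rtrancl_eq:
  assumes into: "h ` X \<subseteq> Y"
    and onto: "\<And>y. y \<in> Y \<Longrightarrow> \<exists>x\<in>X. (y, h x) \<in> S\<^sup>* \<and> (h x, y) \<in> S\<^sup>*"
    and iff: "\<And>x x'. x \<in> X \<Longrightarrow> x' \<in> X \<Longrightarrow> (x, x') \<in> R\<^sup>* \<longleftrightarrow> (h x, h x') \<in> S\<^sup>*"
  shows "card (X // R\<^sup>*) = card (Y // S\<^sup>*)"
proof -
  have X: "X // R\<^sup>* = (\<lambda>x. R\<^sup>* `` {x}) ` X" by (auto simp: quotient_def)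
  have "Y // S\<^sup>* = (\<lambda>y. S\<^sup>* `` {y}) ` Y" by (auto simp: quotient_def)
  also have "\<dots> = (\<lambda>x. S\<^sup>* `` {h x}) ` X"
  proof (intro equalityI subsetI)
    fix C assume "C \<in> (\<lambda>y. S\<^sup>* `` {y}) ` Y"
    then obtain y where y: "y \<in> Y" "C = S\<^sup>* `` {y}" by auto
    obtain x where "x \<in> X" "(y, h x) \<in> S\<^sup>*" "(h x, y) \<in> S\<^sup>*" using onto[OF y(1)] by auto
    then have "x \<in> X" "C = S\<^sup>* `` {h x}" using y(2) by (auto intro: rtrancl_trans)
    then show "C \<in> (\<lambda>x. S\<^sup>* `` {h x}) ` X" by auto
  qed (use into in auto)
  finally have Y: "Y // S\<^sup>* = (\<lambda>x. S\<^sup>* `` {h x}) ` X" .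
  have "bij_betw (\<lambda>C. S\<^sup>* `` (h ` (C \<inter> X))) (X // R\<^sup>*) (Y // S\<^sup>*)"
    unfolding X Y
  proof (rule bij_betw_imageI)
    have eq: "S\<^sup>* `` (h ` (R\<^sup>* `` {x} \<inter> X)) = S\<^sup>* `` {h x}" if "x \<in> X" for x
      using that iff by (auto intro: rtrancl_trans)
    show "inj_on (\<lambda>C. S\<^sup>* `` (h ` (C \<inter> X))) ((\<lambda>x. R\<^sup>* `` {x}) ` X)"
    proof (rule inj_onI, clarsimp simp: eq)
      fix x x' assume "x \<in> X" "x' \<in> X" "S\<^sup>* `` {h x} = S\<^sup>* `` {h x'}"
      then have "(h x, h x') \<in> S\<^sup>*" "(h x', h x) \<in> S\<^sup>*" by auto
      with \<open>x \<in> X\<close> \<open>x' \<in> X\<close> have "(x, x') \<in> R\<^sup>*" "(x', x) \<in> R\<^sup>*" using iff by auto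
      then show "R\<^sup>* `` {x} = R\<^sup>* `` {x'}" by (auto intro: rtrancl_trans)
    qed
    show "(\<lambda>C. S\<^sup>* `` (h ` (C \<inter> X))) ` (\<lambda>x. R\<^sup>* `` {x}) ` X = (\<lambda>x. S\<^sup>* `` {h x}) ` X"
      unfolding image_image by (rule image_cong) (auto simp: eq)
  qed
  then show ?thesis by (rule bij_betw_same_card)
qed

section \<open>Transport of planarity along isomorphisms of codes\<close>

lemma rtrancl_map_prod: "(x, y) \<in> R\<^sup>* \<Longrightarrow> (f x, f y) \<in> (map_prod f f ` R)\<^sup>*"
  by (induction rule: rtrancl_induct) (auto intro: rtrancl_into_rtrancl)

text \<open>Symmetrised at each vertex, because a rotation of the ends can reverse a strand and
  preserves only this union.\<close>

definition strand_rel :: "diagram \<Rightarrow> (nat \<times> nat) set" where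
  "strand_rel D = (\<Union>v\<in>set D. strands v \<union> (strands v)\<inverse>)"

lemma one_component_strand_rel:
  "one_component D \<longleftrightarrow> D \<noteq> [] \<and> (\<forall>e\<in>edges D. \<forall>e'\<in>edges D. (e, e') \<in> (strand_rel D)\<^sup>*)"
proof -
  have "strand_rel D = (\<Union>v\<in>set D. strands v) \<union> (\<Union>v\<in>set D. strands v)\<inverse>"
    by (auto simp: strand_rel_def)
  then show ?thesis by (simp add: one_component_def)
qed

text \<open>\<open>\<pi>\<close> permutes the vertices, \<open>r i\<close> rotates the ends of the \<open>i\<close>-th one, and \<open>f\<close> renames the
  edges.\<close>

lemma knot_diagram_isomorphic:
  assumes kd: "knot_diagram D" and len: "length D' = length D"
    and \<pi>: "bij_betw \<pi> {..<length D} {..<length D}" and f: "inj_on f (edges D)"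
    and ends: "\<And>i. i < length D \<Longrightarrow> ends (D' ! \<pi> i) = map f (rotate (r i) (ends (D ! i)))"
    and strands: "\<And>i. i < length D \<Longrightarrow> strands (D' ! \<pi> i) \<union> (strands (D' ! \<pi> i))\<inverse> =
      map_prod f f ` (strands (D ! i) \<union> (strands (D ! i))\<inverse>)"
  shows "knot_diagram D'"
proof -
  let ?n = "length D"
  let ?L = "\<lambda>i. length (ends (D ! i))"
  \<comment> \<open>Rotation by \<open>r\<close> moves the end at position \<open>j\<close> to
    \<open>j - r\<close>; adding \<open>?L i\<close> before subtracting the reduced \<open>r\<close>
    keeps the subtraction of naturals exact.\<close>
  define h where "h = (\<lambda>(i, j). (\<pi> i, (j + ?L i - r i mod ?L i) mod ?L i))"
  have L: "length (ends (D' ! \<pi> i)) = ?L i" if "i < ?n" for i using ends[OF that] by simp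
  have \<pi>_less: "\<pi> i < ?n" if "i < ?n" for i using \<pi> that by (auto simp: bij_betw_def)
  have mod_shift: "(r + (j + l - r mod l) mod l) mod l = j" if "j < l" for r j l :: nat
  proof -
    have "(r + (j + l - r mod l) mod l) mod l = (r mod l + (j + l - r mod l)) mod l"
      by (metis mod_add_left_eq mod_add_right_eq)
    also have "r mod l + (j + l - r mod l) = j + l" using that mod_less_divisor[of l r] by linarith
    finally show ?thesis using that by simp
  qed
  have h_in: "h c \<in> corners D'" if "c \<in> corners D" for c
    using that by (auto simp: h_def corners_def L \<pi>_less len)
  have h_end: "end_at D' (h c) = f (end_at D c)" if "c \<in> corners D" for c
    using that
    by (auto simp: h_def corners_def end_at_def ends nth_rotate mod_shift add.commute)
  have h_turn: "h (turn D c) = turn D' (h c)" if "c \<in> corners D" for c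
  proof -
    obtain i j where "c = (i, j)" by fastforce
    with that have ij: "c = (i, j)" "i < ?n" by (simp_all add: corners_def)
    let ?r = "r i mod ?L i"
    have le: "?r \<le> ?L i" using mod_less_divisor[of "?L i" "r i"] by simp
    then have "(Suc j mod ?L i + ?L i - ?r) mod ?L i = (Suc j mod ?L i + (?L i - ?r)) mod ?L i" by simp
    also have "\<dots> = (Suc j + (?L i - ?r)) mod ?L i" by (rule mod_add_left_eq)
    also have "Suc j + (?L i - ?r) = Suc (j + ?L i - ?r)" using le by simp
    finally show ?thesis using ij by (simp add: h_def turn_def L mod_Suc_eq)
  qed
  have "inj_on h (corners D)"
  proof (rule inj_onI)
    fix c c' assume c: "c \<in> corners D" "c' \<in> corners D" and eq: "h c = h c'"
    obtain i j i' j' where ij: "c = (i, j)" "c' = (i', j')" by fastforce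
    have "i = i'" using eq c ij \<pi> by (auto simp: h_def corners_def bij_betw_def inj_on_def)
    moreover have "j = j'"
      using eq c ij \<open>i = i'\<close> mod_shift[of j "?L i" "r i"] mod_shift[of j' "?L i" "r i"]
      by (auto simp: h_def corners_def)
    ultimately show "c = c'" using ij by simp
  qed
  moreover have "corners D' \<subseteq> h ` corners D"
  proof
    fix c' assume c': "c' \<in> corners D'"
    obtain i' j' where ij': "c' = (i', j')" by fastforce
    have "i' < ?n" using c' ij' len by (auto simp: corners_def)
    then have "i' \<in> \<pi> ` {..<?n}" using \<pi> by (simp add: bij_betw_def)
    then obtain i where i: "i < ?n" "\<pi> i = i'" by auto
    have j': "j' < ?L i" using c' ij' i L by (auto simp: corners_def)
    let ?j = "(r i + j') mod ?L i"
    have "(?j + ?L i - r i mod ?L i) mod ?L i = j'"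
    proof -
      have less: "r i mod ?L i \<le> ?L i" using j' mod_less_divisor[of "?L i" "r i"] by linarith
      then have "(?j + ?L i - r i mod ?L i) mod ?L i = (?j + (?L i - r i mod ?L i)) mod ?L i" by simp
      also have "\<dots> = (r i + j' + (?L i - r i mod ?L i)) mod ?L i" by (rule mod_add_left_eq)
      also have "\<dots> = (r i mod ?L i + (j' + (?L i - r i mod ?L i))) mod ?L i"
        by (metis add.assoc mod_add_left_eq)
      also have "r i mod ?L i + (j' + (?L i - r i mod ?L i)) = j' + ?L i" using less by linarith
      finally show ?thesis using j' by simp
    qed
    then have "h (i, ?j) = c'" using ij' i by (simp add: h_def)
    moreover have "(i, ?j) \<in> corners D" using i by (simp add: corners_def)
    ultimately show "c' \<in> h ` corners D" by force
  qed
  ultimately have h: "bij_betw h (corners D) (corners D')"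
    using h_in by (auto simp: bij_betw_def)
  have h_step: "(h c, h c') \<in> face_step D' \<longleftrightarrow> (c, c') \<in> face_step D"
    if c: "c \<in> corners D" "c' \<in> corners D" for c c'
  proof -
    have "turn D c' \<in> corners D" using c by simp
    moreover have "end_at D c \<in> edges D" "end_at D (turn D c') \<in> edges D"
      using c calculation end_at_image by blast+
    ultimately show ?thesis
      using c h h_end f
      by (auto simp: face_step_iff h_in bij_betw_def inj_on_eq_iff inj_onD simp flip: h_turn)
  qed
  have h_rtrancl: "(h c, h c') \<in> (face_step D')\<^sup>* \<longleftrightarrow> (c, c') \<in> (face_step D)\<^sup>*"
    if c: "c \<in> corners D" "c' \<in> corners D" for c c'
  proof
    assume "(c, c') \<in> (face_step D)\<^sup>*"
    then show "(h c, h c') \<in> (face_step D')\<^sup>*"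
    proof (induction rule: rtrancl_induct)
      case (step y z)
      then have "y \<in> corners D" "z \<in> corners D" by (auto simp: face_step_iff)
      then show ?case using step h_step by (meson rtrancl.rtrancl_into_rtrancl)
    qed simp
  next
    assume "(h c, h c') \<in> (face_step D')\<^sup>*"
    then have "\<exists>d\<in>corners D. h c' = h d \<and> (c, d) \<in> (face_step D)\<^sup>*"
    proof (induction rule: rtrancl_induct)
      case (step y z)
      then obtain d where d: "d \<in> corners D" "y = h d" "(c, d) \<in> (face_step D)\<^sup>*" by auto
      have "z \<in> corners D'" using step by (auto simp: face_step_iff)
      then have "z \<in> h ` corners D" using h by (simp add: bij_betw_def)
      then obtain d' where "d' \<in> corners D" "z = h d'" by blast
      moreover from this have "(d, d') \<in> face_step D" using d step(2) h_step by simp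
      ultimately show ?case using d by (blast intro: rtrancl_into_rtrancl)
    qed (use c in auto)
    then show "(c, c') \<in> (face_step D)\<^sup>*"
      using h c by (auto simp: bij_betw_def inj_on_eq_iff)
  qed
  have faces: "card (faces D) = card (faces D')"
    unfolding faces_def
  proof (rule card_quotient_rtrancl_eq[where h=h])
    fix c' assume "c' \<in> corners D'"
    then have "c' \<in> h ` corners D" using h by (simp add: bij_betw_def)
    then show "\<exists>c\<in>corners D. (c', h c) \<in> (face_step D')\<^sup>* \<and> (h c, c') \<in> (face_step D')\<^sup>*" by blast
  qed (use h in \<open>simp_all add: h_rtrancl bij_betw_def\<close>)
  have edges: "edges D' = f ` edges D"
  proof -
    have "edges D' = end_at D' ` h ` corners D" using h end_at_image by (auto simp: bij_betw_def)
    also have "\<dots> = f ` end_at D ` corners D" unfolding image_image by (rule image_cong) (auto simp: h_end)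
    finally show ?thesis using end_at_image by simp
  qed
  have "well_formed D'" unfolding well_formed_slots edges
  proof clarify
    fix e assume e: "e \<in> edges D"
    have "{c \<in> corners D'. end_at D' c = f e} = h ` {c \<in> corners D. end_at D c = e}"
    proof -
      have "end_at D c \<in> edges D" if "c \<in> corners D" for c using that end_at_image by blast
      then have "f (end_at D c) = f e \<longleftrightarrow> end_at D c = e" if "c \<in> corners D" for c
        using that f e by (simp add: inj_on_eq_iff)
      moreover have "corners D' = h ` corners D" using h by (simp add: bij_betw_def)
      ultimately show ?thesis using h_end by auto
    qed
    moreover have "card (h ` {c \<in> corners D. end_at D c = e}) = card {c \<in> corners D. end_at D c = e}"
      using h by (intro card_image) (auto simp: bij_betw_def intro: inj_on_subset)
    ultimately show "card {c \<in> corners D'. end_at D' c = f e} = 2"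
      using kd e by (simp add: knot_diagram_def well_formed_slots)
  qed
  moreover have "strand_rel D' = map_prod f f ` strand_rel D"
  proof -
    let ?s = "\<lambda>v. strands v \<union> (strands v)\<inverse>"
    have "set D' = (\<lambda>i. D' ! i) ` \<pi> ` {..<?n}"
      using \<pi> len by (auto simp: set_conv_nth bij_betw_def)
    then have "set D' = (\<lambda>i. D' ! \<pi> i) ` {..<?n}" by (simp add: image_image)
    moreover have "set D = (\<lambda>i. D ! i) ` {..<?n}" by (auto simp: set_conv_nth)
    ultimately
    have "strand_rel D' = (\<Union>i<?n. ?s (D' ! \<pi> i))" "strand_rel D = (\<Union>i<?n. ?s (D ! i))"
      unfolding strand_rel_def by simp_all
    then show ?thesis using strands by (simp add: image_UN)
  qed
  then have "one_component D'"
    using kd len by (auto simp: knot_diagram_def one_component_strand_rel edges intro: rtrancl_map_prod)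
  moreover have "card (edges D') = card (edges D)" unfolding edges by (rule card_image[OF f])
  ultimately show ?thesis using kd faces len by (simp add: knot_diagram_def)
qed

lemma knot_diagram_reorder:
  assumes "mset D = mset D'" and "knot_diagram D"
  shows "knot_diagram D'"
proof -
  obtain \<pi> where \<pi>: "bij_betw \<pi> {..<length D} {..<length D'}" "\<forall>i<length D. D ! i = D' ! \<pi> i"
    using permutation_Ex_bij[OF assms(1)] by blast
  have "length D' = length D" using assms(1) by (metis size_mset)
  then show ?thesis
    using \<pi> assms(2)
    by (intro knot_diagram_isomorphic[of D D' \<pi> id "\<lambda>_. 0"]) (auto simp: prod.map_id0)
qed

lemma strands_map_vertex: "strands (map_vertex f v) = map_prod f f ` strands v"
  by (cases v) auto

lemma ends_map_vertex: "ends (map_vertex f v) = map f (ends v)"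
  by (cases v) auto

lemma knot_diagram_relabel:
  assumes "inj_on f (edges D)" and "knot_diagram D"
  shows "knot_diagram (map (map_vertex f) D)"
  by (rule knot_diagram_isomorphic[OF assms(2), where \<pi>=id and f=f and r="\<lambda>_. 0"])
    (use assms in \<open>auto simp: strands_map_vertex ends_map_vertex image_Un\<close>)

lemma knot_diagram_relabel_iff:
  assumes "inj_on f (edges D)"
  shows "knot_diagram (map (map_vertex f) D) \<longleftrightarrow> knot_diagram D"
proof
  let ?g = "inv_into (edges D) f"
  assume "knot_diagram (map (map_vertex f) D)"
  moreover have "inj_on ?g (edges (map (map_vertex f) D))"
    by (simp add: edges_map_vertex inj_on_inv_into)
  ultimately have "knot_diagram (map (map_vertex ?g) (map (map_vertex f) D))"
    by (rule knot_diagram_relabel[rotated])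
  moreover have "map (map_vertex ?g) (map (map_vertex f) D) = map (map_vertex id) D"
  proof -
    have "map_vertex (?g \<circ> f) v = map_vertex id v" if "v \<in> set D" for v
    proof (rule vertex.map_cong[OF refl])
      fix e assume "e \<in> set_vertex v"
      moreover have "set_vertex v = set (ends v)" by (cases v) auto
      ultimately have "e \<in> edges D" using that by (auto simp: edges_def)
      then show "(?g \<circ> f) e = id e" using assms by simp
    qed
    then show ?thesis by (simp add: vertex.map_comp)
  qed
  ultimately show "knot_diagram D" by (simp add: vertex.map_id0)
qed (rule knot_diagram_relabel[OF assms])

text \<open>Rotating a crossing by one place exchanges its over- and understrand, so this transfers
  planarity between all assignments on the same curve.\<close>

lemma knot_diagram_rotate_vertices:
  assumes kd: "knot_diagram D" and len: "length D' = length D"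
    and ends: "\<And>i. i < length D \<Longrightarrow> ends (D' ! i) = rotate (r i) (ends (D ! i))"
    and strands: "\<And>i. i < length D \<Longrightarrow>
      strands (D' ! i) \<union> (strands (D' ! i))\<inverse> = strands (D ! i) \<union> (strands (D ! i))\<inverse>"
  shows "knot_diagram D'"
  by (rule knot_diagram_isomorphic[OF kd len, where \<pi>=id and f=id and r=r])
    (use ends strands in \<open>auto simp: prod.map_id0\<close>)

lemma knot_diagram_rotate_Xing:
  assumes "knot_diagram (Xing a b c d # D)"
  shows "knot_diagram (Xing c d a b # D)"
  by (rule knot_diagram_rotate_vertices[OF assms, where r="\<lambda>i. if i = 0 then 2 else 0"])
    (auto simp: nth_Cons' numeral_2_eq_2)

text \<open>A joint inserted into an edge adds one vertex, one edge and no face. The implication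
  runs from the shorter code to the longer one, since it is the shorter one whose planarity is known
  when crossings cancel.\<close>

lemma knot_diagram_add_Joint:
  assumes kd: "knot_diagram (map (map_vertex (id(b := a))) D)"
    and wf: "well_formed (Joint a b # D)" and ab: "a \<noteq> b"
  shows "knot_diagram (Joint a b # D)"
proof -
  let ?g = "id(b := a)"
  let ?D' = "map (map_vertex ?g) D" and ?D0 = "Joint a b # D"
  let ?h = "apfst Suc :: nat \<times> nat \<Rightarrow> nat \<times> nat"
  have "count_list (concat (map ends ?D0)) a \<in> {0, 2}" "count_list (concat (map ends ?D0)) b \<in> {0, 2}"
    using wf by (simp_all only: well_formed_count)
  then have count: "count_list (concat (map ends D)) a = 1" "count_list (concat (map ends D)) b = 1"
    using ab by auto
  have mem: "a \<in> edges D" "b \<in> edges D"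
    using count count_list_eq_0_edges[of D a] count_list_eq_0_edges[of D b] by force+
  have corners: "corners ?D' = corners D"
    by (auto simp: corners_def ends_map_vertex)
  have end': "end_at ?D' c = ?g (end_at D c)" if "c \<in> corners D" for c
    using that by (auto simp: end_at_def in_corners ends_map_vertex)
  have turn': "turn ?D' c = turn D c" if "c \<in> corners D" for c
    using that by (auto simp: turn_def in_corners ends_map_vertex)
  have corners0: "corners ?D0 = {(0, 0), (0, 1)} \<union> ?h ` corners D"
    by (auto simp: corners_Cons numeral_2_eq_2 lessThan_Suc)
  obtain ca where slot_a: "{c \<in> corners D. end_at D c = a} = {ca}"
    using count(1) unfolding card_slots[symmetric] by (rule card_1_singletonE)
  obtain cb where slot_b: "{c \<in> corners D. end_at D c = b} = {cb}"
    using count(2) unfolding card_slots[symmetric] by (rule card_1_singletonE)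
  note slot = slot_a slot_b
  have "ca \<in> turn D ` corners D" "cb \<in> turn D ` corners D"
    using slot bij_betw_turn[of D] by (auto simp: bij_betw_def)
  then obtain pa pb where p: "pa \<in> corners D" "turn D pa = ca" "pb \<in> corners D" "turn D pb = cb"
    by blast
  have slotD: "c = ca \<longleftrightarrow> end_at D c = a" "c = cb \<longleftrightarrow> end_at D c = b" if "c \<in> corners D" for c
    using slot that by blast+
  have pD: "c = pa \<longleftrightarrow> end_at D (turn D c) = a" "c = pb \<longleftrightarrow> end_at D (turn D c) = b" if "c \<in> corners D" for c
    using slotD[OF turn_in_corners[OF that]] p that bij_betw_turn[of D]
    by (auto simp: bij_betw_def inj_on_def)
  \<comment> \<open>A left inverse of \<open>?h\<close>: a corner of the joint is sent to the corner
    that follows it on its face.\<close>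
  define \<rho> where "\<rho> = (\<lambda>c. if c = (0, 0) then pa else if c = (0, 1) then pb else apfst (\<lambda>i. i - 1) c)"
  have \<rho>: "\<rho> (0, 0) = pa" "\<rho> (0, 1) = pb" "\<rho> (?h c) = c" for c
    by (cases c; simp add: \<rho>_def)+
  have "inj ?h" by (auto simp: inj_def)
  have step_hh: "(?h c, ?h c') \<in> face_step ?D0 \<longleftrightarrow>
      c \<noteq> turn D c' \<and> end_at D c = end_at D (turn D c')" if "c \<in> corners D" "c' \<in> corners D" for c c'
    using that \<open>inj ?h\<close> by (auto simp: face_step_iff corners0 inj_eq simp del: apfst_conv)
  have step': "(c, c') \<in> face_step ?D' \<longleftrightarrow> c \<noteq> turn D c' \<and> ?g (end_at D c) = ?g (end_at D (turn D c'))"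
    if "c \<in> corners D" "c' \<in> corners D" for c c'
    using that by (auto simp: face_step_iff corners end' turn')
  have hne: "?h c \<noteq> (0, j)" "(0, j) \<noteq> ?h c" for c j by (cases c; simp)+
  have step_a: "(?h c, (0, 1)) \<in> face_step ?D0" if "c \<in> corners D" "end_at D c = a" for c
    using that hne by (auto simp: face_step_iff corners0 simp del: apfst_conv)
  have step_b: "(?h c, (0, 0)) \<in> face_step ?D0" if "c \<in> corners D" "end_at D c = b" for c
    using that hne by (auto simp: face_step_iff corners0 simp del: apfst_conv)
  have step_pa: "((0, 0), ?h pa) \<in> face_step ?D0"
    using p pD[of pa] hne by (auto simp: face_step_iff corners0 simp del: apfst_conv)
  have step_pb: "((0, 1), ?h pb) \<in> face_step ?D0"
    using p pD[of pb] hne by (auto simp: face_step_iff corners0 simp del: apfst_conv)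
  \<comment> \<open>A step across the merged edge becomes two steps, through a corner of the joint;
    every other step remains a single one.\<close>
  have up: "(?h c, ?h c') \<in> (face_step ?D0)\<^sup>*" if st: "(c, c') \<in> face_step ?D'" for c c'
  proof -
    have c: "c \<in> corners D" "c' \<in> corners D" using st by (auto simp: face_step_iff corners)
    then consider "end_at D c = end_at D (turn D c')" | "end_at D c = a" "end_at D (turn D c') = b"
      | "end_at D c = b" "end_at D (turn D c') = a"
      using st by (auto simp: step' split: if_splits)
    then show ?thesis
    proof cases
      case 1
      then show ?thesis using st c by (auto simp: step' step_hh)
    next
      case 2
      then have "c' = pb" using pD c by blast
      then show ?thesis using step_a[OF c(1)] step_pb 2 by auto
    next
      case 3
      then have "c' = pa" using pD c by blast
      then show ?thesis using step_b[OF c(1)] step_pa 3 by auto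
    qed
  qed
  have down: "(\<rho> c, \<rho> c') \<in> (face_step ?D')\<^sup>*" if cc': "(c, c') \<in> face_step ?D0" for c c'
  proof -
    have "c \<in> corners ?D0" "c' \<in> corners ?D0" using cc' by (auto simp: face_step_iff)
    then consider d d' where "c = ?h d" "c' = ?h d'" "d \<in> corners D" "d' \<in> corners D"
      | d j where "c = ?h d" "c' = (0, j)" "j < 2" "d \<in> corners D"
      | d' j where "c = (0, j)" "c' = ?h d'" "j < 2" "d' \<in> corners D"
      | j j' where "c = (0, j)" "c' = (0, j')" "j < 2" "j' < 2"
      by (auto simp: corners0 simp del: apfst_conv)
    then show ?thesis
    proof cases
      case 1
      then show ?thesis using cc' by (auto simp: step' step_hh \<rho> simp del: apfst_conv)
    next
      case 2
      then have "j = 0 \<and> end_at D d = b \<or> j = 1 \<and> end_at D d = a"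
        using cc' by (auto simp: face_step_iff less_2_cases_iff simp del: apfst_conv)
      moreover have "end_at D (turn D pa) = a" "end_at D (turn D pb) = b"
        using pD p(1,3) by blast+
      ultimately have "(d, \<rho> c') \<in> face_step ?D'"
        using step'[OF 2(4) p(1)] step'[OF 2(4) p(3)] ab 2(2) \<rho>(1,2) by auto
      then show ?thesis using 2 by (auto simp: \<rho> simp del: apfst_conv)
    next
      case 3
      then have "j = 0 \<and> end_at D (turn D d') = a \<or> j = 1 \<and> end_at D (turn D d') = b"
        using cc' by (auto simp: face_step_iff less_2_cases_iff simp del: apfst_conv)
      then have "\<rho> c = d'" using 3(1) pD[OF 3(4)] \<rho>(1,2) by auto
      then show ?thesis using 3 by (auto simp: \<rho> simp del: apfst_conv)
    next
      \<comment> \<open>A step from the joint to itself would follow an edge with both ends at the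
        joint, so \<open>a = b\<close>.\<close>
      case 4
      then show ?thesis using cc' ab by (auto simp: face_step_iff less_2_cases_iff)
    qed
  qed
  have sym: "(c', c) \<in> (face_step ?D0)\<^sup>*" if "(c, c') \<in> (face_step ?D0)\<^sup>*" for c c'
    using face_step_rtrancl_sym[OF wf that] .
  have "card (faces ?D') = card (faces ?D0)" unfolding faces_def corners
  proof (rule card_quotient_rtrancl_eq[where h="?h"])
    show "?h ` corners D \<subseteq> corners ?D0" by (auto simp: corners0)
    fix c assume "c \<in> corners ?D0"
    then consider "c = (0, 0)" | "c = (0, 1)" | d where "d \<in> corners D" "c = ?h d"
      by (auto simp: corners0)
    then show "\<exists>d\<in>corners D. (c, ?h d) \<in> (face_step ?D0)\<^sup>* \<and> (?h d, c) \<in> (face_step ?D0)\<^sup>*"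
    proof cases
      case 1 then show ?thesis using step_pa p sym by blast
    next
      case 2 then show ?thesis using step_pb p sym by blast
    qed blast
  next
    fix c c' assume "c \<in> corners D" "c' \<in> corners D"
    show "(c, c') \<in> (face_step ?D')\<^sup>* \<longleftrightarrow> (?h c, ?h c') \<in> (face_step ?D0)\<^sup>*"
    proof
      assume "(c, c') \<in> (face_step ?D')\<^sup>*"
      then show "(?h c, ?h c') \<in> (face_step ?D0)\<^sup>*"
      proof (induction rule: rtrancl_induct)
        case (step y z)
        show ?case by (rule rtrancl_trans[OF step.IH up[OF step.hyps(2)]])
      qed simp
    next
      assume "(?h c, ?h c') \<in> (face_step ?D0)\<^sup>*"
      then have "(\<rho> (?h c), \<rho> (?h c')) \<in> (face_step ?D')\<^sup>*"
      proof (induction rule: rtrancl_induct)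
        case (step y z)
        show ?case by (rule rtrancl_trans[OF step.IH down[OF step.hyps(2)]])
      qed simp
      then show "(c, c') \<in> (face_step ?D')\<^sup>*" by (simp only: \<rho>)
    qed
  qed
  moreover have "card (edges ?D0) = card (edges ?D') + 1"
  proof -
    have "edges ?D0 = insert b (edges ?D')" using mem ab by (auto simp: edges_map_vertex)
    moreover have "b \<notin> edges ?D'" using ab by (auto simp: edges_map_vertex)
    ultimately show ?thesis by simp
  qed
  moreover have "one_component ?D0"
  proof -
    let ?S = "strand_rel ?D0"
    have jab: "(a, b) \<in> ?S" "(b, a) \<in> ?S" by (auto simp: strand_rel_def)
    have g: "(e, ?g e) \<in> ?S\<^sup>*" "(?g e, e) \<in> ?S\<^sup>*" for e using jab by auto
    have strand: "(e, e') \<in> ?S\<^sup>*" if "(e, e') \<in> strand_rel ?D'" for e e'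
    proof -
      obtain u v where uv: "(u, v) \<in> strand_rel D" "e = ?g u" "e' = ?g v"
        using \<open>(e, e') \<in> strand_rel ?D'\<close> unfolding strand_rel_def
        by (simp add: strands_map_vertex del: fun_upd_apply) blast
      then have "(u, v) \<in> ?S" by (auto simp: strand_rel_def)
      then show ?thesis using g uv(2,3) by (meson r_into_rtrancl rtrancl_trans)
    qed
    have *: "(e, e') \<in> ?S\<^sup>*" if "(e, e') \<in> (strand_rel ?D')\<^sup>*" for e e'
      using that
    proof (induction rule: rtrancl_induct)
      case (step y z)
      show ?case by (rule rtrancl_trans[OF step.IH strand[OF step.hyps(2)]])
    qed simp
    have "(e, e') \<in> ?S\<^sup>*" if "e \<in> edges ?D0" "e' \<in> edges ?D0" for e e'
    proof -
      have "?g e \<in> edges ?D'" "?g e' \<in> edges ?D'"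
        using that mem by (auto simp: edges_map_vertex)
      then have "(?g e, ?g e') \<in> ?S\<^sup>*"
        using kd * by (auto simp: knot_diagram_def one_component_strand_rel)
      then show ?thesis using g by (meson rtrancl_trans)
    qed
    then show ?thesis by (auto simp: one_component_strand_rel)
  qed
  ultimately show ?thesis using kd wf by (simp add: knot_diagram_def)
qed

lemma well_formed_R2:
  assumes wf: "well_formed (Xing c x y a # Xing y x d b # D)"
  shows "well_formed (Joint a b # Joint c d # D)" (is "well_formed ?D'")
proof -
  define M where "M = mset (concat (map ends ?D'))"
  have M: "mset (concat (map ends (Xing c x y a # Xing y x d b # D))) = {#x, x, y, y#} + M"
    by (simp add: M_def)
  have "count M e \<in> {0, 2}" for e
  proof -
    have "count ({#x, x, y, y#} + M) e \<in> {0, 2}"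
      using wf unfolding M[symmetric] count_mset by (simp only: well_formed_count)
    then show ?thesis by (auto split: if_splits)
  qed
  then show ?thesis unfolding well_formed_count count_mset[symmetric] M_def by simp
qed

section \<open>The diagrams of the free knot are planar\<close>

lemma free21_eq:
  "free21 m \<alpha> = site_crossing m (\<alpha> Left) Left # site_crossing m (\<alpha> Right) Right #
     site_crossing m (\<alpha> Bottom) Bottom #
     map (\<lambda>i. site_crossing m (\<alpha> (Row i)) (Row i)) [0..<m]"
  by (simp add: free21_def sites_def)

lemma length_free21 [simp]: "length (free21 m \<alpha>) = m + 3"
  by (simp add: free21_eq)

lemma nth_free21:
  "free21 m \<alpha> ! 0 = site_crossing m (\<alpha> Left) Left"
  "free21 m \<alpha> ! Suc 0 = site_crossing m (\<alpha> Right) Right"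
  "free21 m \<alpha> ! 2 = site_crossing m (\<alpha> Bottom) Bottom"
  "i < m \<Longrightarrow> free21 m \<alpha> ! (3 + i) = site_crossing m (\<alpha> (Row i)) (Row i)"
  by (simp_all add: free21_eq numeral_2_eq_2 numeral_3_eq_3)

lemmas edge_numbers = inner_arc_def outer_arc_def left_bottom_def right_bottom_def upper_def lower_def

lemma edge_eq_iff [simp]:
  "upper i = upper j \<longleftrightarrow> i = j" "lower i = lower j \<longleftrightarrow> i = j"
  "upper i \<noteq> lower j" "lower j \<noteq> upper i"
  "upper i \<noteq> 0" "upper i \<noteq> Suc 0" "upper i \<noteq> 2" "upper i \<noteq> 3"
  "Suc 0 \<noteq> upper i" "Suc 0 \<noteq> lower i" "lower i \<noteq> 0" "lower i \<noteq> Suc 0" "lower i \<noteq> 2" "lower i \<noteq> 3"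
  by (simp_all add: upper_def lower_def) presburger+

lemma set_ends_crossing: "set (ends (crossing s i j k l)) = {i, j, k, l}"
  by (auto simp: crossing_def)

lemma mset_ends_crossing: "mset (ends (crossing s i j k l)) = {#i, j, k, l#}"
  by (auto simp: crossing_def)

text \<open>Written as one list taken twice, the ends show that every edge has two of them. The row
  contributes \<open>upper 0\<close> to \<open>upper (m - 1)\<close> as left ends and
  \<open>upper 1\<close> to \<open>upper m\<close> as right ends; the crossings above it supply the
  missing \<open>upper m\<close> and \<open>upper 0\<close>, and likewise for
  \<open>lower\<close>.\<close>

lemma mset_ends_free21:
  "mset (concat (map ends (free21 m \<alpha>))) =
    (let E = [0, 1, 2, 3] @ map upper [0..<Suc m] @ map lower [0..<Suc m] in mset E + mset E)"
proof -
  have row: "mset (concat (map (\<lambda>i. ends (site_crossing m (\<alpha> (Row i)) (Row i))) [0..<k])) =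
    mset (map upper [0..<k]) + mset (map lower [0..<k]) +
    mset (map upper (map Suc [0..<k])) + mset (map lower (map Suc [0..<k]))" for k
    by (induction k) (simp_all add: mset_ends_crossing)
  have last: "mset (map f [0..<Suc m]) = add_mset (f m) (mset (map f [0..<m]))"
    and first: "mset (map f [0..<Suc m]) = add_mset (f 0) (mset (map f (map Suc [0..<m])))"
    for f :: "nat \<Rightarrow> nat"
    by (simp, simp only: map_Suc_upt) (simp add: upt_conv_Cons del: upt_Suc)
  have E: "mset (map f [0..<Suc m]) + mset (map f [0..<Suc m]) =
      add_mset (f m) (add_mset (f 0) (mset (map f [0..<m]) + mset (map f (map Suc [0..<m]))))"
    for f :: "nat \<Rightarrow> nat"
    using arg_cong2[OF last[of f] first[of f], of "(+)"] by (simp only: union_mset_add_mset_left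
        union_mset_add_mset_right add_mset_commute[of "f 0" "f m"])
  have "mset (concat (map ends (free21 m \<alpha>))) = {#0, 0, 1, 1, 2, 2, 3, 3#} +
      (mset (map upper [0..<Suc m]) + mset (map upper [0..<Suc m])) +
      (mset (map lower [0..<Suc m]) + mset (map lower [0..<Suc m]))"
    unfolding E using row[of m]
    by (simp add: free21_eq mset_ends_crossing comp_def inner_arc_def outer_arc_def left_bottom_def
        right_bottom_def)
  then show ?thesis by (simp add: Let_def ac_simps)
qed

lemma edges_free21: "edges (free21 m \<alpha>) = {..<2 * m + 6}"
proof -
  have "edges (free21 m \<alpha>) = set_mset (mset (concat (map ends (free21 m \<alpha>))))"
    by (simp add: edges_def)
  also have "\<dots> = {0, 1, 2, 3} \<union> upper ` {..<Suc m} \<union> lower ` {..<Suc m}"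
    unfolding mset_ends_free21 Let_def by (auto simp: atLeast0LessThan simp del: upt_Suc)
  also have "\<dots> = {..<2 * m + 6}"
  proof (intro equalityI subsetI)
    fix e assume e: "e \<in> {..<2 * m + 6}"
    consider "e < 4" | j where "e = upper j" | j where "e = lower j"
    proof (cases "e < 4")
      case False
      then have "e = upper ((e - 4) div 2) \<or> e = lower ((e - 4) div 2)"
        unfolding upper_def lower_def by presburger
      then show ?thesis using that by blast
    qed (use that in blast)
    then show "e \<in> {0, 1, 2, 3} \<union> upper ` {..<Suc m} \<union> lower ` {..<Suc m}"
    proof cases
      case 1
      then show ?thesis by auto
    qed (use e in \<open>auto simp: upper_def lower_def\<close>)
  qed (auto simp: upper_def lower_def)
  finally show ?thesis .
qed

lemma well_formed_free21: "well_formed (free21 m \<alpha>)"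
proof -
  define E where "E = [0, 1, 2, 3] @ map upper [0..<Suc m] @ map lower [0..<Suc m]"
  have "distinct E" by (auto simp: E_def distinct_map inj_on_def simp del: upt_Suc)
  then have "count (mset E) e = (if e \<in> set E then 1 else 0)" for e
    by (simp add: distinct_count_atmost_1)
  then have "count (mset E + mset E) e \<in> {0, 2}" for e by simp
  then show ?thesis
    unfolding well_formed_count count_mset[symmetric] mset_ends_free21 Let_def E_def by blast
qed

lemma rtrancl_strand_rel_sym: "(e, e') \<in> (strand_rel D)\<^sup>* \<Longrightarrow> (e', e) \<in> (strand_rel D)\<^sup>*"
  by (rule symD[OF sym_rtrancl]) (auto simp: sym_def strand_rel_def)

lemma strand_rel_crossing:
  assumes "crossing s i j k l \<in> set D"
  shows "(i, l) \<in> strand_rel D" "(j, k) \<in> strand_rel D"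
proof -
  let ?v = "crossing s i j k l"
  have "(i, l) \<in> strands ?v \<union> (strands ?v)\<inverse>" "(j, k) \<in> strands ?v \<union> (strands ?v)\<inverse>"
    by (auto simp: crossing_def)
  then show "(i, l) \<in> strand_rel D" "(j, k) \<in> strand_rel D"
    using assms unfolding strand_rel_def by blast+
qed

text \<open>A strand changes between the upper and the lower position at every crossing of the row,
  so it leaves an odd row at the other height than it entered. The curve therefore runs through
  \<open>inner_arc\<close>, \<open>lower 0\<close>, the row, \<open>upper m\<close>,
  \<open>left_bottom\<close>, \<open>outer_arc\<close>, \<open>right_bottom\<close>,
  \<open>upper 0\<close>, the row and \<open>lower m\<close> back to
  \<open>inner_arc\<close>.\<close>

lemma one_component_free21:
  assumes "odd m"
  shows "one_component (free21 m \<alpha>)"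
proof -
  let ?D = "free21 m \<alpha>"
  let ?S = "(strand_rel ?D)\<^sup>*"
  have "crossing (\<alpha> Left) outer_arc inner_arc (lower 0) left_bottom \<in> set ?D"
    "crossing (\<alpha> Right) inner_arc outer_arc right_bottom (lower m) \<in> set ?D"
    "crossing (\<alpha> Bottom) left_bottom right_bottom (upper 0) (upper m) \<in> set ?D"
    by (simp_all add: free21_eq)
  note top = strand_rel_crossing[OF this(1)] strand_rel_crossing[OF this(2)] strand_rel_crossing[OF this(3)]
  have "crossing (\<alpha> (Row i)) (upper i) (upper (Suc i)) (lower i) (lower (Suc i)) \<in> set ?D" if "i < m" for i
    using that by (auto simp: free21_eq)
  note row = strand_rel_crossing[OF this]
  have sym: "(e', e) \<in> ?S" if "(e, e') \<in> strand_rel ?D" for e e'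
    by (rule rtrancl_strand_rel_sym[OF r_into_rtrancl[OF that]])
  have even_odd: "j \<le> m \<Longrightarrow> (lower 0, if even j then lower j else upper j) \<in> ?S \<and>
      (upper 0, if even j then upper j else lower j) \<in> ?S" for j
  proof (induction j)
    case (Suc j)
    then have "j < m" by simp
    have s: "(upper j, lower (Suc j)) \<in> ?S" "(lower j, upper (Suc j)) \<in> ?S"
      using row(1)[OF \<open>j < m\<close>] sym[OF row(2)[OF \<open>j < m\<close>]] by auto
    have "(lower 0, if even j then lower j else upper j) \<in> ?S"
      "(upper 0, if even j then upper j else lower j) \<in> ?S" using Suc by simp_all
    then show ?case
      by (cases "even j") (simp_all add: rtrancl_trans[OF _ s(1)] rtrancl_trans[OF _ s(2)])
  qed simp
  have l: "(inner_arc, lower 0) \<in> ?S" "(inner_arc, lower m) \<in> ?S" using top by auto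
  have um: "(inner_arc, upper m) \<in> ?S"
    using rtrancl_trans[OF l(1)] even_odd[of m] assms by simp
  have u0: "(inner_arc, upper 0) \<in> ?S"
    using rtrancl_trans[OF l(2) rtrancl_strand_rel_sym] even_odd[of m] assms by simp
  have lb: "(inner_arc, left_bottom) \<in> ?S" by (rule rtrancl_trans[OF um sym[OF top(5)]])
  have oa: "(inner_arc, outer_arc) \<in> ?S" by (rule rtrancl_trans[OF lb sym[OF top(1)]])
  have rb: "(inner_arc, right_bottom) \<in> ?S" by (rule rtrancl_into_rtrancl[OF oa top(4)])
  have up: "(inner_arc, upper j) \<in> ?S" and low: "(inner_arc, lower j) \<in> ?S" if "j \<le> m" for j
    using rtrancl_trans[OF l(1)] rtrancl_trans[OF u0] even_odd[OF that] by (cases "even j"; simp)+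
  have "edges ?D \<subseteq> {inner_arc, outer_arc, left_bottom, right_bottom} \<union> upper ` {..m} \<union> lower ` {..m}"
  proof
    fix e assume "e \<in> edges ?D"
    then have "e \<in># mset (concat (map ends ?D))" by (simp add: edges_def)
    then show "e \<in> {inner_arc, outer_arc, left_bottom, right_bottom} \<union> upper ` {..m} \<union> lower ` {..m}"
      unfolding mset_ends_free21 Let_def
      by (auto simp: inner_arc_def outer_arc_def left_bottom_def right_bottom_def)
  qed
  then have "(inner_arc, e) \<in> ?S" if "e \<in> edges ?D" for e
    using that oa lb rb up low by blast
  then have "(e, e') \<in> ?S" if "e \<in> edges ?D" "e' \<in> edges ?D" for e e'
    using that by (blast intro: rtrancl_trans rtrancl_strand_rel_sym)
  moreover have "?D \<noteq> []" by (simp add: free21_eq)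
  ultimately show ?thesis unfolding one_component_strand_rel by blast
qed

text \<open>The faces are numbered as follows: \<open>0\<close> is the outer face, \<open>1\<close> lies between \<open>Bottom\<close> and the
  row, \<open>2\<close> between \<open>Left\<close>, \<open>Right\<close> and \<open>Bottom\<close>, \<open>3\<close> between the arcs, and \<open>4 + i\<close> is the face to
  the left of \<open>Row i\<close>, with \<open>4 + m\<close> to the right of the last crossing of the row.\<close>

fun face_number :: "nat \<Rightarrow> nat \<times> nat \<Rightarrow> nat" where
  "face_number m (i, j) =
    (if i = 0 then [0, 4, 2, 3] ! j else if i = 1 then [2, 4 + m, 0, 3] ! j
     else if i = 2 then [4, 1, 4 + m, 2] ! j else [4 + (i - 3), 0, 5 + (i - 3), 1] ! j)"

text \<open>Face \<open>4 + i\<close> is represented by the left corner of \<open>Row i\<close>; the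
  last of these faces has no crossing of the row on its right and takes its corner from
  \<open>Right\<close>.\<close>

fun face_corner :: "nat \<Rightarrow> nat \<Rightarrow> nat \<times> nat" where
  "face_corner m k =
    (if k = 0 then (0, 0) else if k = 1 then (2, 1) else if k = 2 then (0, 2) else if k = 3 then (0, 3)
     else if k = 4 + m then (1, 1) else (3 + (k - 4), 0))"

lemma length_sites: "length (sites m) = m + 3"
  by (simp add: sites_def)

text \<open>There are m + 3 vertices, 2 m + 6 edges and m + 5 faces. The faces are counted by
  showing that \<open>face_number\<close> is constant along \<open>face_step\<close> and that every
  corner reaches the chosen corner of its number.\<close>

lemma knot_diagram_free21_False:
  assumes "odd m"
  shows "knot_diagram (free21 m (\<lambda>_. False))" (is "knot_diagram ?D")
proof -
  have m: "m \<ge> 1" using assms by (cases m) auto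
  let ?R = "face_step ?D"
  have nth: "?D ! 0 = Xing outer_arc (lower 0) left_bottom inner_arc"
    "?D ! 1 = Xing inner_arc right_bottom (lower m) outer_arc"
    "?D ! 2 = Xing left_bottom (upper 0) (upper m) right_bottom"
    "i < m \<Longrightarrow> ?D ! (3 + i) = Xing (upper i) (lower i) (lower (Suc i)) (upper (Suc i))" for i
    by (simp_all add: nth_free21 crossing_def del: One_nat_def add: One_nat_def)
  have corner_cases: "P c" if "c \<in> corners ?D" "\<And>j. j < 4 \<Longrightarrow> P (0, j)" "\<And>j. j < 4 \<Longrightarrow> P (1, j)"
    "\<And>j. j < 4 \<Longrightarrow> P (2, j)" "\<And>i j. i < m \<Longrightarrow> j < 4 \<Longrightarrow> P (3 + i, j)" for P c
  proof -
    obtain i j where "c = (i, j)" by fastforce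
    with that(1) have c: "c = (i, j)" "i < m + 3" "j < length (ends (?D ! i))"
      by (simp_all add: corners_def)
    consider "i = 0" | "i = 1" | "i = 2" | "i = 3 + (i - 3)" "i - 3 < m"
      using c(2) by linarith
    then show ?thesis
    proof cases
      case 4
      then have "j < 4" using c(3) nth(4)[of "i - 3"] by simp
      then show ?thesis using that(5)[of "i - 3" j] 4 c(1) by simp
    qed (use c that(2-4) nth(1-3) in auto)
  qed
  have less4: "j < 4 \<longleftrightarrow> j = 0 \<or> j = 1 \<or> j = 2 \<or> j = 3" for j :: nat by auto
  have ends4: "length (ends (?D ! i)) = 4" if "i < m + 3" for i
  proof -
    have "length (ends (crossing s a b c d)) = 4" for s and a b c d :: nat by (simp add: crossing_def)
    then have "length (ends (site_crossing m s x)) = 4" for s x by (cases x) auto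
    then show ?thesis using that by (simp add: free21_def length_sites)
  qed
  then have corners: "(i, j) \<in> corners ?D" if "i < m + 3" "j < 4" for i j
    using that by (simp add: corners_def)
  have stepI: "((i, j), (i', j')) \<in> ?R"
    if "i < m + 3" "j < 4" "i' < m + 3" "j' < 4" "(i, j) \<noteq> (i', Suc j' mod 4)"
      "ends (?D ! i) ! j = ends (?D ! i') ! (Suc j' mod 4)" for i j i' j'
    using that corners ends4[of i'] by (simp add: face_step_iff turn_def end_at_def)
  have first: "?D ! 3 = Xing (upper 0) (lower 0) (lower (Suc 0)) (upper (Suc 0))"
    using nth(4)[of 0] m by simp
  obtain m' where m': "m = Suc m'" using m by (cases m) auto
  then have m'_less: "m' < m" and m_pos: "0 < m" by simp_all
  have last: "?D ! (3 + m') = Xing (upper m') (lower m') (lower m) (upper m)"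
    using nth(4)[OF m'_less] m' by simp
  note top = nth(1) nth(2)[unfolded One_nat_def] nth(3)
  have left: "((0, 0), (1, 2)) \<in> ?R" "((0, 1), (3, 0)) \<in> ?R" "((0, 2), (2, 3)) \<in> ?R" "((0, 3), (1, 3)) \<in> ?R"
    by (rule stepI; simp add: top first m_pos)+
  have right: "((1, 0), (0, 2)) \<in> ?R" "((1, 1), (2, 2)) \<in> ?R" "((1, 2), (3 + m', 1)) \<in> ?R" "((1, 3), (0, 3)) \<in> ?R"
    by (rule stepI; simp add: top last m'_less m_pos)+
  have bottom: "((2, 0), (0, 1)) \<in> ?R" "((2, 1), (3, 3)) \<in> ?R" "((2, 2), (3 + m', 2)) \<in> ?R" "((2, 3), (1, 0)) \<in> ?R"
    by (rule stepI; simp add: top first last m'_less m_pos)+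
  have row_ends: "((3, 0), (2, 0)) \<in> ?R" "((3, 1), (0, 0)) \<in> ?R"
    "((3 + m', 2), (1, 1)) \<in> ?R" "((3 + m', 3), (2, 1)) \<in> ?R"
    by (rule stepI; simp add: top first last m'_less m_pos)+
  have row: "((3 + Suc i, 0), (3 + i, 2)) \<in> ?R" "((3 + Suc i, 1), (3 + i, 1)) \<in> ?R"
    "((3 + i, 2), (3 + Suc i, 0)) \<in> ?R" "((3 + i, 3), (3 + Suc i, 3)) \<in> ?R" if "Suc i < m" for i
    by (rule stepI; use that nth(4)[of i] nth(4)[of "Suc i"] in simp)+
  have wf: "well_formed ?D" by (rule well_formed_free21)
  \<comment> \<open>Successors are unique, so it suffices to exhibit for every corner one successor
    with the same number.\<close>
  define P where "P c \<longleftrightarrow> (\<exists>c'. (c, c') \<in> ?R \<and> face_number m c' = face_number m c)" for c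
  have P: "P c" if "(c, c') \<in> ?R" "face_number m c' = face_number m c" for c c'
    unfolding P_def using that by blast
  have face_next: "P c" if "c \<in> corners ?D" for c
    using that
  proof (rule corner_cases)
    fix j :: nat assume j: "j < 4"
    show "P (0, j)" using j P[OF left(1)] P[OF left(2)] P[OF left(3)] P[OF left(4)] by (auto simp: less4)
    show "P (1, j)"
      using j m' P[OF right(1)] P[OF right(2)] P[OF right(3)] P[OF right(4)] by (auto simp: less4)
    show "P (2, j)"
      using j m' P[OF bottom(1)] P[OF bottom(2)] P[OF bottom(3)] P[OF bottom(4)] by (auto simp: less4)
    fix i assume i: "i < m"
    have "P (3 + i, 0)" using P[OF row_ends(1)] P[OF row(1)[of "i - 1"]] i by (cases i) simp_all
    moreover have "P (3 + i, 1)" using P[OF row_ends(2)] P[OF row(2)[of "i - 1"]] i by (cases i) simp_all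
    moreover have "P (3 + i, 2)"
      using P[OF row_ends(3)] P[OF row(3)[of i]] i m' by (cases "i = m'") simp_all
    moreover have "P (3 + i, 3)"
      using P[OF row_ends(4)] P[OF row(4)[of i]] i m' by (cases "i = m'") simp_all
    ultimately show "P (3 + i, j)" using j by (auto simp: less4)
  qed
  have label_step: "face_number m c' = face_number m c" if "(c, c') \<in> ?R" for c c'
  proof -
    have c: "c \<in> corners ?D" using that by (simp add: face_step_iff)
    then show ?thesis
      using face_step_functional(1)[OF wf c] face_next[OF c] that unfolding P_def by blast
  qed
  have faces: "face_number m c' = face_number m c" if "(c, c') \<in> ?R\<^sup>*" for c c'
    using that
  proof (induction rule: rtrancl_induct)
    case (step y z)
    show ?case using step.IH \<open>(y, z) \<in> ?R\<close>[THEN label_step] by simp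
  qed simp
  have sym: "(c', c) \<in> ?R\<^sup>*" if "(c, c') \<in> ?R\<^sup>*" for c c'
    by (rule face_step_rtrancl_sym[OF wf that])
  \<comment> \<open>The outer face and the face between \<open>Bottom\<close> and the row border on
    the whole row, so reaching their chosen corners takes an induction along it. All other faces
    have a bounded number of corners.\<close>
  have outer: "((3 + i, 1), (0, 0)) \<in> ?R\<^sup>*" if "i < m" for i
    using that
  proof (induction i)
    case 0
    then show ?case using row_ends by auto
  next
    case (Suc i)
    then have "((3 + i, 1), (0, 0)) \<in> ?R\<^sup>*" by simp
    then show ?case by (rule converse_rtrancl_into_rtrancl[OF row(2)[OF Suc.prems]])
  qed
  have inner: "((2, 1), (3 + i, 3)) \<in> ?R\<^sup>*" if "i < m" for i
    using that
  proof (induction i)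
    case 0
    then show ?case using bottom by auto
  next
    case (Suc i)
    then have "((2, 1), (3 + i, 3)) \<in> ?R\<^sup>*" by simp
    then show ?case by (rule rtrancl_into_rtrancl[OF _ row(4)[OF Suc.prems]])
  qed
  have rep: "(c, face_corner m (face_number m c)) \<in> ?R\<^sup>*" if "c \<in> corners ?D" for c
    using that
  proof (rule corner_cases)
    have 1: "((0, 0), (1, 2)) \<in> ?R\<^sup>*" "((0, 1), (3, 0)) \<in> ?R\<^sup>*" "((0, 2), (2, 3)) \<in> ?R\<^sup>*"
      "((0, 3), (1, 3)) \<in> ?R\<^sup>*" "((1, 0), (0, 2)) \<in> ?R\<^sup>*" "((2, 0), (0, 1)) \<in> ?R\<^sup>*"
      "((1, 1), (2, 2)) \<in> ?R\<^sup>*" "((2, 2), (3 + m', 2)) \<in> ?R\<^sup>*"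
      using left right bottom by auto
    fix j :: nat assume j: "j < 4"
    show "((0, j), face_corner m (face_number m (0, j))) \<in> ?R\<^sup>*"
      using j 1 m by (auto simp: less4)
    show "((1, j), face_corner m (face_number m (1, j))) \<in> ?R\<^sup>*"
      using j 1 m sym[OF 1(1)] sym[OF 1(4)] by (auto simp: less4)
    show "((2, j), face_corner m (face_number m (2, j))) \<in> ?R\<^sup>*"
      using j m rtrancl_trans[OF 1(6) 1(2)] sym[OF 1(7)] sym[OF 1(3)] by (auto simp: less4)
    fix i assume i: "i < m"
    have "((3 + i, 2), face_corner m (5 + i)) \<in> ?R\<^sup>*"
      using row_ends(3) row(3)[of i] i m' by (cases "i = m'") auto
    then show "((3 + i, j), face_corner m (face_number m (3 + i, j))) \<in> ?R\<^sup>*"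
      using j i outer[OF i] sym[OF inner[OF i]] by (auto simp: less4)
  qed
  \<comment> \<open>The face numbers enter the comparison as the classes of the empty
    relation.\<close>
  have "card (({..<m + 5} :: nat set) // {}\<^sup>*) = card (faces ?D)" unfolding faces_def
  proof (rule card_quotient_rtrancl_eq[where h = "face_corner m"])
    show "face_corner m ` {..<m + 5} \<subseteq> corners ?D" using m by (auto intro!: corners)
    fix c assume "c \<in> corners ?D"
    moreover from this have "face_number m c \<in> {..<m + 5}"
      by (rule corner_cases) (auto simp: less4)
    ultimately show "\<exists>k\<in>{..<m + 5}. (c, face_corner m k) \<in> ?R\<^sup>* \<and> (face_corner m k, c) \<in> ?R\<^sup>*"
      using rep sym by blast
  next
    fix k l :: nat assume "k \<in> {..<m + 5}" "l \<in> {..<m + 5}"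
    then have "face_number m (face_corner m k) = k" "face_number m (face_corner m l) = l" by auto
    then show "(k, l) \<in> {}\<^sup>* \<longleftrightarrow> (face_corner m k, face_corner m l) \<in> ?R\<^sup>*"
      using faces by (metis pair_in_Id_conv rtrancl.rtrancl_refl rtrancl_empty)
  qed
  moreover have "({..<m + 5} :: nat set) // {}\<^sup>* = (\<lambda>k. {k}) ` {..<m + 5}" by (auto simp: quotient_def)
  ultimately have "card (faces ?D) = m + 5" by (simp add: card_image)
  then show ?thesis
    unfolding knot_diagram_def edges_free21 using wf one_component_free21[OF assms] by simp
qed

lemma knot_diagram_free21:
  assumes "odd m"
  shows "knot_diagram (free21 m \<alpha>)"
proof (rule knot_diagram_rotate_vertices[OF knot_diagram_free21_False[OF assms]])
  let ?s = "\<lambda>i. \<alpha> (sites m ! i)"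
  have rot: "ends (site_crossing m s x) = rotate (if s then 1 else 0) (ends (site_crossing m False x))"
    "strands (site_crossing m s x) \<union> (strands (site_crossing m s x))\<inverse> =
      strands (site_crossing m False x) \<union> (strands (site_crossing m False x))\<inverse>" for s x
    by (cases x; auto simp: crossing_def)+
  have nth: "free21 m \<beta> ! i = site_crossing m (\<beta> (sites m ! i)) (sites m ! i)" if "i < m + 3" for \<beta> i
    using that by (simp add: free21_def length_sites)
  fix i assume "i < length (free21 m (\<lambda>_. False))"
  then have i: "i < m + 3" by simp
  show "ends (free21 m \<alpha> ! i) = rotate (if ?s i then 1 else 0) (ends (free21 m (\<lambda>_. False) ! i))"
    unfolding nth[OF i] by (rule rot(1))
  show "strands (free21 m \<alpha> ! i) \<union> (strands (free21 m \<alpha> ! i))\<inverse> =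
      strands (free21 m (\<lambda>_. False) ! i) \<union> (strands (free21 m (\<lambda>_. False) ! i))\<inverse>"
    unfolding nth[OF i] by (rule rot(2))
qed simp

section \<open>Cancelling crossings of the row\<close>

lemma same_knot_refl [simp]: "D \<approx> D"
  by (simp add: same_knot_def)

lemma same_knot_sym: "D \<approx> D' \<Longrightarrow> D' \<approx> D"
  unfolding same_knot_def by (rule equivclp_sym)

lemma same_knot_trans [trans]: "D \<approx> D' \<Longrightarrow> D' \<approx> D'' \<Longrightarrow> D \<approx> D''"
  unfolding same_knot_def by (rule equivclp_trans)

lemma same_knot_move: "move D D' \<Longrightarrow> knot_diagram D \<Longrightarrow> knot_diagram D' \<Longrightarrow> D \<approx> D'"
  unfolding same_knot_def by (rule r_into_equivclp) (simp add: knot_step_def)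

lemma same_knot_reorder: "mset D = mset D' \<Longrightarrow> knot_diagram D \<Longrightarrow> D \<approx> D'"
  by (blast intro: same_knot_move move.reorder knot_diagram_reorder)

lemma same_knot_relabel:
  "inj_on f (edges D) \<Longrightarrow> knot_diagram D \<Longrightarrow> D \<approx> map (map_vertex f) D"
  by (blast intro: same_knot_move move.relabel knot_diagram_relabel)

lemma same_knot_rotate_Xing:
  "knot_diagram (Xing a b c d # D) \<Longrightarrow> Xing a b c d # D \<approx> Xing c d a b # D"
  by (blast intro: same_knot_move move.rotate_Xing knot_diagram_rotate_Xing)

lemma count_list_map_merge:
  assumes "a \<noteq> b"
  shows "count_list (map (id(b := a)) xs) e =
    (if e = b then 0 else if e = a then count_list xs a + count_list xs b else count_list xs e)"
  using assms by (induction xs) auto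

lemma well_formed_remove_Joint:
  assumes wf: "well_formed (Joint a b # D)" and ab: "a \<noteq> b"
  shows "well_formed (map (map_vertex (id(b := a))) D)"
proof -
  let ?xs = "concat (map ends D)"
  have xs: "concat (map ends (map (map_vertex (id(b := a))) D)) = map (id(b := a)) ?xs"
    by (simp add: map_concat comp_def ends_map_vertex)
  have c: "count_list (concat (map ends (Joint a b # D))) e \<in> {0, 2}" for e
    using wf by (simp only: well_formed_count)
  show ?thesis unfolding well_formed_count xs count_list_map_merge[OF ab]
  proof
    fix e show "(if e = b then 0 else if e = a then count_list ?xs a + count_list ?xs b else count_list ?xs e) \<in> {0, 2}"
      using c[of a] c[of b] c[of e] ab by auto
  qed
qed

text \<open>After \<open>R2\<close> the strands pass through two joints, which are then removed. The
  two codes with joints get their planarity in the opposite order, starting from the final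
  one.\<close>

lemma cancel_R2:
  assumes kd: "knot_diagram (Xing c x y a # Xing y x d b # D)"
    and distinct: "distinct [a, b, c, d]"
    and kd': "knot_diagram (map (map_vertex (id(b := a, d := c))) D)"
  shows "Xing c x y a # Xing y x d b # D \<approx> map (map_vertex (id(b := a, d := c))) D"
proof -
  let ?D' = "map (map_vertex (id(b := a))) D"
  have ne: "a \<noteq> b" "c \<noteq> d" "a \<noteq> d" "b \<noteq> c" "b \<noteq> d" "c \<noteq> b" "d \<noteq> b" using distinct by auto
  have wf1: "well_formed (Joint a b # Joint c d # D)"
    by (rule well_formed_R2[where x=x and y=y]) (use kd in \<open>simp add: knot_diagram_def\<close>)
  have 1: "map (map_vertex (id(b := a))) (Joint c d # D) = Joint c d # ?D'"
    using ne by simp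
  have wf2: "well_formed (Joint c d # ?D')"
    using well_formed_remove_Joint[OF wf1 ne(1)] unfolding 1 .
  have "id(d := c) \<circ> id(b := a) = id(b := a, d := c)" using ne by auto
  then have 2: "map (map_vertex (id(d := c))) ?D' = map (map_vertex (id(b := a, d := c))) D"
    by (simp add: vertex.map_comp del: fun_upd_apply)
  have kd2: "knot_diagram (Joint c d # ?D')"
    by (rule knot_diagram_add_Joint[OF _ wf2 ne(2)]) (unfold 2, rule kd')
  have kd1: "knot_diagram (Joint a b # Joint c d # D)"
    by (rule knot_diagram_add_Joint[OF _ wf1 ne(1)]) (unfold 1, rule kd2)
  have "Xing c x y a # Xing y x d b # D \<approx> Joint a b # Joint c d # D"
    by (rule same_knot_move[OF move.R2 kd kd1])
  also have "\<dots> \<approx> Joint c d # ?D'"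
    using same_knot_move[OF move.remove_Joint[OF ne(1)] kd1] kd2 unfolding 1 by simp
  also have "\<dots> \<approx> map (map_vertex (id(b := a, d := c))) D"
    using same_knot_move[OF move.remove_Joint[OF ne(2)] kd2] kd' unfolding 2 by simp
  finally show ?thesis .
qed

section \<open>Removing two neighbouring crossings of the row\<close>

definition skip :: "nat \<Rightarrow> (site \<Rightarrow> 'a) \<Rightarrow> site \<Rightarrow> 'a" where
  "skip i \<alpha> s = (case s of Row j \<Rightarrow> \<alpha> (Row (if j < i then j else j + 2)) | _ \<Rightarrow> \<alpha> s)"

text \<open>After \<open>Row i\<close> and \<open>Row (Suc i)\<close> have cancelled, \<open>upper (i + 2)\<close> and \<open>lower (i + 2)\<close> continue
  \<open>upper i\<close> and \<open>lower i\<close>; \<open>collapse i\<close> renumbers the later edges accordingly.\<close>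

definition collapse :: "nat \<Rightarrow> nat \<Rightarrow> nat" where
  "collapse i e = (if e < 2 * i + 6 then e else e - 4)"

lemma collapse_simps [simp]:
  "collapse i inner_arc = inner_arc" "collapse i outer_arc = outer_arc"
  "collapse i left_bottom = left_bottom" "collapse i right_bottom = right_bottom"
  "j \<le> i \<Longrightarrow> collapse i (upper j) = upper j" "j \<le> i \<Longrightarrow> collapse i (lower j) = lower j"
  "i \<le> j \<Longrightarrow> collapse i (upper (Suc (Suc j))) = upper j"
  "i \<le> j \<Longrightarrow> collapse i (lower (Suc (Suc j))) = lower j"
  by (auto simp: collapse_def edge_numbers)

text \<open>Apart from the edges between the two cancelled crossings, which are gone, the
  renumbering identifies only edges that the cancellation joins. Hence it is injective once these
  have been merged.\<close>

lemma collapse_eqE: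
  assumes "u \<noteq> upper (Suc i)" "u \<noteq> lower (Suc i)" "v \<noteq> upper (Suc i)" "v \<noteq> lower (Suc i)"
    and "collapse i u = collapse i v"
  obtains "u = v" | "u = upper i" "v = upper (i + 2)" | "u = upper (i + 2)" "v = upper i"
    | "u = lower i" "v = lower (i + 2)" | "u = lower (i + 2)" "v = lower i"
proof -
  note alts = that
  have ne: "u \<noteq> 2 * i + 6" "u \<noteq> 2 * i + 7" "v \<noteq> 2 * i + 6" "v \<noteq> 2 * i + 7"
    using assms(1-4) by (simp_all add: upper_def lower_def)
  have eq: "(if u < 2 * i + 6 then u else u - 4) = (if v < 2 * i + 6 then v else v - 4)"
    using assms(5) by (simp add: collapse_def)
  have case1: thesis if "x < 2 * i + 6" "\<not> y < 2 * i + 6" "x = y - 4" "y \<noteq> 2 * i + 6" "y \<noteq> 2 * i + 7"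
    "{x, y} = {u, v}" for x y
  proof -
    have "x = 2 * i + 4 \<and> y = 2 * i + 8 \<or> x = 2 * i + 5 \<and> y = 2 * i + 9"
      using that(1-5) by arith
    then have "x = upper i \<and> y = upper (i + 2) \<or> x = lower i \<and> y = lower (i + 2)"
      by (auto simp: upper_def lower_def)
    moreover have "u = x \<and> v = y \<or> u = y \<and> v = x" using that(6) by (auto simp: doubleton_eq_iff)
    ultimately show thesis using alts by blast
  qed
  show thesis
  proof (cases "u < 2 * i + 6"; cases "v < 2 * i + 6")
    assume "u < 2 * i + 6" "v < 2 * i + 6"
    then show thesis using eq by (intro alts(1)) simp
  next
    assume "u < 2 * i + 6" "\<not> v < 2 * i + 6"
    then show thesis using eq ne by (intro case1[of u v]) simp_all
  next
    assume "\<not> u < 2 * i + 6" "v < 2 * i + 6"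
    then show thesis using eq ne by (intro case1[of v u]) auto
  next
    assume "\<not> u < 2 * i + 6" "\<not> v < 2 * i + 6"
    then have "u - 4 = v - 4" "4 \<le> u" "4 \<le> v" using eq by simp_all
    then show thesis by (intro alts(1)) linarith
  qed
qed

lemma map_vertex_crossing:
  "map_vertex f (crossing s i j k l) = crossing s (f i) (f j) (f k) (f l)"
  by (simp add: crossing_def)

text \<open>With opposite types the same strand is on top at both crossings, so the bigon between
  them opens.\<close>

lemma same_knot_skip:
  assumes m: "odd m" and i: "i \<le> m" and opp: "\<alpha> (Row i) \<noteq> \<alpha> (Row (Suc i))"
  shows "free21 (m + 2) \<alpha> \<approx> free21 m (skip i \<alpha>)"
proof -
  let ?c = "\<lambda>s. site_crossing (m + 2) (\<alpha> s) s"
  let ?rest = "map ?c ([Left, Right, Bottom] @ map Row ([0..<i] @ [i + 2..<m + 2]))"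
  let ?U = upper and ?L = lower
  have upt: "[0..<m + 2] = [0..<i] @ [i, Suc i] @ [i + 2..<m + 2]"
  proof -
    have "[0..<m + 2] = [0..<i] @ [i..<m + 2]" using i upt_add_eq_append[of 0 i "m + 2 - i"] by simp
    also have "[i..<m + 2] = [i, Suc i] @ [i + 2..<m + 2]" using i by (simp add: upt_conv_Cons)
    finally show ?thesis .
  qed
  have mset: "mset (free21 (m + 2) \<alpha>) = mset (?c (Row i) # ?c (Row (Suc i)) # ?rest)"
    unfolding free21_def sites_def upt by simp
  have kd: "knot_diagram (free21 (m + 2) \<alpha>)" "knot_diagram (free21 m (skip i \<alpha>))"
    using m by (simp_all add: knot_diagram_free21)
  have kd0: "knot_diagram (?c (Row i) # ?c (Row (Suc i)) # ?rest)"
    by (rule knot_diagram_reorder[OF mset kd(1)])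
  have "map (map_vertex (collapse i)) (map ?c [Left, Right, Bottom]) =
      map (\<lambda>s. site_crossing m (skip i \<alpha> s) s) [Left, Right, Bottom]"
    using i by (simp add: map_vertex_crossing skip_def)
  moreover have "map (map_vertex (collapse i)) (map ?c (map Row [0..<i])) =
      map (\<lambda>s. site_crossing m (skip i \<alpha> s) s) (map Row [0..<i])"
    by (simp add: map_vertex_crossing skip_def)
  moreover have "map (map_vertex (collapse i)) (map ?c (map Row [i + 2..<m + 2])) =
      map (\<lambda>s. site_crossing m (skip i \<alpha> s) s) (map Row [i..<m])"
  proof -
    have shift: "[i + 2..<m + 2] = map (\<lambda>j. j + 2) [i..<m]" by (intro nth_equalityI) (auto simp del: upt_Suc)
    show ?thesis unfolding shift by (simp add: map_vertex_crossing skip_def)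
  qed
  moreover have "[0..<m] = [0..<i] @ [i..<m]" using i upt_add_eq_append[of 0 i "m - i"] by simp
  ultimately have collapse: "map (map_vertex (collapse i)) ?rest = free21 m (skip i \<alpha>)"
    by (simp only: free21_def sites_def map_append)
  have edges_rest: "edges ?rest \<inter> {?U (Suc i), ?L (Suc i)} = {}"
    using i by (auto simp: edges_def set_ends_crossing edge_numbers)
  \<comment> \<open>The joined edges may keep the names on the left or those on the right. As
    \<open>collapse i \<circ> g = collapse i\<close>, both choices give the same code after
    renumbering.\<close>
  have merge: "map (map_vertex g) ?rest \<approx> free21 m (skip i \<alpha>)" "knot_diagram (map (map_vertex g) ?rest)"
    if g: "g = id(?U (i + 2) := ?U i, ?L (i + 2) := ?L i) \<or> g = id(?L i := ?L (i + 2), ?U i := ?U (i + 2))" for g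
  proof -
    have "collapse i (g e) = collapse i e" for e
      using g by (auto simp: collapse_def edge_numbers)
    then have cg: "collapse i \<circ> g = collapse i" by auto
    have eq: "map (map_vertex (collapse i)) (map (map_vertex g) ?rest) = free21 m (skip i \<alpha>)"
    proof -
      have "map (map_vertex (collapse i)) (map (map_vertex g) xs) = map (map_vertex (collapse i)) xs" for xs
        by (simp add: vertex.map_comp cg)
      then show ?thesis using collapse by (simp only:)
    qed
    have inj: "inj_on (collapse i) (edges (map (map_vertex g) ?rest))"
    proof (rule inj_onI)
      fix x y assume "x \<in> edges (map (map_vertex g) ?rest)" "y \<in> edges (map (map_vertex g) ?rest)"
        and c: "collapse i x = collapse i y"
      then obtain u v where uv: "u \<in> edges ?rest" "v \<in> edges ?rest" "x = g u" "y = g v"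
        unfolding edges_map_vertex by blast
      then have "u \<noteq> ?U (Suc i)" "u \<noteq> ?L (Suc i)" "v \<noteq> ?U (Suc i)" "v \<noteq> ?L (Suc i)"
        using edges_rest by auto
      moreover have "collapse i u = collapse i v" using c uv(3,4) cg by (metis comp_apply)
      ultimately show "x = y" unfolding uv(3,4)
        by (rule collapse_eqE) (use g in auto)
    qed
    show kdg: "knot_diagram (map (map_vertex g) ?rest)"
      using knot_diagram_relabel_iff[OF inj] kd(2) unfolding eq by simp
    show "map (map_vertex g) ?rest \<approx> free21 m (skip i \<alpha>)"
      using same_knot_relabel[OF inj kdg] unfolding eq .
  qed
  have start: "free21 (m + 2) \<alpha> \<approx> ?c (Row i) # ?c (Row (Suc i)) # ?rest"
    by (rule same_knot_reorder[OF mset kd(1)])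
  show ?thesis
  proof (cases "\<alpha> (Row i)")
    case True
    with opp have c: "?c (Row i) = Xing (?L i) (?L (Suc i)) (?U (Suc i)) (?U i)"
      "?c (Row (Suc i)) = Xing (?U (Suc i)) (?L (Suc i)) (?L (i + 2)) (?U (i + 2))"
      by (simp_all add: crossing_def)
    note start[unfolded c]
    also have "Xing (?L i) (?L (Suc i)) (?U (Suc i)) (?U i) #
        Xing (?U (Suc i)) (?L (Suc i)) (?L (i + 2)) (?U (i + 2)) # ?rest \<approx>
        map (map_vertex (id(?U (i + 2) := ?U i, ?L (i + 2) := ?L i))) ?rest"
      by (rule cancel_R2[OF kd0[unfolded c]]) (simp, rule merge(2), blast)
    also have "\<dots> \<approx> free21 m (skip i \<alpha>)" by (rule merge(1)) blast
    finally show ?thesis .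
  next
    \<comment> \<open>Here the pattern of \<open>R2\<close> appears only after a half turn of each
      crossing and an exchange of the two; then \<open>upper i\<close> and \<open>lower i\<close>
      are the names that disappear.\<close>
    case False
    with opp have c: "?c (Row i) = Xing (?U i) (?L i) (?L (Suc i)) (?U (Suc i))"
      "?c (Row (Suc i)) = Xing (?L (Suc i)) (?L (i + 2)) (?U (i + 2)) (?U (Suc i))"
      by (simp_all add: crossing_def)
    let ?X = "Xing (?L (Suc i)) (?U (Suc i)) (?U i) (?L i)"
      and ?Y = "Xing (?L (Suc i)) (?L (i + 2)) (?U (i + 2)) (?U (Suc i))"
      and ?Z = "Xing (?U (i + 2)) (?U (Suc i)) (?L (Suc i)) (?L (i + 2))"
    note kd0 = kd0[unfolded c] and start = start[unfolded c]
    have kd1: "knot_diagram (?X # ?Y # ?rest)" by (rule knot_diagram_rotate_Xing[OF kd0])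
    have mset1: "mset (?X # ?Y # ?rest) = mset (?Y # ?X # ?rest)" by simp
    have kd2: "knot_diagram (?Y # ?X # ?rest)" by (rule knot_diagram_reorder[OF mset1 kd1])
    have kd3: "knot_diagram (?Z # ?X # ?rest)" by (rule knot_diagram_rotate_Xing[OF kd2])
    note start
    also note same_knot_rotate_Xing[OF kd0]
    also note same_knot_reorder[OF mset1 kd1]
    also note same_knot_rotate_Xing[OF kd2]
    also have "?Z # ?X # ?rest \<approx> map (map_vertex (id(?L i := ?L (i + 2), ?U i := ?U (i + 2)))) ?rest"
      by (rule cancel_R2[OF kd3]) (simp, rule merge(2), blast)
    also have "\<dots> \<approx> free21 m (skip i \<alpha>)" by (rule merge(1)) blast
    finally show ?thesis .
  qed
qed

lemma free21_cong: "(\<And>s. s \<in> set (sites m) \<Longrightarrow> \<alpha> s = \<beta> s) \<Longrightarrow> free21 m \<alpha> = free21 m \<beta>"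
  by (simp add: free21_def)

lemma constant_list:
  assumes "\<And>i. Suc i < length xs \<Longrightarrow> xs ! i = xs ! Suc i" and "x \<in> set xs"
  shows "x = xs ! 0"
proof -
  have "xs ! i = xs ! 0" if "i < length xs" for i
    using that by (induction i) (use assms(1) in auto)
  then show ?thesis using assms(2) by (metis in_set_conv_nth)
qed

abbreviation row :: "nat \<Rightarrow> (site \<Rightarrow> bool) \<Rightarrow> bool list" where
  "row n \<alpha> \<equiv> map (\<lambda>i. \<alpha> (Row i)) [0..<n]"

text \<open>A row of both types has two neighbours of different type. Cancelling them lowers both
  counts by one, so the excess \<open>k\<close> stays, and the induction is on the size of the
  minority.\<close>

lemma same_knot_constant_row:
  assumes "odd k" and "count_list (row n \<alpha>) b = count_list (row n \<alpha>) (\<not> b) + k"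
  shows "free21 n \<alpha> \<approx> free21 k (\<lambda>s. case s of Row _ \<Rightarrow> b | _ \<Rightarrow> \<alpha> s)"
  using assms(2)
proof (induction "count_list (row n \<alpha>) (\<not> b)" arbitrary: n \<alpha>)
  case 0
  then have "(\<not> b) \<notin> set (row n \<alpha>)" by (simp add: count_list_0_iff)
  have all: "\<alpha> (Row i) = b" if "i < n" for i
  proof (rule ccontr)
    assume "\<alpha> (Row i) \<noteq> b"
    then have "(\<not> b) = \<alpha> (Row i)" by auto
    then show False using \<open>(\<not> b) \<notin> set (row n \<alpha>)\<close> that by simp
  qed
  then have "row n \<alpha> = replicate n b" by (intro nth_equalityI) auto
  then have "count_list (row n \<alpha>) b = n" by (simp add: count_list_eq_length_filter)
  then have "n = k" using 0 by simp
  have "free21 k \<alpha> = free21 k (\<lambda>s. case s of Row _ \<Rightarrow> b | _ \<Rightarrow> \<alpha> s)"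
    by (rule free21_cong) (use all \<open>n = k\<close> in \<open>auto simp: sites_def\<close>)
  then show ?case using \<open>n = k\<close> by simp
next
  case (Suc c)
  have len: "count_list xs b + count_list xs (\<not> b) = length xs" for xs by (induction xs) auto
  have n: "n = 2 * c + 2 + k" using len[of "row n \<alpha>"] Suc by simp
  define m where "m = 2 * c + k"
  have nm: "n = m + 2" using n m_def by simp
  have "\<exists>i. Suc i < n \<and> \<alpha> (Row i) \<noteq> \<alpha> (Row (Suc i))"
  proof (rule ccontr)
    assume "\<not> ?thesis"
    then have const: "x = row n \<alpha> ! 0" if "x \<in> set (row n \<alpha>)" for x
      by (intro constant_list) (use that in auto)
    have "count_list (row n \<alpha>) b \<noteq> 0" "count_list (row n \<alpha>) (\<not> b) \<noteq> 0" using Suc by auto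
    then have "b \<in> set (row n \<alpha>)" "(\<not> b) \<in> set (row n \<alpha>)" by (auto simp only: count_list_0_iff)
    from this[THEN const] show False by auto
  qed
  then obtain i where i: "Suc i < n" "\<alpha> (Row i) \<noteq> \<alpha> (Row (Suc i))" by blast
  have row: "row n \<alpha> = take i (row n \<alpha>) @ [\<alpha> (Row i), \<alpha> (Row (Suc i))] @ drop (i + 2) (row n \<alpha>)"
    using i id_take_nth_drop[of i "row n \<alpha>"] Cons_nth_drop_Suc[of "Suc i" "row n \<alpha>"] by simp
  have row': "row m (skip i \<alpha>) = take i (row n \<alpha>) @ drop (i + 2) (row n \<alpha>)"
    using i nm by (intro nth_equalityI) (auto simp: nth_append skip_def simp del: upt_Suc)
  have count: "count_list (row n \<alpha>) x = Suc (count_list (row m (skip i \<alpha>)) x)" for x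
    unfolding row' by (subst row) (use i in auto)
  have "odd m" using assms(1) m_def by simp
  then have "free21 n \<alpha> \<approx> free21 m (skip i \<alpha>)"
    unfolding nm by (rule same_knot_skip) (use i nm in auto)
  also have "\<dots> \<approx> free21 k (\<lambda>s. case s of Row _ \<Rightarrow> b | _ \<Rightarrow> skip i \<alpha> s)"
    by (rule Suc.hyps) (use Suc count in auto)
  also have "(\<lambda>s. case s of Row _ \<Rightarrow> b | _ \<Rightarrow> skip i \<alpha> s) = (\<lambda>s. case s of Row _ \<Rightarrow> b | _ \<Rightarrow> \<alpha> s)"
    by (auto simp: fun_eq_iff skip_def split: site.split)
  finally show ?case .
qed

section \<open>The bracket of the free knot\<close>

text \<open>Reflection in the diagonal through NW and SE exchanges the smoothings; it passes between
  composing crossings side by side and on top of each other.\<close>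

lemma braid_rotate: "braid p q i j k l = braid q p i k j l"
  by (auto simp: braid_def)

text \<open>The product in the Temperley-Lieb algebra on two strands: for e, a cup over a cap, e^2 =
  3 e.\<close>

lemma sum_braid_braid:
  fixes p q :: "'r::comm_ring_1"
  assumes "u < 3" "l < 3" "c < 3" "d < 3"
  shows "(\<Sum>x<3. \<Sum>y<3. braid p q u l x y * braid p' q' x y c d) =
    braid (p * p') (p * q' + q * p' + 3 * (q * q')) u l c d"
proof -
  have "(\<Sum>x<3. \<Sum>y<3. braid p q u l x y * braid p' q' x y c d) =
    (\<Sum>x<3. \<Sum>y<3. kron l y * (p * (kron u x * braid p' q' x y c d)) +
      kron x y * (q * (kron u l * braid p' q' x y c d)))"
    by (intro sum.cong refl) (simp add: braid_def algebra_simps)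
  also have "\<dots> = (\<Sum>x<3. kron u x * (p * braid p' q' x l c d) +
      (kron x c * (q * kron u l * p' * kron x d) + q * kron u l * q' * kron c d))"
    by (intro sum.cong refl) (simp only: sum.distrib sum_kron assms lessThan_iff,
        simp add: braid_def algebra_simps)
  also have "\<dots> = p * braid p' q' u l c d + q * kron u l * p' * kron c d + 3 * (q * kron u l * q' * kron c d)"
    by (simp only: sum.distrib sum_kron assms) simp
  finally show ?thesis by (simp add: braid_def algebra_simps)
qed

text \<open>The closure of two strands has two circles, that of a cup over a cap has one.\<close>

lemma sum_braid_closure: "(\<Sum>c<3. \<Sum>d<3. braid p q d c d c) = 9 * p + 3 * (q :: 'r::comm_ring_1)"
proof -
  have "(\<Sum>c<3. \<Sum>d<3. braid p q d c d c) = (\<Sum>c<3. \<Sum>d<3. p + kron c d * q)"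
    by (intro sum.cong refl) (auto simp: braid_def)
  also have "\<dots> = (\<Sum>c<3::nat. 3 * p + q)"
    by (intro sum.cong refl) (simp only: sum.distrib sum_kron lessThan_iff, simp)
  finally show ?thesis by simp
qed

lemma sum_swap_pairs:
  "(\<Sum>x\<in>X. \<Sum>y\<in>Y. \<Sum>c\<in>C. \<Sum>d\<in>D. F x y c d) =
    (\<Sum>c\<in>C. \<Sum>d\<in>D. \<Sum>x\<in>X. \<Sum>y\<in>Y. F x y c d)"
proof -
  have "(\<Sum>x\<in>X. \<Sum>y\<in>Y. \<Sum>c\<in>C. \<Sum>d\<in>D. F x y c d) =
      (\<Sum>x\<in>X. \<Sum>c\<in>C. \<Sum>y\<in>Y. \<Sum>d\<in>D. F x y c d)"
    by (intro sum.cong refl sum.swap)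
  also have "\<dots> = (\<Sum>c\<in>C. \<Sum>x\<in>X. \<Sum>d\<in>D. \<Sum>y\<in>Y. F x y c d)"
    by (subst sum.swap) (intro sum.cong refl sum.swap)
  also have "\<dots> = (\<Sum>c\<in>C. \<Sum>d\<in>D. \<Sum>x\<in>X. \<Sum>y\<in>Y. F x y c d)"
    by (intro sum.cong refl sum.swap)
  finally show ?thesis .
qed

text \<open>The row is a linear combination of two horizontal strands and of a closing of its left
  ends and its right ends.\<close>

fun row_strands :: "'r::comm_ring_1 \<Rightarrow> 'r \<Rightarrow> bool list \<Rightarrow> 'r" and
  row_caps :: "'r::comm_ring_1 \<Rightarrow> 'r \<Rightarrow> bool list \<Rightarrow> 'r" where
  "row_strands A B [] = 1"
| "row_caps A B [] = 0"
| "row_strands A B (s # ss) = row_strands A B ss * (if s then A else B)"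
| "row_caps A B (s # ss) = row_strands A B ss * (if s then B else A) +
     row_caps A B ss * (if s then A else B) + 3 * (row_caps A B ss * (if s then B else A))"

abbreviation row_edges :: "nat \<Rightarrow> nat set" where
  "row_edges m \<equiv> {0, 1, 2, 3} \<union> upper ` {..m} \<union> lower ` {..m}"

text \<open>Sums out the row. \<open>H\<close> is the weight of everything outside it, with the
  colours at the right ends as separate arguments; it is arbitrary in the induction because each
  step moves the last crossing of the row into it. As crossings are taken off at the right, the row
  appears reversed.\<close>

lemma sum_row:
  fixes H :: "(nat \<Rightarrow> nat) \<Rightarrow> nat \<Rightarrow> nat \<Rightarrow> 'r::comm_ring_1"
  assumes H: "\<And>f j c. 0 < j \<Longrightarrow> H (f(upper j := c)) = H f" "\<And>f j c. 0 < j \<Longrightarrow> H (f(lower j := c)) = H f"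
  shows "(\<Sum>f\<in>labellings (row_edges m).
      weights A B f (map (\<lambda>i. site_crossing n (\<alpha> (Row i)) (Row i)) [0..<m]) * H f (f (upper m)) (f (lower m))) =
    (\<Sum>f\<in>labellings (row_edges 0). \<Sum>c<3. \<Sum>d<3.
      braid (row_strands A B (rev (row m \<alpha>))) (row_caps A B (rev (row m \<alpha>)))
        (f (upper 0)) (f (lower 0)) c d * H f c d)"
  using H
proof (induction m arbitrary: H)
  case 0
  show ?case
  proof (rule sum.cong)
    fix f assume f: "f \<in> labellings (row_edges 0)"
    have less: "f (upper 0) < 3" "f (lower 0) < 3" by (auto intro: labellings_less[OF f])
    have "braid 1 0 (f (upper 0)) (f (lower 0)) c d * H f c d =
        kron (f (upper 0)) c * (kron (f (lower 0)) d * H f c d)" for c d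
      by (simp add: braid_def)
    then have "(\<Sum>c<3. \<Sum>d<3. braid 1 0 (f (upper 0)) (f (lower 0)) c d * H f c d) =
        (\<Sum>c<3. kron (f (upper 0)) c * (\<Sum>d<3. kron (f (lower 0)) d * H f c d))"
      by (simp only: sum_distrib_left)
    also have "\<dots> = H f (f (upper 0)) (f (lower 0))"
      by (simp only: sum_kron less)
    finally show "weights A B f (map (\<lambda>i. site_crossing n (\<alpha> (Row i)) (Row i)) [0..<0]) *
        H f (f (upper 0)) (f (lower 0)) =
      (\<Sum>c<3. \<Sum>d<3. braid (row_strands A B (rev (row 0 \<alpha>))) (row_caps A B (rev (row 0 \<alpha>)))
        (f (upper 0)) (f (lower 0)) c d * H f c d)"
      by simp
  qed simp
next
  case (Suc m)
  let ?W = "\<lambda>f m. weights A B f (map (\<lambda>i. site_crossing n (\<alpha> (Row i)) (Row i)) [0..<m])"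
  let ?P = "row_strands A B (rev (row m \<alpha>))" and ?Q = "row_caps A B (rev (row m \<alpha>))"
  let ?p = "if \<alpha> (Row m) then A else B" and ?q = "if \<alpha> (Row m) then B else A"
  let ?U = "upper (Suc m)" and ?L = "lower (Suc m)"
  define H' where "H' f x y = (\<Sum>c<3. \<Sum>d<3. braid ?p ?q x y c d * H f c d)" for f x y
  have E: "row_edges (Suc m) = insert ?L (insert ?U (row_edges m))"
    by (auto simp: atMost_Suc)
  have new: "?U \<notin> row_edges m" "?L \<notin> insert ?U (row_edges m)" by auto
  have W: "?W (f(?U := c, ?L := d)) m = ?W f m" for f c d
    by (rule weights_cong) (auto simp: edges_def set_ends_crossing)
  have last: "weight A B f (site_crossing n (\<alpha> (Row m)) (Row m)) =
      braid ?p ?q (f (upper m)) (f (lower m)) (f ?U) (f ?L)" for f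
    by (simp add: weight_crossing braid_rotate)
  have "(\<Sum>f\<in>labellings (row_edges (Suc m)). ?W f (Suc m) * H f (f ?U) (f ?L)) =
      (\<Sum>f\<in>labellings (row_edges m). \<Sum>c<3. \<Sum>d<3.
        ?W (f(?U := c, ?L := d)) (Suc m) * H (f(?U := c, ?L := d)) c d)"
    unfolding E sum_labellings_insert[OF new(2)] sum_labellings_insert[OF new(1)] by simp
  also have "\<dots> = (\<Sum>f\<in>labellings (row_edges m). ?W f m * H' f (f (upper m)) (f (lower m)))"
  proof (intro sum.cong refl)
    fix f
    have "?W (f(?U := c, ?L := d)) (Suc m) * H (f(?U := c, ?L := d)) c d =
        ?W f m * (braid ?p ?q (f (upper m)) (f (lower m)) c d * H f c d)" for c d
    proof -
      have "H (f(?U := c, ?L := d)) = H f" by (simp only: Suc.prems zero_less_Suc)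
      then show ?thesis
        using W[of f c d] by (simp add: last mult.assoc del: site_crossing.simps map_map)
    qed
    then show "(\<Sum>c<3. \<Sum>d<3. ?W (f(?U := c, ?L := d)) (Suc m) * H (f(?U := c, ?L := d)) c d) =
        ?W f m * H' f (f (upper m)) (f (lower m))"
      by (simp only: H'_def sum_distrib_left)
  qed
  also have "\<dots> = (\<Sum>f\<in>labellings (row_edges 0). \<Sum>x<3. \<Sum>y<3.
      braid ?P ?Q (f (upper 0)) (f (lower 0)) x y * H' f x y)"
  proof (rule Suc.IH)
    fix f :: "nat \<Rightarrow> nat" and j c :: nat assume "0 < j"
    then show "H' (f(upper j := c)) = H' f" "H' (f(lower j := c)) = H' f"
      by (intro ext, simp only: H'_def Suc.prems)+
  qed
  also have "\<dots> = (\<Sum>f\<in>labellings (row_edges 0). \<Sum>c<3. \<Sum>d<3.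
      braid (?P * ?p) (?P * ?q + ?Q * ?p + 3 * (?Q * ?q)) (f (upper 0)) (f (lower 0)) c d * H f c d)"
  proof (rule sum.cong[OF refl])
    fix f assume f: "f \<in> labellings (row_edges 0)"
    have less: "f (upper 0) < 3" "f (lower 0) < 3" by (auto intro: labellings_less[OF f])
    have "(\<Sum>x<3. \<Sum>y<3. braid ?P ?Q (f (upper 0)) (f (lower 0)) x y * H' f x y) =
      (\<Sum>x<3. \<Sum>y<3. \<Sum>c<3. \<Sum>d<3. braid ?P ?Q (f (upper 0)) (f (lower 0)) x y *
        braid ?p ?q x y c d * H f c d)"
      by (simp only: H'_def sum_distrib_left mult.assoc)
    also have "\<dots> = (\<Sum>c<3. \<Sum>d<3. \<Sum>x<3. \<Sum>y<3. braid ?P ?Q (f (upper 0)) (f (lower 0)) x y *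
        braid ?p ?q x y c d * H f c d)"
      by (rule sum_swap_pairs)
    also have "\<dots> = (\<Sum>c<3. \<Sum>d<3. (\<Sum>x<3. \<Sum>y<3. braid ?P ?Q (f (upper 0)) (f (lower 0)) x y *
        braid ?p ?q x y c d) * H f c d)"
      by (simp only: sum_distrib_right)
    also have "\<dots> = (\<Sum>c<3. \<Sum>d<3.
      braid (?P * ?p) (?P * ?q + ?Q * ?p + 3 * (?Q * ?q)) (f (upper 0)) (f (lower 0)) c d * H f c d)"
      by (intro sum.cong refl arg_cong2[of _ _ _ _ "(*)"] sum_braid_braid less) simp_all
    finally show "(\<Sum>x<3. \<Sum>y<3. braid ?P ?Q (f (upper 0)) (f (lower 0)) x y * H' f x y) = \<dots>" .
  qed
  also have "\<dots> = (\<Sum>f\<in>labellings (row_edges 0). \<Sum>c<3. \<Sum>d<3.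
      braid (row_strands A B (rev (row (Suc m) \<alpha>))) (row_caps A B (rev (row (Suc m) \<alpha>)))
        (f (upper 0)) (f (lower 0)) c d * H f c d)"
    by (intro sum.cong refl) simp
  finally show ?case .
qed

lemma edges_free21_row_edges: "edges (free21 m \<alpha>) = row_edges m"
proof -
  have "edges (free21 m \<alpha>) = set_mset (mset (concat (map ends (free21 m \<alpha>))))"
    by (simp add: edges_def)
  also have "\<dots> = row_edges m"
    unfolding mset_ends_free21 Let_def by (auto simp: atLeast0LessThan lessThan_Suc_atMost simp del: upt_Suc)
  finally show ?thesis .
qed

text \<open>\<open>Left\<close> and \<open>Right\<close>, joined by the two arcs, have the
  coefficients \<open>\<kappa>\<close> and \<open>\<mu>\<close>; together with \<open>Bottom\<close>
  they have \<open>P\<close> and \<open>Q\<close>. Closing this up with the row gives 9 p P + 3 (p Q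
  + q P) + 9 q Q, arranged so that p + 3 q, which is multiplicative along the row, appears as a
  factor.\<close>

lemma bracket_free21:
  fixes A B :: "'r::comm_ring_1"
  assumes "0 < m"
  defines "a \<equiv> \<lambda>s. if s then B else A" and "b \<equiv> \<lambda>s. if s then A else B"
  defines "\<kappa> \<equiv> \<lambda>\<alpha>. a (\<alpha> Left) * a (\<alpha> Right)"
    and "\<mu> \<equiv> \<lambda>\<alpha>. a (\<alpha> Left) * b (\<alpha> Right) + b (\<alpha> Left) * a (\<alpha> Right) + 3 * (b (\<alpha> Left) * b (\<alpha> Right))"
  defines "P \<equiv> \<lambda>\<alpha>. \<mu> \<alpha> * b (\<alpha> Bottom) + \<kappa> \<alpha> * a (\<alpha> Bottom) + 3 * (\<kappa> \<alpha> * b (\<alpha> Bottom))"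
    and "Q \<equiv> \<lambda>\<alpha>. \<mu> \<alpha> * a (\<alpha> Bottom)"
  defines "p \<equiv> \<lambda>\<alpha>. row_strands A B (rev (row m \<alpha>))" and "q \<equiv> \<lambda>\<alpha>. row_caps A B (rev (row m \<alpha>))"
  shows "bracket A B (free21 m \<alpha>) = 8 * (p \<alpha> * P \<alpha>) + (p \<alpha> + 3 * q \<alpha>) * (P \<alpha> + 3 * Q \<alpha>)"
proof -
  define H where "H f c d =
      braid (a (\<alpha> Left)) (b (\<alpha> Left)) (f (lower 0)) (f 2) (f 1) (f 0) *
      braid (a (\<alpha> Right)) (b (\<alpha> Right)) (f 1) (f 0) d (f 3) *
      braid (a (\<alpha> Bottom)) (b (\<alpha> Bottom)) (f 2) (f 3) (f (upper 0)) c" for f c d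
  let ?p = "p \<alpha>" and ?q = "q \<alpha>"
  have crossings: "weight A B f (crossing s i j k l) = braid (a s) (b s) (f i) (f j) (f k) (f l)" for f s i j k l
    by (simp add: weight_crossing a_def b_def)
  have weights: "weights A B f (free21 m \<alpha>) =
      weights A B f (map (\<lambda>i. site_crossing m (\<alpha> (Row i)) (Row i)) [0..<m]) * H f (f (upper m)) (f (lower m))" for f
  proof -
    have "weight A B f (site_crossing m (\<alpha> Left) Left) =
        braid (a (\<alpha> Left)) (b (\<alpha> Left)) (f (lower 0)) (f 2) (f 1) (f 0)"
      by (simp add: crossings outer_arc_def inner_arc_def left_bottom_def braid_flip(2)[of _ _ "f (Suc 0)"])
    moreover have "weight A B f (site_crossing m (\<alpha> Right) Right) =
        braid (a (\<alpha> Right)) (b (\<alpha> Right)) (f 1) (f 0) (f (lower m)) (f 3)"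
      by (simp add: crossings outer_arc_def inner_arc_def right_bottom_def braid_flip(1)[of _ _ "f 0"])
    moreover have "weight A B f (site_crossing m (\<alpha> Bottom) Bottom) =
        braid (a (\<alpha> Bottom)) (b (\<alpha> Bottom)) (f 2) (f 3) (f (upper 0)) (f (upper m))"
      by (simp add: crossings left_bottom_def right_bottom_def)
    ultimately show ?thesis
      by (simp add: free21_eq H_def mult_ac del: site_crossing.simps map_map)
  qed
  have "bracket A B (free21 m \<alpha>) = (\<Sum>f\<in>labellings (row_edges 0). \<Sum>c<3. \<Sum>d<3.
      braid ?p ?q (f (upper 0)) (f (lower 0)) c d * H f c d)"
    unfolding bracket_def edges_free21_row_edges weights p_def q_def by (rule sum_row) (simp_all add: H_def)
  also have "\<dots> = (\<Sum>c<3. \<Sum>d<3. \<Sum>f\<in>labellings (row_edges 0).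
      braid ?p ?q (f (upper 0)) (f (lower 0)) c d * H f c d)"
    by (subst sum.swap) (intro sum.cong refl sum.swap)
  also have "\<dots> = (\<Sum>c<3. \<Sum>d<3. \<Sum>l<3. \<Sum>u<3. braid ?p ?q u l c d * (\<Sum>x<3. \<Sum>y<3.
      (\<Sum>i<3. \<Sum>j<3. braid (a (\<alpha> Left)) (b (\<alpha> Left)) l x i j * braid (a (\<alpha> Right)) (b (\<alpha> Right)) i j d y) *
      braid (a (\<alpha> Bottom)) (b (\<alpha> Bottom)) x y u c))"
  proof -
    have E0: "row_edges 0 = insert 0 (insert 1 (insert 3 (insert 2 (insert (upper 0) (insert (lower 0) {})))))"
      by auto
    have new: "lower 0 \<notin> {}" "upper 0 \<notin> {lower 0}" "2 \<notin> {upper 0, lower 0}" "3 \<notin> {2, upper 0, lower 0}"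
      "1 \<notin> {3, 2, upper 0, lower 0}" "0 \<notin> {1, 3, 2, upper 0, lower 0}"
      by (simp_all add: edge_numbers)
    have empty: "labellings {} = {\<lambda>_. undefined}" by (simp add: labellings_def)
    show ?thesis
      unfolding E0 sum_labellings_insert[OF new(6)] sum_labellings_insert[OF new(5)] sum_labellings_insert[OF new(4)]
        sum_labellings_insert[OF new(3)] sum_labellings_insert[OF new(2)] sum_labellings_insert[OF new(1)] empty
      by (simp add: H_def sum_distrib_left sum_distrib_right mult.assoc)
  qed
  also have "\<dots> = (\<Sum>c<3. \<Sum>d<3. \<Sum>l<3. \<Sum>u<3. braid ?p ?q u l c d * (\<Sum>x<3. \<Sum>y<3.
      braid (\<kappa> \<alpha>) (\<mu> \<alpha>) l x d y * braid (a (\<alpha> Bottom)) (b (\<alpha> Bottom)) x y u c))"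
    by (intro sum.cong refl arg_cong2[of _ _ _ _ "(*)"]) (simp add: sum_braid_braid \<kappa>_def \<mu>_def)
  also have "\<dots> = (\<Sum>c<3. \<Sum>d<3. \<Sum>l<3. \<Sum>u<3. braid ?p ?q d c l u * braid (P \<alpha>) (Q \<alpha>) l u d c)"
  proof (intro sum.cong refl arg_cong2[of _ _ _ _ "(*)"])
    fix c d l u :: nat assume less: "c \<in> {..<3}" "d \<in> {..<3}" "l \<in> {..<3}" "u \<in> {..<3}"
    show "braid ?p ?q u l c d = braid ?p ?q d c l u"
      by (metis braid_flip)
    \<comment> \<open>The ends \<open>x\<close> and \<open>y\<close> that lead to
      \<open>Bottom\<close> are on the right of the composed clasp; a reflection brings them to its
      lower side, where \<open>Bottom\<close> can be stacked.\<close>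
    have "(\<Sum>x<3. \<Sum>y<3. braid (\<kappa> \<alpha>) (\<mu> \<alpha>) l x d y * braid (a (\<alpha> Bottom)) (b (\<alpha> Bottom)) x y u c) =
      (\<Sum>x<3. \<Sum>y<3. braid (\<mu> \<alpha>) (\<kappa> \<alpha>) l d x y * braid (a (\<alpha> Bottom)) (b (\<alpha> Bottom)) x y u c)"
      by (intro sum.cong refl arg_cong2[of _ _ _ _ "(*)"]) (rule braid_rotate)
    also have "\<dots> = braid (Q \<alpha>) (P \<alpha>) l d u c"
      using less by (subst sum_braid_braid) (simp_all add: P_def Q_def)
    also have "\<dots> = braid (P \<alpha>) (Q \<alpha>) l u d c" by (rule braid_rotate)
    finally show "(\<Sum>x<3. \<Sum>y<3. braid (\<kappa> \<alpha>) (\<mu> \<alpha>) l x d y *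
      braid (a (\<alpha> Bottom)) (b (\<alpha> Bottom)) x y u c) = braid (P \<alpha>) (Q \<alpha>) l u d c" .
  qed
  also have "\<dots> = (\<Sum>c<3. \<Sum>d<3. braid (?p * P \<alpha>) (?p * Q \<alpha> + ?q * P \<alpha> + 3 * (?q * Q \<alpha>)) d c d c)"
    by (intro sum.cong refl) (simp add: sum_braid_braid)
  also have "\<dots> = 9 * (?p * P \<alpha>) + 3 * (?p * Q \<alpha> + ?q * P \<alpha> + 3 * (?q * Q \<alpha>))"
    by (rule sum_braid_closure)
  finally show ?thesis by (simp add: algebra_simps)
qed

text \<open>Every fourth Lucas number: over the complex numbers, A^4 is the fourth power of the
  golden ratio or of its inverse. The recurrence has 7 because A^4 + B^4 = (A^2 + B^2)^2 - 2 =
  7.\<close>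

fun lucas :: "nat \<Rightarrow> int" where
  "lucas 0 = 2"
| "lucas (Suc 0) = 7"
| "lucas (Suc (Suc n)) = 7 * lucas (Suc n) - lucas n"

lemma lucas_power_sum:
  fixes x y :: "'r::comm_ring_1"
  assumes "x * y = 1" "x + y = 7"
  shows "x ^ n + y ^ n = of_int (lucas n)"
proof (induction n rule: lucas.induct)
  case (3 n)
  have "x ^ Suc (Suc n) + y ^ Suc (Suc n) =
      (x + y) * (x ^ Suc n + y ^ Suc n) - (x * y) * (x ^ n + y ^ n)"
    by (simp add: algebra_simps)
  also have "\<dots> = of_int (lucas (Suc (Suc n)))" unfolding 3 assms by simp
  finally show ?case .
qed (use assms in simp_all)

lemma row_strands_eq: "row_strands A B ss = A ^ count_list ss True * B ^ count_list ss False"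
  by (induction ss) (simp_all add: algebra_simps)

text \<open>Since e^2 = 3 e for a cup over a cap e, sending e to 3 is multiplicative. Each crossing
  contributes its value at e = 3, a kink factor.\<close>

lemma row_strands_caps_eq:
  "row_strands A B ss + 3 * row_caps A B ss = (A + 3 * B) ^ count_list ss True * (B + 3 * A) ^ count_list ss False"
proof (induction ss)
  case (Cons s ss)
  have "row_strands A B (s # ss) + 3 * row_caps A B (s # ss) =
      (row_strands A B ss + 3 * row_caps A B ss) * (if s then A + 3 * B else B + 3 * A)"
    by (simp add: algebra_simps)
  then show ?case unfolding Cons by (simp add: algebra_simps)
qed simp

lemma lucas_growth: "0 < lucas n \<and> 3 * lucas n \<le> lucas (Suc n)"
  by (induction n rule: lucas.induct) auto

lemma lucas_ge_7: "7 \<le> lucas (Suc n)"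
  by (induction n) (use lucas_growth in \<open>auto intro: order_trans simp del: lucas.simps(3)\<close>, smt (verit) lucas_growth)

text \<open>The value of the invariant for the 2 1 k knot with \<open>k = Suc j\<close>.\<close>

definition value_21 :: "nat \<Rightarrow> int" where
  "value_21 j = 2025 + 48 * (lucas (j + 3) - lucas (j + 2) - lucas j)"

text \<open>In the difference, \<open>lucas (j + 4)\<close> exceeds twice
  \<open>lucas (j + 3)\<close> by at least \<open>lucas (j + 3)\<close>, which dominates the
  negative term \<open>lucas (j + 1)\<close>.\<close>

lemma strict_mono_value_21: "strict_mono value_21"
  unfolding strict_mono_Suc_iff
proof
  fix j
  show "value_21 j < value_21 (Suc j)"
    using lucas_growth[of j] lucas_growth[of "j + 1"] lucas_growth[of "j + 2"] lucas_growth[of "j + 3"]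
    by (simp add: value_21_def numeral_eq_Suc del: lucas.simps(3))
qed

lemma value_21_gt: "9 < value_21 j"
proof -
  have "value_21 0 \<le> value_21 j" using strict_mono_value_21 by (simp add: strict_mono_less_eq)
  then show ?thesis by (simp add: value_21_def numeral_eq_Suc)
qed

text \<open>\<open>X\<close> and \<open>Y\<close> will be the k-th powers of A and B. Only their
  fourth powers survive, which is how A^4 and B^4 enter the invariant.\<close>

lemma norm_expand:
  fixes X Y :: "'r::comm_ring_1"
  assumes XY: "X * Y = 1"
  shows "(8 * (X * P) - Y ^ 3 * R) * (8 * (Y * P') - X ^ 3 * R') =
    64 * (P * P') + R * R' - 8 * (X ^ 4 * (P * R') + Y ^ 4 * (P' * R))"
proof -
  have "(8 * (X * P) - Y ^ 3 * R) * (8 * (Y * P') - X ^ 3 * R') =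
    64 * (X * Y) * (P * P') + (X * Y) ^ 3 * (R * R') - 8 * (X ^ 4 * (P * R') + Y ^ 4 * (P' * R))"
    by (simp add: algebra_simps power3_eq_cube power4_eq_xxxx)
  then show ?thesis unfolding XY by simp
qed

text \<open>The minority of the row cancels already in the coefficients, by AB = 1 and (A + 3 B) (B
  + 3 A) = 1. The sign comes from (A + 3 B)^k = (-B^3)^k with odd k.\<close>

lemma bracket_free21_majority:
  fixes A B :: "'r::idom"
  assumes AB: "A * B = 1" "A * A + B * B = -3"
    and count: "count_list (row m \<alpha>) True = count_list (row m \<alpha>) False + k" and "odd k"
  defines "a \<equiv> \<lambda>s. if s then B else A" and "b \<equiv> \<lambda>s. if s then A else B"
  defines "\<kappa> \<equiv> \<lambda>\<alpha>. a (\<alpha> Left) * a (\<alpha> Right)"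
    and "\<mu> \<equiv> \<lambda>\<alpha>. a (\<alpha> Left) * b (\<alpha> Right) + b (\<alpha> Left) * a (\<alpha> Right) + 3 * (b (\<alpha> Left) * b (\<alpha> Right))"
  defines "P \<equiv> \<lambda>\<alpha>. \<mu> \<alpha> * b (\<alpha> Bottom) + \<kappa> \<alpha> * a (\<alpha> Bottom) + 3 * (\<kappa> \<alpha> * b (\<alpha> Bottom))"
    and "Q \<equiv> \<lambda>\<alpha>. \<mu> \<alpha> * a (\<alpha> Bottom)"
  shows "bracket A B (free21 m \<alpha>) = 8 * (A ^ k * P \<alpha>) - (B ^ k) ^ 3 * (P \<alpha> + 3 * Q \<alpha>)"
proof -
  let ?F = "count_list (row m \<alpha>) False"
  have m: "0 < m" using count \<open>odd k\<close> by (cases m) (auto simp: odd_pos)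
  have cancel: "u ^ (n + k) * v ^ n = u ^ k" if "u * v = 1" for u v :: 'r and n
  proof -
    have "u ^ (n + k) * v ^ n = (u * v) ^ n * u ^ k" by (simp add: power_add power_mult_distrib mult_ac)
    then show ?thesis unfolding that by simp
  qed
  have p: "row_strands A B (rev (row m \<alpha>)) = A ^ k"
    unfolding row_strands_eq count_list_rev count by (rule cancel[OF AB(1)])
  have "(A + 3 * B) * (B + 3 * A) = 10 * (A * B) + 3 * (A * A + B * B)" by (simp add: algebra_simps)
  then have one: "(A + 3 * B) * (B + 3 * A) = 1" unfolding AB by simp
  have A3: "A + 3 * B = - (B ^ 3)" using AB by algebra
  have "row_strands A B (rev (row m \<alpha>)) + 3 * row_caps A B (rev (row m \<alpha>)) = (A + 3 * B) ^ k"
    unfolding row_strands_caps_eq count_list_rev count by (rule cancel[OF one])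
  also have "\<dots> = - ((B ^ k) ^ 3)"
    unfolding A3 power_minus_odd[OF \<open>odd k\<close>] power_mult[symmetric] mult.commute[of 3 k] ..
  finally have q: "row_strands A B (rev (row m \<alpha>)) + 3 * row_caps A B (rev (row m \<alpha>)) = - ((B ^ k) ^ 3)" .
  have "bracket A B (free21 m \<alpha>) = 8 * (row_strands A B (rev (row m \<alpha>)) * P \<alpha>) +
      (row_strands A B (rev (row m \<alpha>)) + 3 * row_caps A B (rev (row m \<alpha>))) * (P \<alpha> + 3 * Q \<alpha>)"
    unfolding P_def Q_def \<kappa>_def \<mu>_def a_def b_def by (rule bracket_free21[OF m])
  then show ?thesis unfolding q unfolding p by simp
qed

text \<open>In pairs, the values of \<open>P\<close> and of \<open>P + 3 * Q\<close> for the four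
  tops with \<open>Left\<close> and \<open>Right\<close> of equal type. In the first two pairs they
  are monomials: in the bracket such a top acts, up to a kink, as two crossings added to or taken
  from the row.\<close>

lemma top_simps:
  fixes A B :: "'r::idom"
  assumes AB: "A * B = 1" "A * A + B * B = -3"
  shows "(B * A + A * B + 3 * (A * A)) * A + B * B * B + 3 * (B * B * A) = - (A ^ 5)"
    "- (A ^ 5) + 3 * ((B * A + A * B + 3 * (A * A)) * B) = - (B ^ 3)"
    "(A * B + B * A + 3 * (B * B)) * B + A * A * A + 3 * (A * A * B) = - (B ^ 5)"
    "- (B ^ 5) + 3 * ((A * B + B * A + 3 * (B * B)) * A) = - (A ^ 3)"
    "(A * B + B * A + 3 * (B * B)) * A + A * A * B + 3 * (A * A * A) = - 6 * A"
    "- 6 * A + 3 * ((A * B + B * A + 3 * (B * B)) * B) = B ^ 7 - B ^ 3 - A ^ 5"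
    "(B * A + A * B + 3 * (A * A)) * B + B * B * A + 3 * (B * B * B) = - 6 * B"
    "- 6 * B + 3 * ((B * A + A * B + 3 * (A * A)) * A) = A ^ 7 - A ^ 3 - B ^ 5"
  using AB by algebra+

text \<open>Let k be \<open>Suc j\<close>. If the clasp opens or the three top crossings agree, the
  bracket is up to kinks that of a closed row of k, k + 2 or k - 2 crossings, and the product is 65
  - 8 (x^i + y^i) for that odd number i. This is at most 65 - 56 = 9, the value 3 * 3 of the unknot.
  The other small case has an alternating top above a row with the wrong majority.\<close>

lemma bracket_norm_majority:
  fixes A B :: "'r::idom"
  assumes AB: "A * B = 1" "A * A + B * B = -3"
    and count: "count_list (row m \<alpha>) True = count_list (row m \<alpha>) False + Suc j" and "even j"
  shows "if \<not> \<alpha> Left \<and> \<not> \<alpha> Right \<and> \<alpha> Bottom then bracket_norm A B (free21 m \<alpha>) = of_int (value_21 j)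
    else \<exists>z\<le>9. bracket_norm A B (free21 m \<alpha>) = of_int z"
proof -
  let ?k = "Suc j"
  let ?x = "A ^ 4" and ?y = "B ^ 4"
  let ?N = "bracket_norm A B (free21 m \<alpha>)"
  have BA: "B * A = 1" "B * B + A * A = -3" using AB by (simp_all add: algebra_simps)
  have k: "odd ?k" using \<open>even j\<close> by simp
  have xy: "?x * ?y = 1" "?x + ?y = 7" using AB by algebra+
  have XY: "A ^ ?k * B ^ ?k = 1" unfolding power_mult_distrib[symmetric] AB by simp
  have pow: "(A ^ ?k) ^ 4 = ?x ^ ?k" "(B ^ ?k) ^ 4 = ?y ^ ?k"
    by (simp_all only: power_mult[symmetric] mult.commute[of 4 ?k])
  have N: "?N = 64 * (P * P') + R * R' - 8 * (?x ^ ?k * (P * R') + ?y ^ ?k * (P' * R))"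
    if "bracket A B (free21 m \<alpha>) = 8 * (A ^ ?k * P) - (B ^ ?k) ^ 3 * R"
      "bracket B A (free21 m \<alpha>) = 8 * (B ^ ?k * P') - (A ^ ?k) ^ 3 * R'" for P P' R R'
    unfolding bracket_norm_def that norm_expand[OF XY] pow ..
  note Z = bracket_free21_majority[OF AB count k] bracket_free21_majority[OF BA count k]
  note L = lucas_power_sum[OF xy]
  have shift': "u ^ Suc i * v = u ^ i" if "u * v = 1" for u v :: 'r and i
    by (simp only: power_Suc2 mult.assoc that mult_1_right)
  have yx: "?y * ?x = 1" using xy(1) by (simp add: mult.commute)
  note shift = shift'[OF xy(1)] shift'[OF yx]
  \<comment> \<open>The value of x^(j - 1) + y^(j - 1); at j = 0 the exponent -1 gives x + y = 7
    again.\<close>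
  let ?e = "if j = 0 then 7 else lucas (j - 1)"
  have e: "?x ^ j * ?y + ?y ^ j * ?x = of_int ?e"
  proof (cases j)
    case 0
    then show ?thesis using xy(2) by (simp add: add.commute)
  next
    case (Suc i)
    show ?thesis unfolding Suc shift using L[of i] by simp
  qed
  have e_bounds: "7 \<le> ?e" "?e - lucas j - lucas (?k + 1) \<le> -42"
  proof -
    \<comment> \<open>Parity keeps \<open>?e\<close> away from \<open>lucas 0 = 2\<close>, for which
      the bound would fail.\<close>
    have "odd (j - 1)" if "j \<noteq> 0" using that \<open>even j\<close> by simp
    then show "7 \<le> ?e" using lucas_ge_7[of "j - 2"] by (cases j rule: lucas.cases) auto
    \<comment> \<open>-42 is (9 - 2025) / 48, and \<open>j = 0\<close> attains it as 7 - 2 -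
      47.\<close>
    show "?e - lucas j - lucas (?k + 1) \<le> -42"
    proof (cases j)
      case (Suc i)
      then show ?thesis
        using lucas_growth[of i] lucas_growth[of j] lucas_growth[of ?k] lucas_ge_7[of i]
        by (simp del: lucas.simps(3))
    qed (simp add: numeral_2_eq_2)
  qed
  have small: "\<exists>z\<le>9. ?N = of_int z" if "?N = of_int z" "z \<le> 9" for z
    using that by blast
  consider "\<alpha> Left \<noteq> \<alpha> Right" | "\<alpha> Left = True" "\<alpha> Right = True" "\<alpha> Bottom = True"
    | "\<alpha> Left = False" "\<alpha> Right = False" "\<alpha> Bottom = False"
    | "\<alpha> Left = False" "\<alpha> Right = False" "\<alpha> Bottom = True"
    | "\<alpha> Left = True" "\<alpha> Right = True" "\<alpha> Bottom = False"
    by blast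
  then show ?thesis
  proof cases
    case 1
    let ?c = "if \<alpha> Bottom then B + 3 * A else A + 3 * B" and ?c' = "if \<alpha> Bottom then A + 3 * B else B + 3 * A"
    \<comment> \<open>These vanishing sums are the coefficient \<open>\<mu>\<close>: the two
      crossings of the clasp cancel, \<open>\<kappa>\<close> becomes 1, and \<open>Bottom\<close>
      remains as a kink.\<close>
    have 0: "A * A + B * B + 3 * (A * B) = 0" "B * B + A * A + 3 * (B * A) = 0"
      "A * A + B * B + 3 * (B * A) = 0" "B * B + A * A + 3 * (A * B) = 0" using AB by algebra+
    have "bracket A B (free21 m \<alpha>) = 8 * (A ^ ?k * ?c) - (B ^ ?k) ^ 3 * ?c"
      "bracket B A (free21 m \<alpha>) = 8 * (B ^ ?k * ?c') - (A ^ ?k) ^ 3 * ?c'"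
      unfolding Z using 1 AB(1) BA(1) 0 by (cases "\<alpha> Left"; cases "\<alpha> Bottom"; simp)+
    note N = N[OF this]
    have cc: "?c * ?c' = 1" "?c' * ?c = 1" using AB by (cases "\<alpha> Bottom"; simp; algebra)+
    have "?N = 65 - 8 * (?x ^ ?k + ?y ^ ?k)" unfolding N cc by simp
    then have "?N = of_int (65 - 8 * lucas ?k)" unfolding L by simp
    moreover have "65 - 8 * lucas ?k \<le> 9" using lucas_ge_7[of j] by simp
    ultimately have "\<exists>z\<le>9. ?N = of_int z" by (rule small)
    with 1 show ?thesis by auto
  next
    case 2
    have "bracket A B (free21 m \<alpha>) = 8 * (A ^ ?k * - (A ^ 5)) - (B ^ ?k) ^ 3 * - (B ^ 3)"
      "bracket B A (free21 m \<alpha>) = 8 * (B ^ ?k * - (B ^ 5)) - (A ^ ?k) ^ 3 * - (A ^ 3)"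
      by (simp_all only: Z 2 if_True if_False top_simps[OF AB] top_simps[OF BA])
    note N = N[OF this]
    have c: "- (A ^ 5) * - (B ^ 5) = 1" "- (B ^ 3) * - (A ^ 3) = 1"
      "- (A ^ 5) * - (A ^ 3) = ?x ^ 2" "- (B ^ 5) * - (B ^ 3) = ?y ^ 2" using AB by algebra+
    have "?N = 65 - 8 * (?x ^ (?k + 2) + ?y ^ (?k + 2))" unfolding N c power_add by simp
    then have "?N = of_int (65 - 8 * lucas (?k + 2))" unfolding L by simp
    moreover have "65 - 8 * lucas (?k + 2) \<le> 9" using lucas_ge_7[of "j + 2"] by simp
    ultimately have "\<exists>z\<le>9. ?N = of_int z" by (rule small)
    with 2 show ?thesis by auto
  next
    case 3
    have "bracket A B (free21 m \<alpha>) = 8 * (A ^ ?k * - (B ^ 5)) - (B ^ ?k) ^ 3 * - (A ^ 3)"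
      "bracket B A (free21 m \<alpha>) = 8 * (B ^ ?k * - (A ^ 5)) - (A ^ ?k) ^ 3 * - (B ^ 3)"
      by (simp_all only: Z 3 if_True if_False top_simps[OF AB] top_simps[OF BA])
    note N = N[OF this]
    have c: "- (B ^ 5) * - (A ^ 5) = 1" "- (A ^ 3) * - (B ^ 3) = 1"
      "- (B ^ 5) * - (B ^ 3) = ?y * ?y" "- (A ^ 5) * - (A ^ 3) = ?x * ?x" using AB by algebra+
    have "?N = 65 - 8 * (?x ^ j * ?y + ?y ^ j * ?x)" unfolding N c mult.assoc[symmetric] shift by simp
    then have "?N = of_int (65 - 8 * ?e)" unfolding e by simp
    moreover have "65 - 8 * ?e \<le> 9" using e_bounds(1) by simp
    ultimately have "\<exists>z\<le>9. ?N = of_int z" by (rule small)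
    with 3 show ?thesis by auto
  next
    case 4
    have "bracket A B (free21 m \<alpha>) = 8 * (A ^ ?k * (- 6 * A)) - (B ^ ?k) ^ 3 * (B ^ 7 - B ^ 3 - A ^ 5)"
      "bracket B A (free21 m \<alpha>) = 8 * (B ^ ?k * (- 6 * B)) - (A ^ ?k) ^ 3 * (A ^ 7 - A ^ 3 - B ^ 5)"
      by (simp_all only: Z 4 if_True if_False top_simps[OF AB] top_simps[OF BA])
    note N = N[OF this]
    \<comment> \<open>The source of the constants in \<open>value_21\<close>: 64 * 36 - 279 = 2025
      and 8 * 6 = 48.\<close>
    have c: "- 6 * A * (- 6 * B) = 36" "(B ^ 7 - B ^ 3 - A ^ 5) * (A ^ 7 - A ^ 3 - B ^ 5) = -279"
      "- 6 * A * (A ^ 7 - A ^ 3 - B ^ 5) = -6 * (?x * ?x - ?x - ?y)"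
      "- 6 * B * (B ^ 7 - B ^ 3 - A ^ 5) = -6 * (?y * ?y - ?y - ?x)" using AB by algebra+
    have "?N = 2025 + 48 * ((?x ^ (?k + 2) + ?y ^ (?k + 2)) - (?x ^ (?k + 1) + ?y ^ (?k + 1)) - (?x ^ ?k * ?y + ?y ^ ?k * ?x))"
      unfolding N c by (simp add: algebra_simps)
    then have "?N = of_int (value_21 j)" unfolding shift L value_21_def by (simp add: numeral_eq_Suc)
    then show ?thesis using 4 by simp
  next
    case 5
    have "bracket A B (free21 m \<alpha>) = 8 * (A ^ ?k * (- 6 * B)) - (B ^ ?k) ^ 3 * (A ^ 7 - A ^ 3 - B ^ 5)"
      "bracket B A (free21 m \<alpha>) = 8 * (B ^ ?k * (- 6 * A)) - (A ^ ?k) ^ 3 * (B ^ 7 - B ^ 3 - A ^ 5)"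
      by (simp_all only: Z 5 if_True if_False top_simps[OF AB] top_simps[OF BA])
    note N = N[OF this]
    have c: "- 6 * B * (- 6 * A) = 36" "(A ^ 7 - A ^ 3 - B ^ 5) * (B ^ 7 - B ^ 3 - A ^ 5) = -279"
      "- 6 * B * (B ^ 7 - B ^ 3 - A ^ 5) = -6 * (?y * ?y - ?y - ?x)"
      "- 6 * A * (A ^ 7 - A ^ 3 - B ^ 5) = -6 * (?x * ?x - ?x - ?y)" using AB by algebra+
    have "?N = 2025 + 48 * ((?x ^ ?k * ?y) * ?y + (?y ^ ?k * ?x) * ?x - (?x ^ ?k * ?y + ?y ^ ?k * ?x) -
        (?x ^ (?k + 1) + ?y ^ (?k + 1)))"
      unfolding N c by (simp add: algebra_simps)
    then have "?N = of_int (2025 + 48 * (?e - lucas j - lucas (?k + 1)))" unfolding shift L e by simp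
    moreover have "2025 + 48 * u \<le> 9" if "u \<le> -42" for u :: int using that by simp
    note this[OF e_bounds(2)]
    ultimately have "\<exists>z\<le>9. ?N = of_int z" by (rule small)
    with 5 show ?thesis by auto
  qed
qed

section \<open>Counting assignments\<close>

text \<open>The clasp and the crossing below it alternate, and the row has \<open>k\<close> more crossings of the type
  that continues the alternation than of the other type.\<close>

definition reduces_to_21 :: "nat \<Rightarrow> bool \<Rightarrow> nat \<Rightarrow> (site \<Rightarrow> bool) \<Rightarrow> bool" where
  "reduces_to_21 n b k \<alpha> \<longleftrightarrow> \<alpha> Left = (\<not> b) \<and> \<alpha> Right = (\<not> b) \<and> \<alpha> Bottom = b \<and>
     count_list (row n \<alpha>) b = count_list (row n \<alpha>) (\<not> b) + k"

text \<open>A is i times the golden ratio and B its inverse; the square of the golden ratio and that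
  of its inverse add up to 3.\<close>

lemma ex_bracket_parameters: "\<exists>A B :: complex. A * B = 1 \<and> A * A + B * B = -3"
proof (intro exI conjI)
  let ?A = "Complex 0 ((1 + sqrt 5) / 2)" and ?B = "Complex 0 ((1 - sqrt 5) / 2)"
  have "(1 + sqrt 5) * (1 - sqrt 5) = -4" "(1 + sqrt 5) * (1 + sqrt 5) + (1 - sqrt 5) * (1 - sqrt 5) = 12"
    by (simp_all add: algebra_simps)
  then show "?A * ?B = 1" "?A * ?A + ?B * ?B = -3"
    by (simp_all add: complex_eq_iff add_divide_distrib[symmetric])
qed

text \<open>By this symmetry it suffices to evaluate rows in which \<open>True\<close>
  prevails.\<close>

lemma bracket_norm_opposite:
  fixes A B :: "'r::comm_ring_1"
  shows "bracket_norm A B (free21 m (\<lambda>s. \<not> \<alpha> s)) = bracket_norm A B (free21 m \<alpha>)"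
proof -
  have "bracket A B (free21 m (\<lambda>s. \<not> \<alpha> s)) = bracket B A (free21 m \<alpha>)" for A B :: 'r
  proof (rule bracket_eqI[OF edges_free21 edges_free21])
    have "weight A B f (crossing (\<not> s) i j k l) = weight B A f (crossing s i j k l)" for f s and i j k l :: nat
      by (simp add: weight_crossing)
    then have "weight A B f (site_crossing m (\<not> \<alpha> s) s) = weight B A f (site_crossing m (\<alpha> s) s)" for f s
      by (cases s) simp_all
    then show "weights A B f (free21 m (\<lambda>s. \<not> \<alpha> s)) = weights B A f (free21 m \<alpha>)" for f
      by (simp add: free21_def comp_def del: site_crossing.simps)
  qed
  then show ?thesis by (simp add: bracket_norm_def mult.commute)
qed

lemma count_row_opposite: "count_list (row n (\<lambda>s. \<not> \<alpha> s)) b = count_list (row n \<alpha>) (\<not> b)"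
  by (cases b) (simp_all add: count_list_eq_length_filter filter_map comp_def)

lemma bracket_norm_free21:
  fixes A B :: "'r::idom"
  assumes AB: "A * B = 1" "A * A + B * B = -3"
    and count: "count_list (row n \<alpha>) b = count_list (row n \<alpha>) (\<not> b) + Suc j" and "even j"
  shows "if reduces_to_21 n b (Suc j) \<alpha> then bracket_norm A B (free21 n \<alpha>) = of_int (value_21 j)
    else \<exists>z\<le>9. bracket_norm A B (free21 n \<alpha>) = of_int z"
proof (cases b)
  case True
  then show ?thesis using bracket_norm_majority[OF AB, where m=n and \<alpha>=\<alpha> and j=j] count \<open>even j\<close>
    by (auto simp: reduces_to_21_def split: if_splits)
next
  case False
  have "count_list (row n (\<lambda>s. \<not> \<alpha> s)) True = count_list (row n (\<lambda>s. \<not> \<alpha> s)) False + Suc j"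
    using count False unfolding count_row_opposite by simp
  from bracket_norm_majority[OF AB this \<open>even j\<close>] show ?thesis
    using count False unfolding bracket_norm_opposite by (auto simp: reduces_to_21_def split: if_splits)
qed

text \<open>An odd length excludes a tie and makes the excess odd, so \<open>j\<close>, the argument
  of \<open>value_21\<close>, is even.\<close>

lemma row_majority:
  assumes "odd n"
  obtains b j where "even j" "count_list (row n \<alpha>) b = count_list (row n \<alpha>) (\<not> b) + Suc j"
proof -
  let ?t = "count_list (row n \<alpha>) True" and ?f = "count_list (row n \<alpha>) False"
  have "count_list xs True + count_list xs False = length xs" for xs by (induction xs) auto
  from this[of "row n \<alpha>"] have n: "?t + ?f = n" by simp
  show thesis
  proof (cases "?f < ?t")
    case True
    then obtain j where j: "?t = ?f + Suc j" by (metis add_Suc_right less_imp_Suc_add)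
    moreover from j n have "n = 2 * ?f + Suc j" by simp
    then have "even j" using assms by presburger
    ultimately show thesis using that[of j True] by simp
  next
    case False
    then have "?t < ?f" using n assms by (metis even_add linorder_neqE_nat)
    then obtain j where j: "?f = ?t + Suc j" by (metis add_Suc_right less_imp_Suc_add)
    moreover from j n have "n = 2 * ?t + Suc j" by simp
    then have "even j" using assms by presburger
    ultimately show thesis using that[of j False] by simp
  qed
qed

section \<open>Alternating assignments\<close>

lemma under_over_crossing:
  "e \<in> under_ends (crossing s nw ne sw se) \<longleftrightarrow> (if s then e = ne \<or> e = sw else e = nw \<or> e = se)"
  "e \<in> over_ends (crossing s nw ne sw se) \<longleftrightarrow> (if s then e = nw \<or> e = se else e = ne \<or> e = sw)"
  by (auto simp: crossing_def)

lemma ex_free21: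
  "(\<exists>v\<in>set (free21 m \<alpha>). P v) \<longleftrightarrow> P (site_crossing m (\<alpha> Left) Left) \<or>
    P (site_crossing m (\<alpha> Right) Right) \<or> P (site_crossing m (\<alpha> Bottom) Bottom) \<or>
    (\<exists>i<m. P (site_crossing m (\<alpha> (Row i)) (Row i)))"
  unfolding free21_eq by (auto simp del: site_crossing.simps)

text \<open>At a crossing, NW and SE lie on one strand, NE and SW on the other. An edge between ends
  of the same kind forces opposite types, any other edge equal types. The edges
  \<open>inner_arc\<close>, \<open>left_bottom\<close> and the upper edges of the row already
  determine everything up to \<open>b\<close>.\<close>

lemma alternating_free21:
  assumes "0 < k"
  shows "alternating (free21 k \<alpha>) \<longleftrightarrow>
    (\<exists>b. \<alpha> Left = (\<not> b) \<and> \<alpha> Right = (\<not> b) \<and> \<alpha> Bottom = b \<and> (\<forall>i<k. \<alpha> (Row i) = b))"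
    (is "_ \<longleftrightarrow> ?R")
proof -
  let ?D = "free21 k \<alpha>"
  note numbers = inner_arc_def outer_arc_def left_bottom_def right_bottom_def
  have under: "(\<exists>v\<in>set ?D. e \<in> under_ends v) \<longleftrightarrow>
      (if \<alpha> Left then e = inner_arc \<or> e = lower 0 else e = outer_arc \<or> e = left_bottom) \<or>
      (if \<alpha> Right then e = outer_arc \<or> e = right_bottom else e = inner_arc \<or> e = lower k) \<or>
      (if \<alpha> Bottom then e = right_bottom \<or> e = upper 0 else e = left_bottom \<or> e = upper k) \<or>
      (\<exists>i<k. if \<alpha> (Row i) then e = upper (Suc i) \<or> e = lower i else e = upper i \<or> e = lower (Suc i))" for e
    by (simp only: ex_free21 site_crossing.simps under_over_crossing)
  have over: "(\<exists>v\<in>set ?D. e \<in> over_ends v) \<longleftrightarrow>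
      (if \<alpha> Left then e = outer_arc \<or> e = left_bottom else e = inner_arc \<or> e = lower 0) \<or>
      (if \<alpha> Right then e = inner_arc \<or> e = lower k else e = outer_arc \<or> e = right_bottom) \<or>
      (if \<alpha> Bottom then e = left_bottom \<or> e = upper k else e = right_bottom \<or> e = upper 0) \<or>
      (\<exists>i<k. if \<alpha> (Row i) then e = upper i \<or> e = lower (Suc i) else e = upper (Suc i) \<or> e = lower i)" for e
    by (simp only: ex_free21 site_crossing.simps under_over_crossing)
  have mem: "inner_arc \<in> edges ?D" "left_bottom \<in> edges ?D" "j \<le> k \<Longrightarrow> upper j \<in> edges ?D" for j
    unfolding edges_free21 by (simp_all add: edge_numbers)
  show ?thesis
  proof
    assume alt: "alternating ?D"
    have 1: "\<alpha> Left = \<alpha> Right"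
      using alt[unfolded alternating_def under over, rule_format, OF mem(1)]
      by (auto simp: numbers split: if_splits)
    have 2: "\<alpha> Left = (\<not> \<alpha> Bottom)"
      using alt[unfolded alternating_def under over, rule_format, OF mem(2)]
      by (auto simp: numbers split: if_splits)
    have 3: "\<alpha> (Row 0) = \<alpha> Bottom"
      using alt[unfolded alternating_def under over, rule_format, OF mem(3)[of 0]] assms
      by (auto simp: numbers split: if_splits)
    have 4: "\<alpha> (Row (Suc i)) = \<alpha> (Row i)" if "Suc i < k" for i
      using alt[unfolded alternating_def under over, rule_format, OF mem(3)[of "Suc i"]] that
      by (auto simp: numbers split: if_splits)
    have "\<alpha> (Row i) = \<alpha> Bottom" if "i < k" for i
      using that by (induction i) (use 3 4 in auto)
    then show ?R using 1 2 by auto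
  next
    assume ?R
    then obtain b where b: "\<alpha> Left = (\<not> b)" "\<alpha> Right = (\<not> b)" "\<alpha> Bottom = b" "\<And>i. i < k \<Longrightarrow> \<alpha> (Row i) = b"
      by blast
    obtain k' where k': "k = Suc k'" using assms by (cases k) auto
    show "alternating ?D" unfolding alternating_def under over
    proof
      fix e assume "e \<in> edges ?D"
      then have "e \<in> row_edges k" by (simp add: edges_free21_row_edges)
      then consider "e = 0 \<or> e = 1 \<or> e = 2 \<or> e = 3" | j where "j \<le> k" "e = upper j \<or> e = lower j" by auto
      then show "((if \<alpha> Left then e = inner_arc \<or> e = lower 0 else e = outer_arc \<or> e = left_bottom) \<or>
      (if \<alpha> Right then e = outer_arc \<or> e = right_bottom else e = inner_arc \<or> e = lower k) \<or>
      (if \<alpha> Bottom then e = right_bottom \<or> e = upper 0 else e = left_bottom \<or> e = upper k) \<or>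
      (\<exists>i<k. if \<alpha> (Row i) then e = upper (Suc i) \<or> e = lower i else e = upper i \<or> e = lower (Suc i))) \<and>
      ((if \<alpha> Left then e = outer_arc \<or> e = left_bottom else e = inner_arc \<or> e = lower 0) \<or>
      (if \<alpha> Right then e = inner_arc \<or> e = lower k else e = outer_arc \<or> e = right_bottom) \<or>
      (if \<alpha> Bottom then e = left_bottom \<or> e = upper k else e = right_bottom \<or> e = upper 0) \<or>
      (\<exists>i<k. if \<alpha> (Row i) then e = upper i \<or> e = lower (Suc i) else e = upper (Suc i) \<or> e = lower i))"
      proof cases
        case 1
        then show ?thesis using b(1-3) by (auto simp: numbers)
      next
        case 2
        \<comment> \<open>An edge of the row is an end of the crossing on its left and of the one on
          its right; at \<open>j = 0\<close> and \<open>j = k\<close> a crossing of the top stands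
          in for the missing one.\<close>
        have "j = k \<or> (\<exists>i<k. i = j)" using 2(1) by auto
        moreover have "j = 0 \<or> (\<exists>i<k. Suc i = j)" using 2(1) by (cases j) auto
        moreover have ex: "(\<exists>i<k. if \<alpha> (Row i) then P i else Q i) \<longleftrightarrow> (\<exists>i<k. if b then P i else Q i)" for P Q
          using b(4) by auto
        ultimately show ?thesis using 2(2) unfolding ex b(1-3) by (cases b) auto
      qed
    qed
  qed
qed

lemma count_row: "count_list (row n \<alpha>) x = card {i. i < n \<and> \<alpha> (Row i) = x}"
  unfolding card_nth_eq[symmetric] by (intro arg_cong[of _ _ card]) auto

lemma is_21_knot_iff:
  assumes n: "odd n" and k: "odd k"
  shows "is_21_knot k (free21 n \<alpha>) \<longleftrightarrow> (\<exists>b. reduces_to_21 n b k \<alpha>)"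
proof
  assume "\<exists>b. reduces_to_21 n b k \<alpha>"
  then obtain b where b: "reduces_to_21 n b k \<alpha>" ..
  let ?\<beta> = "\<lambda>s. case s of Row _ \<Rightarrow> b | _ \<Rightarrow> \<alpha> s"
  let ?\<gamma> = "restrict ?\<beta> (set (sites k))"
  have eq: "free21 k ?\<gamma> = free21 k ?\<beta>" by (rule free21_cong) simp
  have "free21 n \<alpha> \<approx> free21 k ?\<beta>"
    using b k by (intro same_knot_constant_row) (simp_all add: reduces_to_21_def)
  moreover have "alternating (free21 k ?\<beta>)"
    using b k by (subst alternating_free21) (auto simp: reduces_to_21_def odd_pos)
  moreover have "?\<gamma> \<in> assignments k" by (simp add: assignments_def)
  ultimately show "is_21_knot k (free21 n \<alpha>)" unfolding is_21_knot_def eq[symmetric] by blast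
next
  assume "is_21_knot k (free21 n \<alpha>)"
  then obtain \<gamma> where \<gamma>: "alternating (free21 k \<gamma>)" "free21 n \<alpha> \<approx> free21 k \<gamma>"
    unfolding is_21_knot_def by blast
  obtain b where b: "\<gamma> Left = (\<not> b)" "\<gamma> Right = (\<not> b)" "\<gamma> Bottom = b" "\<And>i. i < k \<Longrightarrow> \<gamma> (Row i) = b"
    using \<gamma>(1) k by (subst (asm) alternating_free21) (auto simp: odd_pos)
  obtain j where j: "k = Suc j" "even j" using k by (cases k) auto
  have "count_list (row k \<gamma>) b = card {..<k}" "count_list (row k \<gamma>) (\<not> b) = card ({} :: nat set)"
    unfolding count_row by (rule arg_cong[of _ _ card]; use b(4) in auto)+
  then have count: "count_list (row k \<gamma>) b = count_list (row k \<gamma>) (\<not> b) + Suc j" using j by simp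
  then have red: "reduces_to_21 k b (Suc j) \<gamma>" using b by (simp add: reduces_to_21_def)
  obtain A B :: complex where AB: "A * B = 1" "A * A + B * B = -3" using ex_bracket_parameters by blast
  have "bracket_norm A B (free21 k \<gamma>) = of_int (value_21 j)"
    using bracket_norm_free21[OF AB count j(2)] red by simp
  then have norm: "bracket_norm A B (free21 n \<alpha>) = of_int (value_21 j)"
    using bracket_norm_same_knot[OF AB \<gamma>(2)] by simp
  \<comment> \<open>Every row of odd length has a majority, so the evaluation of the invariant
    covers each assignment, whichever type prevails.\<close>
  obtain c i where c: "even i" "count_list (row n \<alpha>) c = count_list (row n \<alpha>) (\<not> c) + Suc i"
    using row_majority[OF n] .
  note N = bracket_norm_free21[OF AB c(2) c(1)]
  show "\<exists>b. reduces_to_21 n b k \<alpha>"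
  proof (cases "reduces_to_21 n c (Suc i) \<alpha>")
    case True
    then have "value_21 i = value_21 j" using N norm by simp
    then have "i = j" using strict_mono_value_21 by (simp add: strict_mono_eq)
    then show ?thesis using True j by blast
  next
    case False
    then obtain z where "z \<le> 9" "bracket_norm A B (free21 n \<alpha>) = of_int z" using N by auto
    then have "value_21 j \<le> 9" using norm by simp
    then show ?thesis using value_21_gt[of j] by simp
  qed
qed

section \<open>Counting rows with a given excess\<close>

lemma set_sites: "set (sites n) = {Left, Right, Bottom} \<union> Row ` {..<n}"
  by (auto simp: sites_def)

text \<open>Such an assignment is determined by the set of row positions of the minority type.
  Majority and minority add up to \<open>n\<close> and differ by \<open>k\<close>, so this set has
  (n - k) / 2 elements.\<close>

lemma card_reduces_to_21:
  assumes "odd n" "odd k" "k \<le> n"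
  shows "card {\<alpha> \<in> assignments n. reduces_to_21 n b k \<alpha>} = n choose ((n - k) div 2)"
proof -
  let ?X = "{\<alpha> \<in> assignments n. reduces_to_21 n b k \<alpha>}"
  let ?Y = "{S. S \<subseteq> {..<n} \<and> card S = (n - k) div 2}"
  define f where "f \<alpha> = {i. i < n \<and> \<alpha> (Row i) = (\<not> b)}" for \<alpha> :: "site \<Rightarrow> bool"
  define g where "g S = restrict (\<lambda>s. case s of Left \<Rightarrow> \<not> b | Right \<Rightarrow> \<not> b | Bottom \<Rightarrow> b
    | Row i \<Rightarrow> (if i \<in> S then \<not> b else b)) (set (sites n))" for S
  have "count_list xs b + count_list xs (\<not> b) = length xs" for xs by (induction xs) auto
  from this[of "row n \<alpha>" for \<alpha>] have len: "count_list (row n \<alpha>) b + count_list (row n \<alpha>) (\<not> b) = n" for \<alpha>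
    by simp
  have count: "count_list (row n \<alpha>) b = count_list (row n \<alpha>) (\<not> b) + k \<longleftrightarrow> card (f \<alpha>) = (n - k) div 2" for \<alpha>
  proof -
    have "even (n - k)" using assms by simp
    then obtain c where "n - k = 2 * c" by (rule evenE)
    then have "n = k + 2 * c" "(n - k) div 2 = c" using assms by simp_all
    then show ?thesis unfolding f_def count_row[symmetric] using len[of \<alpha>] by linarith
  qed
  have "bij_betw f ?X ?Y"
  proof (rule bij_betw_byWitness[where f' = g])
    show "\<forall>\<alpha>\<in>?X. g (f \<alpha>) = \<alpha>"
    proof
      fix \<alpha> assume "\<alpha> \<in> ?X"
      then have \<alpha>: "\<alpha> \<in> extensional (set (sites n))" "\<alpha> Left = (\<not> b)" "\<alpha> Right = (\<not> b)" "\<alpha> Bottom = b"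
        by (auto simp: assignments_def reduces_to_21_def PiE_def)
      show "g (f \<alpha>) = \<alpha>"
      proof (rule extensionalityI[OF _ \<alpha>(1)])
        show "g (f \<alpha>) \<in> extensional (set (sites n))" by (simp add: g_def)
        show "g (f \<alpha>) s = \<alpha> s" if "s \<in> set (sites n)" for s
          using that \<alpha>(2-4) by - (cases s; auto simp: g_def f_def set_sites)
      qed
    qed
    show fg: "\<forall>S\<in>?Y. f (g S) = S" by (auto simp: g_def f_def set_sites)
    show "f ` ?X \<subseteq> ?Y" using count by (auto simp: reduces_to_21_def) (auto simp: f_def)
    show "g ` ?Y \<subseteq> ?X"
    proof
      fix \<alpha> assume "\<alpha> \<in> g ` ?Y"
      then obtain S where S: "S \<in> ?Y" "\<alpha> = g S" by blast
      then have "card (f \<alpha>) = (n - k) div 2" using fg by auto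
      moreover have "\<alpha> \<in> assignments n" "\<alpha> Left = (\<not> b)" "\<alpha> Right = (\<not> b)" "\<alpha> Bottom = b"
        unfolding S(2) by (auto simp: g_def assignments_def set_sites)
      ultimately show "\<alpha> \<in> ?X" by (simp add: reduces_to_21_def count)
    qed
  qed
  then have "card ?X = card ?Y" by (rule bij_betw_same_card)
  also have "\<dots> = n choose ((n - k) div 2)" by (subst n_subsets) simp_all
  finally show ?thesis .
qed

lemma card_is_21_knot:
  assumes "odd n" "odd k" "k \<le> n"
  shows "card {\<alpha> \<in> assignments n. is_21_knot k (free21 n \<alpha>)} = 2 * (n choose ((n - k) div 2))"
proof -
  let ?X = "\<lambda>b. {\<alpha> \<in> assignments n. reduces_to_21 n b k \<alpha>}"
  have "{\<alpha> \<in> assignments n. is_21_knot k (free21 n \<alpha>)} = ?X True \<union> ?X False"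
    unfolding is_21_knot_iff[OF assms(1,2)] by (auto simp: ex_bool_eq)
  moreover have "finite (?X b)" for b
    by (rule finite_subset[of _ "assignments n"]) (auto simp: assignments_def intro: finite_PiE)
  moreover have "?X True \<inter> ?X False = {}" by (auto simp: reduces_to_21_def)
  ultimately show ?thesis by (simp add: card_Un_disjoint card_reduces_to_21[OF assms])
qed

lemma card_assignments: "card (assignments n) = 2 ^ (n + 3)"
proof -
  have "distinct (sites n)" by (auto simp: sites_def distinct_map inj_on_def)
  then have "card (set (sites n)) = n + 3" by (simp add: distinct_card length_sites)
  then show ?thesis by (simp add: assignments_def card_PiE)
qed

section \<open>The figure eight knot\<close>

lemma same_knot_knot_diagram: "D \<approx> D' \<Longrightarrow> knot_diagram D \<Longrightarrow> knot_diagram D'"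
  unfolding same_knot_def by (induction rule: equivclp_induct) (auto simp: knot_step_def)

lemma same_knot_rotate_Xing_at:
  assumes "knot_diagram (xs @ Xing a b c d # ys)"
  shows "xs @ Xing a b c d # ys \<approx> xs @ Xing c d a b # ys"
proof -
  have m: "mset (xs @ Xing a b c d # ys) = mset (Xing a b c d # xs @ ys)"
    "mset (Xing c d a b # xs @ ys) = mset (xs @ Xing c d a b # ys)" by simp_all
  have kd: "knot_diagram (Xing a b c d # xs @ ys)" by (rule knot_diagram_reorder[OF m(1) assms])
  note same_knot_reorder[OF m(1) assms]
  also note same_knot_rotate_Xing[OF kd]
  also note same_knot_reorder[OF m(2) knot_diagram_rotate_Xing[OF kd]]
  finally show ?thesis .
qed

text \<open>Each of the two alternating diagrams becomes the standard code by renumbering edges,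
  turning crossings by a half and reordering. That both reach it without a mirror image reflects the
  amphichirality of this knot.\<close>

lemma figure_eight_free21:
  assumes "alternating (free21 1 \<alpha>)"
  shows "free21 1 \<alpha> \<approx> figure_eight"
proof -
  obtain b where b: "\<alpha> Left = (\<not> b)" "\<alpha> Right = (\<not> b)" "\<alpha> Bottom = b" "\<alpha> (Row 0) = b"
    using assms by (subst (asm) alternating_free21) auto
  have kd: "knot_diagram (free21 1 \<alpha>)" by (rule knot_diagram_free21) simp
  let ?f = "\<lambda>xs e. (xs :: nat list) ! e"
  have relabel: "free21 1 \<alpha> \<approx> map (map_vertex (?f xs)) (free21 1 \<alpha>)"
    "knot_diagram (map (map_vertex (?f xs)) (free21 1 \<alpha>))" if "length xs = 8" "distinct xs" for xs
  proof -
    have "inj_on (?f xs) (edges (free21 1 \<alpha>))"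
      unfolding edges_free21 using that by (intro inj_on_nth) auto
    then show "free21 1 \<alpha> \<approx> map (map_vertex (?f xs)) (free21 1 \<alpha>)"
      "knot_diagram (map (map_vertex (?f xs)) (free21 1 \<alpha>))"
      using kd by (auto intro: same_knot_relabel knot_diagram_relabel)
  qed
  show ?thesis
  proof (cases b)
    case False
    \<comment> \<open>Entry e of the list is the new number of edge e, in the order
      \<open>inner_arc\<close>, \<open>outer_arc\<close>, \<open>left_bottom\<close>,
      \<open>right_bottom\<close>, \<open>upper 0\<close>, \<open>lower 0\<close>,
      \<open>upper 1\<close>, \<open>lower 1\<close>.\<close>
    have "map (map_vertex (?f [5, 1, 2, 8, 7, 4, 3, 6])) (free21 1 \<alpha>) =
        [Xing 4 2 5 1, Xing 8 6 1 5, Xing 2 7 3 8] @ Xing 7 4 6 3 # []"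
      using b False by (simp add: free21_eq crossing_def edge_numbers)
    note r = relabel[of "[5, 1, 2, 8, 7, 4, 3, 6]", unfolded this]
    have kd1: "knot_diagram ([Xing 4 2 5 1, Xing 8 6 1 5, Xing 2 7 3 8] @ Xing 7 4 6 3 # [])"
      by (rule r(2)) simp_all
    have "free21 1 \<alpha> \<approx> [Xing 4 2 5 1, Xing 8 6 1 5, Xing 2 7 3 8] @ Xing 7 4 6 3 # []"
      by (rule r(1)) simp_all
    also note rot = same_knot_rotate_Xing_at[OF kd1]
    also have "[Xing 4 2 5 1, Xing 8 6 1 5, Xing 2 7 3 8] @ Xing 6 3 7 4 # [] \<approx> figure_eight"
      by (rule same_knot_reorder[OF _ same_knot_knot_diagram[OF rot kd1]]) (simp add: figure_eight_def)
    finally show ?thesis .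
  next
    case True
    have "map (map_vertex (?f [7, 3, 2, 4, 5, 8, 1, 6])) (free21 1 \<alpha>) =
        [] @ Xing 3 8 2 7 # [Xing 7 4 6 3, Xing 5 1 4 2, Xing 8 6 1 5]"
      using b True by (simp add: free21_eq crossing_def edge_numbers)
    note r = relabel[of "[7, 3, 2, 4, 5, 8, 1, 6]", unfolded this]
    have kd1: "knot_diagram ([] @ Xing 3 8 2 7 # [Xing 7 4 6 3, Xing 5 1 4 2, Xing 8 6 1 5])"
      by (rule r(2)) simp_all
    note rot1 = same_knot_rotate_Xing_at[OF kd1]
    have kd2: "knot_diagram ([Xing 2 7 3 8] @ Xing 7 4 6 3 # [Xing 5 1 4 2, Xing 8 6 1 5])"
      using same_knot_knot_diagram[OF rot1 kd1] by simp
    note rot2 = same_knot_rotate_Xing_at[OF kd2]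
    have kd3: "knot_diagram ([Xing 2 7 3 8, Xing 6 3 7 4] @ Xing 5 1 4 2 # [Xing 8 6 1 5])"
      using same_knot_knot_diagram[OF rot2 kd2] by simp
    note rot3 = same_knot_rotate_Xing_at[OF kd3]
    have "free21 1 \<alpha> \<approx> [] @ Xing 3 8 2 7 # [Xing 7 4 6 3, Xing 5 1 4 2, Xing 8 6 1 5]"
      by (rule r(1)) simp_all
    also note rot1
    also have "[] @ Xing 2 7 3 8 # [Xing 7 4 6 3, Xing 5 1 4 2, Xing 8 6 1 5] =
        [Xing 2 7 3 8] @ Xing 7 4 6 3 # [Xing 5 1 4 2, Xing 8 6 1 5]" by simp
    also note rot2
    also have "[Xing 2 7 3 8] @ Xing 6 3 7 4 # [Xing 5 1 4 2, Xing 8 6 1 5] =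
        [Xing 2 7 3 8, Xing 6 3 7 4] @ Xing 5 1 4 2 # [Xing 8 6 1 5]" by simp
    also note rot3
    also have "[Xing 2 7 3 8, Xing 6 3 7 4] @ Xing 4 2 5 1 # [Xing 8 6 1 5] \<approx> figure_eight"
      by (rule same_knot_reorder[OF _ same_knot_knot_diagram[OF rot3 kd3]]) (simp add: figure_eight_def)
    finally show ?thesis .
  qed
qed

lemma same_knot_figure_eight_iff: "D \<approx> figure_eight \<longleftrightarrow> is_21_knot 1 D"
proof
  let ?\<gamma> = "restrict (\<lambda>s. s \<in> {Left, Right}) (set (sites 1))"
  have "?\<gamma> \<in> assignments 1" by (simp add: assignments_def)
  moreover have alt: "alternating (free21 1 ?\<gamma>)"
    by (subst alternating_free21) (auto simp: set_sites intro!: exI[of _ False])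
  moreover assume "D \<approx> figure_eight"
  then have "D \<approx> free21 1 ?\<gamma>"
    by (rule same_knot_trans[OF _ same_knot_sym[OF figure_eight_free21[OF alt]]])
  ultimately show "is_21_knot 1 D" unfolding is_21_knot_def by blast
next
  assume "is_21_knot 1 D"
  then show "D \<approx> figure_eight"
    unfolding is_21_knot_def by (blast intro: same_knot_trans figure_eight_free21)
qed

theorem theorem6p4:
  fixes n :: nat
  assumes "n \<ge> 1" and "odd n"
  shows "card (assignments n) = 2 ^ (n + 3) \<and>
    card {\<alpha> \<in> assignments n. free21 n \<alpha> \<approx> figure_eight} = 2 * (n choose ((n - 1) div 2)) \<and>
    (\<forall>k. odd k \<and> 1 \<le> k \<and> k \<le> n \<longrightarrow>
      card {\<alpha> \<in> assignments n. is_21_knot k (free21 n \<alpha>)} = 2 * (n choose ((n - k) div 2)))"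
  unfolding same_knot_figure_eight_iff
  using assms card_assignments card_is_21_knot[OF assms(2)] by simp

end
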